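(* Let $\alpha>0$ and let $U_{(\alpha)}(t)$, $0\le t\le 1$, be the stationary Ornstein--Uhlenbeck process, i.e. the centered continuous Gaussian process with covariance $G(t,s)=e^{-\alpha|t-s|}/(2\alpha)$, $s,t\in[0,1]$. Let $\psi:[0,1]\to\mathbb{R}$ be positive and twice continuously differentiable on $[0,1]$, and let $\vartheta=\int_0^1\sqrt{\psi(t)}\,dt$. Then, as $\varepsilon\to0+$, $$ \mathsf{P}\{\|U_{(\alpha)}\|_\psi\leq\varepsilon\}\sim \frac{8\alpha^{1/2}e^{\alpha/2}}{\pi^{1/2}\vartheta^{3/2}\psi^{1/8}(0)\psi^{1/8}(1)}\, \varepsilon^2 \exp\left(-\frac{\vartheta^2}{8}\varepsilon^{-2}\right). $$
   Context: For a process $X(t)$, $0\le t\le 1$, and a non-negative weight $\psi$ on $[0,1]$, $\|X\|_\psi=\left(\int_0^1X^2(t)\psi(t)\,dt\right)^{1/2}$. The notation $f(\varepsilon)\sim g(\varepsilon)$ means $f(\varepsilon)/g(\varepsilon)\to1$. $\psi^{a}(t)$ means $(\psi(t))^{a}$. *)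

theory Defs
  imports "HOL-Probability.Probability" "HOL-Library.Landau_Symbols"
begin

text \<open>Degenerate (almost surely constant) variables count as Gaussian, so that all finite
  linear combinations of a Gaussian process are covered, including the zero combination.\<close>

definition gaussian_rv :: "'a measure \<Rightarrow> ('a \<Rightarrow> real) \<Rightarrow> bool" where
  "gaussian_rv M Y \<longleftrightarrow>
     Y \<in> borel_measurable M \<and>
     ((\<exists>m. AE \<omega> in M. Y \<omega> = m) \<or>
      (\<exists>m s. s > 0 \<and> distributed M lborel Y (\<lambda>x. ennreal (normal_density m s x))))"

definition gaussian_process :: "'a measure \<Rightarrow> 't set \<Rightarrow> ('t \<Rightarrow> 'a \<Rightarrow> real) \<Rightarrow> bool" where
  "gaussian_process M T X \<longleftrightarrow>
     (\<forall>F c. finite F \<longrightarrow> F \<subseteq> T \<longrightarrow> gaussian_rv M (\<lambda>\<omega>. \<Sum>t\<in>F. c t * X t \<omega>))"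

text \<open>Continuity is required of every sample path: for merely almost surely continuous paths
  the small ball events need not be measurable unless the measure is complete.\<close>

definition stationary_OU_process :: "'a measure \<Rightarrow> real \<Rightarrow> (real \<Rightarrow> 'a \<Rightarrow> real) \<Rightarrow> bool" where
  "stationary_OU_process M \<alpha> U \<longleftrightarrow>
     gaussian_process M {0..1} U \<and>
     (\<forall>\<omega>\<in>space M. continuous_on {0..1} (\<lambda>t. U t \<omega>)) \<and>
     (\<forall>t\<in>{0..1}. (\<integral>\<omega>. U t \<omega> \<partial>M) = 0) \<and>
     (\<forall>t\<in>{0..1}. \<forall>s\<in>{0..1}.
        (\<integral>\<omega>. U t \<omega> * U s \<omega> \<partial>M) = exp (- \<alpha> * \<bar>t - s\<bar>) / (2 * \<alpha>))"

definition weighted_norm :: "(real \<Rightarrow> real) \<Rightarrow> (real \<Rightarrow> real) \<Rightarrow> real" where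
  "weighted_norm \<psi> x = sqrt (LBINT t:{0..1}. (x t)\<^sup>2 * \<psi> t)"

text \<open>Derivatives are taken within \<open>S\<close>, hence are one-sided at the endpoints of an interval.\<close>

definition twice_continuously_differentiable_on :: "(real \<Rightarrow> real) \<Rightarrow> real set \<Rightarrow> bool" where
  "twice_continuously_differentiable_on f S \<longleftrightarrow>
     (\<exists>f' f''. (\<forall>t\<in>S. (f has_real_derivative f' t) (at t within S)) \<and>
               (\<forall>t\<in>S. (f' has_real_derivative f'' t) (at t within S)) \<and>
               continuous_on S f'')"

end

theory Submission
  imports Defs "HOL-Real_Asymp.Real_Asymp"
begin

text \<open>
  Let \<open>X\<close> be the squared weighted norm, \<open>L s\<close> its Laplace transform and \<open>F\<close> its distribution
  function. Three ingredients give the sharp asymptotics of \<open>F\<close> at \<open>0\<close>.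

  (1) \<open>L s\<close> is asymptotic to \<open>C * s powr (-1/4) * exp (- a * sqrt s)\<close> with \<open>a = \<theta> / sqrt 2\<close>. On a
  grid the process is a Gaussian autoregression, and the Laplace transform of a weighted sum of
  squares is computed by eliminating one variable at a time. In the limit the expectation of
  \<open>exp (- (\<integral> q U\<^sup>2) / 2)\<close> is expressed by a positive solution of \<open>y'' = (\<alpha>\<^sup>2 + q) y\<close> with
  \<open>y' 1 = - \<alpha> * y 1\<close>. For the Liouville--Green functions the weight \<open>q\<close> differs from \<open>2 s \<psi>\<close> by
  a function that stays bounded as \<open>s\<close> grows, so \<open>L s\<close> is squeezed between the explicit values
  at \<open>s + k\<close> and \<open>s - k\<close>.

  (2) \<open>F\<close> is log-concave, by the Prekopa--Leindler inequality applied to the same autoregression.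

  (3) A Tauberian theorem: the exponentially tilted and rescaled densities
  \<open>exp (- s * x) * F x\<close> have moment generating functions converging to a Gaussian one, hence
  converge weakly, and for log-concave densities weak convergence implies pointwise convergence.
  Real asymptotics of \<open>L\<close> alone would not determine \<open>F\<close> up to asymptotic equivalence; log-concavity
  supplies the missing regularity.
\<close>

section \<open>The Prekopa--Leindler inequality\<close>

text \<open>The process is known only through its finite-dimensional laws: neither independent
  innovations nor conditional expectations are given. Conditioning is therefore replaced by an
  orthogonality relation tested on characters, to which Gaussian squares reduce as mixtures. Two
  discretisations occur: sampling \<open>\<psi>\<close> itself gives log-concavity but no closed
  Laplace transform, while weights computed from an explicit solution give a closed transform and
  match the wanted integrand only in the limit.

  The constants come from a saddle point. The transform of \<open>F\<close> is
  \<open>L s / s\<close>, of order \<open>s powr (-5/4) * exp (- a * sqrt s)\<close>, and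
  \<open>s * x - a * sqrt s\<close> is minimal at \<open>s = a^2 / (4 * x^2)\<close> with value
  \<open>- a^2 / (4 * x)\<close>, which is \<open>- \<theta>^2 / (8 * \<epsilon>^2)\<close> for
  \<open>x = \<epsilon>^2\<close>. There \<open>s powr (-5/4)\<close> is of order
  \<open>x powr (5/2)\<close>, the tilted law has width of order \<open>x powr (3/2)\<close>, and
  the quotient is the factor \<open>\<epsilon>^2\<close> of the theorem.\<close>

lemma weighted_am_gm:
  fixes x y t :: real
  assumes "0 \<le> x" "0 \<le> y" "0 < t" "t < 1"
  shows "x powr (1 - t) * y powr t \<le> (1 - t) * x + t * y"
  using Youngs_inequality_0[of "1-t" t x y] assms by (cases "x = 0 \<or> y = 0") (auto simp: order.order_iff_strict)

text \<open>Translates of \<open>(1 - t) * A\<close> and \<open>t * B\<close> fit inside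
  \<open>C\<close> so that they meet in at most one point: combine the points of \<open>A\<close>
  below \<open>a\<close> with the fixed \<open>b\<close>, and the points of \<open>B\<close> above
  \<open>b\<close> with the fixed \<open>a\<close>. Letting \<open>a\<close> approach the supremum
  of \<open>A\<close> and \<open>b\<close> the infimum of \<open>B\<close> exhausts both sets.
  \<open>C\<close> is any Borel set containing the combinations, since the set of combinations need
  not be Borel.\<close>

lemma real_brunn_minkowski:
  fixes A B C :: "real set"
  assumes [measurable]: "A \<in> sets borel" "B \<in> sets borel" "C \<in> sets borel"
    and "A \<noteq> {}" "B \<noteq> {}" and t: "0 < t" "t < 1"
    and sub: "\<And>a b. a \<in> A \<Longrightarrow> b \<in> B \<Longrightarrow> (1 - t) * a + t * b \<in> C"
  shows "ennreal (1 - t) * emeasure lborel A + ennreal t * emeasure lborel B \<le> emeasure lborel C"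
proof -
  have scale: "emeasure lborel ((\<lambda>x. d + c * x) -` S) * ennreal c = emeasure lborel S"
    if [measurable]: "S \<in> sets borel" and "c > 0" for S and c d :: real
  proof -
    have "emeasure lborel S = (\<integral>\<^sup>+x. indicator S x \<partial>lborel)" by simp
    also have "\<dots> = \<bar>c\<bar> * (\<integral>\<^sup>+x. indicator S (d + c * x) \<partial>lborel)"
      by (rule nn_integral_real_affine) (use that in auto)
    also have "(\<integral>\<^sup>+x. indicator S (d + c * x) \<partial>lborel) = (\<integral>\<^sup>+x. indicator ((\<lambda>x. d + c * x) -` S) x \<partial>lborel)"
      by (simp add: indicator_vimage)
    also have "\<dots> = emeasure lborel ((\<lambda>x. d + c * x) -` S)"
      by (rule nn_integral_indicator) (use measurable_sets_borel[of "\<lambda>x. d + c * x" borel S] that in simp)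
    finally show ?thesis using that by (simp add: mult.commute)
  qed
  have part: "ennreal (1 - t) * emeasure lborel (A \<inter> {..a}) + ennreal t * emeasure lborel (B \<inter> {b..})
      \<le> emeasure lborel C" if ab: "a \<in> A" "b \<in> B" for a b
  proof -
    \<comment> \<open>\<open>P\<close> is \<open>(1 - t) * (A \<inter> {..a}) + t * b\<close> and
      \<open>Q\<close> is \<open>(1 - t) * a + t * (B \<inter> {b..})\<close>, written as preimages
      to make measurability immediate; they lie on opposite sides of \<open>?m\<close>.\<close>
    define P where "P = (\<lambda>x. - (t * b) / (1 - t) + 1 / (1 - t) * x) -` (A \<inter> {..a})"
    define Q where "Q = (\<lambda>x. - ((1 - t) * a) / t + 1 / t * x) -` (B \<inter> {b..})"
    let ?m = "(1 - t) * a + t * b"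
    have [measurable]: "P \<in> sets borel" "Q \<in> sets borel"
      unfolding P_def Q_def
      by (auto intro!: measurable_sets_borel[of _ borel])
    have eP: "emeasure lborel P = ennreal (1 - t) * emeasure lborel (A \<inter> {..a})"
    proof -
      have "emeasure lborel P * ennreal (1 / (1 - t)) = emeasure lborel (A \<inter> {..a})"
        unfolding P_def by (rule scale) (use t in auto)
      then have "ennreal (1 - t) * emeasure lborel (A \<inter> {..a}) = emeasure lborel P * (ennreal (1 / (1 - t)) * ennreal (1 - t))"
        by (metis mult.assoc mult.commute)
      also have "ennreal (1 / (1 - t)) * ennreal (1 - t) = 1" using t by (simp flip: ennreal_mult')
      finally show ?thesis by simp
    qed
    have eQ: "emeasure lborel Q = ennreal t * emeasure lborel (B \<inter> {b..})"
    proof -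
      have "emeasure lborel Q * ennreal (1 / t) = emeasure lborel (B \<inter> {b..})"
        unfolding Q_def by (rule scale) (use t in auto)
      then have "ennreal t * emeasure lborel (B \<inter> {b..}) = emeasure lborel Q * (ennreal (1 / t) * ennreal t)"
        by (metis mult.assoc mult.commute)
      also have "ennreal (1 / t) * ennreal t = 1" using t by (simp flip: ennreal_mult')
      finally show ?thesis by simp
    qed
    have PC: "P \<subseteq> C"
    proof
      fix x assume "x \<in> P"
      then have "(x - t * b) / (1 - t) \<in> A" by (auto simp: P_def diff_divide_distrib)
      from sub[OF this ab(2)] show "x \<in> C" using t by simp
    qed
    have QC: "Q \<subseteq> C"
    proof
      fix x assume "x \<in> Q"
      then have "(x - (1 - t) * a) / t \<in> B" by (auto simp: Q_def diff_divide_distrib)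
      from sub[OF ab(1) this] t show "x \<in> C" using t by simp
    qed
    have P1: "x \<le> ?m" if "x \<in> P" for x
    proof -
      have "(x - t * b) / (1 - t) \<le> a" using that by (auto simp: P_def diff_divide_distrib)
      then show ?thesis using t by (simp add: pos_divide_le_eq algebra_simps)
    qed
    have Q1: "?m \<le> x" if "x \<in> Q" for x
    proof -
      have "b \<le> (x - (1 - t) * a) / t" using that by (auto simp: Q_def diff_divide_distrib)
      then show ?thesis using t by (simp add: pos_le_divide_eq algebra_simps)
    qed
    have "emeasure lborel P + emeasure lborel Q = emeasure lborel (P - {?m}) + emeasure lborel Q"
    proof -
      have "{?m} \<in> null_sets lborel" by (intro null_setsI) auto
      then show ?thesis by (simp only: emeasure_Diff_null_set sets_lborel \<open>P \<in> sets borel\<close>)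
    qed
    also have "\<dots> = emeasure lborel ((P - {?m}) \<union> Q)"
      by (rule plus_emeasure) (use P1 Q1 in force)+
    also have "\<dots> \<le> emeasure lborel C"
      by (rule emeasure_mono) (use PC QC in auto)
    finally show ?thesis by (simp add: eP eQ)
  qed
  \<comment> \<open>The supremum may be infinite or not attained, so the cut points run through
    elements of the set: running maxima of a countable cofinal subset, obtained by choosing an
    element above each rational that has one.\<close>
  have exA: "\<exists>a. range a \<subseteq> A \<and> (\<lambda>n. emeasure lborel (A \<inter> {..a n::real})) \<longlonglongrightarrow> emeasure lborel A"
    if [measurable]: "A \<in> sets borel" and "A \<noteq> {}" for A
  proof (cases "\<exists>m\<in>A. \<forall>x\<in>A. x \<le> m")
    case True
    then obtain m where "m \<in> A" "\<forall>x\<in>A. x \<le> m" by blast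
    then have "A \<inter> {..m} = A" by auto
    then show ?thesis using \<open>m \<in> A\<close> by (intro exI[of _ "\<lambda>_. m"]) auto
  next
    case False
    then have F: "\<exists>y\<in>A. x < y" if "x \<in> A" for x using that by force
    have "\<exists>C. countable C \<and> C \<subseteq> A \<and> (\<forall>x\<in>A. \<exists>c\<in>C. x < c)"
    proof -
      have "\<exists>c\<in>A. q < c" if "q \<in> {q\<in>\<rat>. \<exists>c\<in>A. q < c}" for q using that by auto
      then obtain f where f: "\<And>q. q \<in> {q\<in>\<rat>. \<exists>c\<in>A. q < c} \<Longrightarrow> f q \<in> A \<and> q < f q" by metis
      have "\<forall>x\<in>A. \<exists>c\<in>f ` {q\<in>\<rat>. \<exists>c\<in>A. q < c}. x < c"
      proof
        fix x assume "x \<in> A"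
        then obtain y where y: "y \<in> A" "x < y" using F by blast
        obtain q where q: "q \<in> \<rat>" "x < q" "q < y" using Rats_dense_in_real[OF y(2)] by blast
        then have "q \<in> {q\<in>\<rat>. \<exists>c\<in>A. q < c}" using y by auto
        then show "\<exists>c\<in>f ` {q\<in>\<rat>. \<exists>c\<in>A. q < c}. x < c" using f[of q] q by force
      qed
      then show ?thesis
        using f countable_rat by (intro exI[of _ "f ` {q\<in>\<rat>. \<exists>c\<in>A. q < c}"]) (auto intro: countable_subset)
    qed
    then obtain C where C: "countable C" "C \<subseteq> A" "\<forall>x\<in>A. \<exists>c\<in>C. x < c" by blast
    then have "C \<noteq> {}" using that by auto
    then have r: "range (from_nat_into C) = C" using C(1) by (simp add: range_from_nat_into)
    define a where "a n = Max (from_nat_into C ` {..n})" for n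
    have aA: "a n \<in> A" for n
    proof -
      have "a n \<in> from_nat_into C ` {..n}" unfolding a_def by (rule Max_in) auto
      then show ?thesis using r C(2) by blast
    qed
    have "mono a" unfolding a_def by (intro monoI Max_mono) auto
    have "incseq (\<lambda>n. A \<inter> {..a n})" using monoD[OF \<open>mono a\<close>] by (fastforce simp: incseq_def)
    then have "(\<lambda>n. emeasure lborel (A \<inter> {..a n})) \<longlonglongrightarrow> emeasure lborel (\<Union>n. A \<inter> {..a n})"
      by (intro Lim_emeasure_incseq) auto
    also have "(\<Union>n. A \<inter> {..a n}) = A"
    proof -
      have "\<exists>n. x \<le> a n" if x: "x \<in> A" for x
      proof -
        obtain c where c: "c \<in> C" "x < c" using C(3) x by blast
        obtain n where "from_nat_into C n = c" using from_nat_into_surj[OF C(1) c(1)] by blast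
        with c have "x < from_nat_into C n" by simp
        also have "\<dots> \<le> a n" unfolding a_def by (rule Max_ge) auto
        finally show ?thesis using less_imp_le by blast
      qed
      then show ?thesis by auto
    qed
    finally show ?thesis using aA by blast
  qed
  obtain a where a: "range a \<subseteq> A" "(\<lambda>n. emeasure lborel (A \<inter> {..a n})) \<longlonglongrightarrow> emeasure lborel A"
    using exA[of A] assms by auto
  \<comment> \<open>Reflection turns the approximation of the infimum of \<open>B\<close> into the
    case just treated.\<close>
  have neg: "emeasure lborel (uminus -` S) = emeasure lborel S" if [measurable]: "S \<in> sets borel" for S :: "real set"
  proof -
    have "emeasure lborel S = (\<integral>\<^sup>+x. indicator S x \<partial>lborel)" by simp
    also have "\<dots> = \<bar>-1::real\<bar> * (\<integral>\<^sup>+x. indicator S (0 + (-1) * x) \<partial>lborel)"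
      by (rule nn_integral_real_affine) auto
    also have "\<dots> = (\<integral>\<^sup>+x. indicator (uminus -` S) x \<partial>lborel)"
      by (simp add: indicator_vimage)
    also have "\<dots> = emeasure lborel (uminus -` S)"
      by (rule nn_integral_indicator) (use measurable_sets_borel[of "uminus" borel S] that in simp)
    finally show ?thesis by simp
  qed
  have "uminus -` B \<in> sets borel" using measurable_sets_borel[of "uminus" borel B] assms by simp
  moreover have "uminus -` B \<noteq> {}" using assms(5) by (metis ex_in_conv minus_minus vimageI)
  ultimately obtain b where b: "range b \<subseteq> uminus -` B"
    "(\<lambda>n. emeasure lborel (uminus -` B \<inter> {..b n})) \<longlonglongrightarrow> emeasure lborel (uminus -` B)"
    using exA[of "uminus -` B"] by auto
  have eq: "uminus -` B \<inter> {..b n} = uminus -` (B \<inter> {- b n..})" for n by auto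
  have b2: "(\<lambda>n. emeasure lborel (B \<inter> {- b n..})) \<longlonglongrightarrow> emeasure lborel B"
  proof -
    have "emeasure lborel (uminus -` (B \<inter> {- b n..})) = emeasure lborel (B \<inter> {- b n..})" for n
      by (rule neg) simp
    moreover have "emeasure lborel (uminus -` B) = emeasure lborel B" by (rule neg) simp
    ultimately show ?thesis using b(2) unfolding eq by presburger
  qed
  have "(\<lambda>n. ennreal (1 - t) * emeasure lborel (A \<inter> {..a n}) + ennreal t * emeasure lborel (B \<inter> {- b n..}))
     \<longlonglongrightarrow> ennreal (1 - t) * emeasure lborel A + ennreal t * emeasure lborel B"
    by (intro tendsto_add ennreal_tendsto_cmult a b2) auto
  then show ?thesis
    by (rule LIMSEQ_le_const2) (use part a(1) b(1) in blast)
qed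

lemma nn_integral_layer_cake:
  fixes f :: "real \<Rightarrow> real"
  assumes [measurable]: "f \<in> borel_measurable lborel"
  shows "(\<integral>\<^sup>+x. ennreal (f x) \<partial>lborel) = (\<integral>\<^sup>+r. emeasure lborel {x. f x > r} * indicator {0<..} r \<partial>lborel)"
proof -
  have "(\<integral>\<^sup>+x. ennreal (f x) \<partial>lborel) = (\<integral>\<^sup>+x. \<integral>\<^sup>+r. indicator {(x, r). 0 < r \<and> r < f x} (x, r) \<partial>lborel \<partial>lborel)"
  proof (intro nn_integral_cong)
    fix x :: real
    have "(\<integral>\<^sup>+r. indicator {(x, r). 0 < r \<and> r < f x} (x, r) \<partial>lborel) = (\<integral>\<^sup>+r. indicator {0<..<f x} r \<partial>lborel)"
      by (intro nn_integral_cong) (auto simp: indicator_def)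
    also have "\<dots> = ennreal (f x)" by (cases "0 \<le> f x") (auto simp: ennreal_neg)
    finally show "ennreal (f x) = (\<integral>\<^sup>+r. indicator {(x, r). 0 < r \<and> r < f x} (x, r) \<partial>lborel)" by simp
  qed
  also have "\<dots> = (\<integral>\<^sup>+r. \<integral>\<^sup>+x. indicator {(x, r). 0 < r \<and> r < f x} (x, r) \<partial>lborel \<partial>lborel)"
    by (rule lborel_pair.Fubini'[symmetric]) measurable
  also have "\<dots> = (\<integral>\<^sup>+r. emeasure lborel {x. f x > r} * indicator {0<..} r \<partial>lborel)"
  proof (intro nn_integral_cong)
    fix r :: real
    have "(\<integral>\<^sup>+x. indicator {(x, r). 0 < r \<and> r < f x} (x, r) \<partial>lborel)
       = (\<integral>\<^sup>+x. indicator {x. f x > r} x * indicator {0<..} r \<partial>lborel)"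
      by (intro nn_integral_cong) (auto simp: indicator_def)
    also have "\<dots> = emeasure lborel {x. f x > r} * indicator {0<..} r"
      by (subst nn_integral_multc) auto
    finally show "(\<integral>\<^sup>+x. indicator {(x, r). 0 < r \<and> r < f x} (x, r) \<partial>lborel)
       = emeasure lborel {x. f x > r} * indicator {0<..} r" .
  qed
  finally show ?thesis .
qed

lemma measurable_emeasure_superlevel [measurable]:
  fixes f :: "real \<Rightarrow> real"
  assumes [measurable]: "f \<in> borel_measurable borel"
  shows "(\<lambda>r. emeasure lborel {x. f x > r}) \<in> borel_measurable borel"
proof -
  have "{p \<in> space (borel \<Otimes>\<^sub>M lborel). f (snd p) > fst p} \<in> sets (borel \<Otimes>\<^sub>M lborel)" by measurable
  then have "{(r, x). f x > r} \<in> sets (borel \<Otimes>\<^sub>M lborel)"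
    by (simp add: space_pair_measure case_prod_unfold)
  from lborel.measurable_emeasure_Pair[OF this] show ?thesis by (simp add: vimage_def)
qed

text \<open>Dividing \<open>f\<close> and \<open>g\<close> by their suprema makes the superlevel
  sets of both nonempty for the same levels \<open>0 < r < 1\<close>, as Brunn--Minkowski demands;
  the bound \<open>K\<close> keeps the suprema finite. Integrating over the levels gives an
  arithmetic mean of the normalised integrals, which dominates the geometric mean, and the
  normalising factors cancel against \<open>c\<close>.\<close>

lemma prekopa_leindler_real:
  fixes f g h :: "real \<Rightarrow> real"
  assumes int: "integrable lborel f" "integrable lborel g" "integrable lborel h"
    and nonneg: "\<And>x. 0 \<le> f x" "\<And>x. 0 \<le> g x" "\<And>x. 0 \<le> h x"
    and bound: "\<And>x. f x \<le> K" "\<And>x. g x \<le> K"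
    and t: "0 < t" "t < 1"
    and hyp: "\<And>x y. f x powr (1 - t) * g y powr t \<le> h ((1 - t) * x + t * y)"
  shows "(\<integral>x. f x \<partial>lborel) powr (1 - t) * (\<integral>x. g x \<partial>lborel) powr t \<le> (\<integral>x. h x \<partial>lborel)"
proof (cases "(\<forall>x. f x = 0) \<or> (\<forall>x. g x = 0)")
  case True
  moreover have "0 \<le> (\<integral>x. h x \<partial>lborel)" using nonneg by simp
  ultimately show ?thesis by auto
next
  case False
  have [measurable]: "f \<in> borel_measurable borel" "g \<in> borel_measurable borel" "h \<in> borel_measurable borel"
    using int by (auto dest: borel_measurable_integrable)
  define a where "a = (SUP x. f x)"
  define b where "b = (SUP x. g x)"
  define c where "c = a powr (1 - t) * b powr t"
  have bdd: "bdd_above (range f)" "bdd_above (range g)" using bound by (auto intro!: bdd_aboveI)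
  have le: "f x \<le> a" "g x \<le> b" for x unfolding a_def b_def by (auto intro!: cSUP_upper bdd)
  obtain x y where "f x \<noteq> 0" "g y \<noteq> 0" using False by auto
  then have pos: "a > 0" "b > 0" using le(1)[of x] le(2)[of y] nonneg(1)[of x] nonneg(2)[of y] by linarith+
  then have c: "c > 0" by (simp add: c_def)
  have key: "ennreal (1 - t) * (emeasure lborel {x. f x / a > r} * indicator {0<..} r)
     + ennreal t * (emeasure lborel {x. g x / b > r} * indicator {0<..} r)
      \<le> emeasure lborel {x. h x / c > r} * indicator {0<..} r" for r
  proof (cases "0 < r \<and> r < 1")
    case False
    then have "r \<le> 0 \<or> r \<ge> 1" by auto
    then show ?thesis
    proof
      assume r: "r \<ge> 1"
      have "\<not> r < f x / a" "\<not> r < g x / b" for x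
        using r le[of x] pos divide_le_eq_1_pos[of a "f x"] divide_le_eq_1_pos[of b "g x"] by linarith+
      then show ?thesis by simp
    qed simp
  next
    case True
    have exf: "\<exists>x. r < f x / a"
    proof -
      have "r * a < (SUP x. f x)" using True pos by (simp add: a_def[symmetric])
      then obtain x where "r * a < f x" by (subst (asm) less_cSUP_iff) (use bdd in auto)
      then show ?thesis using pos by (auto simp: field_simps)
    qed
    have exg: "\<exists>x. r < g x / b"
    proof -
      have "r * b < (SUP x. g x)" using True pos by (simp add: b_def[symmetric])
      then obtain x where "r * b < g x" by (subst (asm) less_cSUP_iff) (use bdd in auto)
      then show ?thesis using pos by (auto simp: field_simps)
    qed
    have sub: "(1 - t) * x + t * y \<in> {x. h x / c > r}"
      if "x \<in> {x. f x / a > r}" "y \<in> {x. g x / b > r}" for x y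
    proof -
      have 1: "r * a < f x" "r * b < g y" using that pos by (auto simp: field_simps)
      have "r * c = (r * a) powr (1 - t) * (r * b) powr t"
        using True pos t by (simp add: c_def powr_mult) (simp add: mult_ac flip: powr_add)
      also have "\<dots> < f x powr (1 - t) * g y powr t"
      proof (rule mult_strict_mono)
        have "0 < r * a" "0 < r * b" using True pos by auto
        then show "(r * a) powr (1 - t) < f x powr (1 - t)" "(r * b) powr t < g y powr t"
          using 1 t by (simp_all add: powr_less_mono2)
        show "0 < f x powr (1 - t)" using 1 \<open>0 < r * a\<close> by simp
      qed simp
      also have "\<dots> \<le> h ((1 - t) * x + t * y)" by (rule hyp)
      finally show ?thesis using c by (simp add: field_simps)
    qed
    have "ennreal (1 - t) * emeasure lborel {x. f x / a > r} + ennreal t * emeasure lborel {x. g x / b > r}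
      \<le> emeasure lborel {x. h x / c > r}"
      using exf exg by (intro real_brunn_minkowski t sub) auto
    then show ?thesis using True by simp
  qed
  have nn: "(\<integral>\<^sup>+x. ennreal (u x / d) \<partial>lborel) = ennreal ((\<integral>x. u x \<partial>lborel) / d)"
    if "integrable lborel u" "\<And>x. 0 \<le> u x" "d > 0" for u :: "real \<Rightarrow> real" and d
    using that by (subst nn_integral_eq_integral) auto
  have I0: "0 \<le> (\<integral>x. f x \<partial>lborel)" "0 \<le> (\<integral>x. g x \<partial>lborel)" "0 \<le> (\<integral>x. h x \<partial>lborel)"
    using nonneg by auto
  have lc: "(\<integral>\<^sup>+x. ennreal (u x / d) \<partial>lborel) = (\<integral>\<^sup>+r. emeasure lborel {x. u x / d > r} * indicator {0<..} r \<partial>lborel)"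
    if "u \<in> borel_measurable borel" for u :: "real \<Rightarrow> real" and d
    by (rule nn_integral_layer_cake) (use that in measurable)
  have [measurable]: "(\<lambda>r. emeasure lborel {x. u x / d > r}) \<in> borel_measurable borel"
    if "u \<in> borel_measurable borel" for u :: "real \<Rightarrow> real" and d
    by (rule measurable_emeasure_superlevel) (use that in measurable)
  have "ennreal (1 - t) * (\<integral>\<^sup>+x. ennreal (f x / a) \<partial>lborel) + ennreal t * (\<integral>\<^sup>+x. ennreal (g x / b) \<partial>lborel)
    = (\<integral>\<^sup>+r. ennreal (1 - t) * (emeasure lborel {x. f x / a > r} * indicator {0<..} r)
     + ennreal t * (emeasure lborel {x. g x / b > r} * indicator {0<..} r) \<partial>lborel)"
    by (simp add: lc nn_integral_add nn_integral_cmult)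
  also have "\<dots> \<le> (\<integral>\<^sup>+r. emeasure lborel {x. h x / c > r} * indicator {0<..} r \<partial>lborel)"
    by (intro nn_integral_mono key)
  also have "\<dots> = (\<integral>\<^sup>+x. ennreal (h x / c) \<partial>lborel)"
    by (simp add: lc)
  finally have "ennreal (1 - t) * (\<integral>\<^sup>+x. ennreal (f x / a) \<partial>lborel) + ennreal t * (\<integral>\<^sup>+x. ennreal (g x / b) \<partial>lborel)
    \<le> (\<integral>\<^sup>+x. ennreal (h x / c) \<partial>lborel)" .
  then have "(1 - t) * ((\<integral>x. f x \<partial>lborel) / a) + t * ((\<integral>x. g x \<partial>lborel) / b) \<le> (\<integral>x. h x \<partial>lborel) / c"
    using I0 t pos c by (simp add: nn[OF int(1) nonneg(1)] nn[OF int(2) nonneg(2)] nn[OF int(3) nonneg(3)]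
       flip: ennreal_mult ennreal_plus)
  with weighted_am_gm[of "(\<integral>x. f x \<partial>lborel) / a" "(\<integral>x. g x \<partial>lborel) / b" t]
  have "((\<integral>x. f x \<partial>lborel) / a) powr (1 - t) * ((\<integral>x. g x \<partial>lborel) / b) powr t \<le> (\<integral>x. h x \<partial>lborel) / c"
    using I0 t pos by simp
  then show ?thesis
    using pos c I0 by (simp add: powr_divide c_def field_simps)
qed

text \<open>The multiplicative form allows zeros: \<open>0 powr u = 0\<close> makes the inequality
  trivial outside the support, where a logarithm would be meaningless.\<close>

definition log_concave :: "('v::real_vector \<Rightarrow> real) \<Rightarrow> bool" where
  "log_concave f \<longleftrightarrow> (\<forall>x. 0 \<le> f x) \<and>
     (\<forall>x y t. 0 < t \<longrightarrow> t < 1 \<longrightarrow> f x powr (1 - t) * f y powr t \<le> f ((1 - t) *\<^sub>R x + t *\<^sub>R y))"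

lemma log_concaveI:
  assumes "\<And>x. 0 \<le> f x"
    and "\<And>x y t. 0 < t \<Longrightarrow> t < 1 \<Longrightarrow> f x powr (1 - t) * f y powr t \<le> f ((1 - t) *\<^sub>R x + t *\<^sub>R y)"
  shows "log_concave f"
  using assms by (auto simp: log_concave_def)

lemma log_concaveD:
  assumes "log_concave f"
  shows "0 \<le> f x"
    and "0 < t \<Longrightarrow> t < 1 \<Longrightarrow> f x powr (1 - t) * f y powr t \<le> f ((1 - t) *\<^sub>R x + t *\<^sub>R y)"
  using assms by (auto simp: log_concave_def)

lemma log_concave_mult:
  assumes "log_concave f" "log_concave g"
  shows "log_concave (\<lambda>x. f x * g x)"
proof (rule log_concaveI)
  fix x y and t :: real assume t: "0 < t" "t < 1"
  note nn = log_concaveD(1)[OF assms(1)] log_concaveD(1)[OF assms(2)]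
  have "(f x * g x) powr (1 - t) * (f y * g y) powr t
      = (f x powr (1 - t) * f y powr t) * (g x powr (1 - t) * g y powr t)"
    using nn by (simp add: powr_mult mult_ac)
  also have "\<dots> \<le> f ((1 - t) *\<^sub>R x + t *\<^sub>R y) * g ((1 - t) *\<^sub>R x + t *\<^sub>R y)"
    by (intro mult_mono log_concaveD(2) assms t nn) auto
  finally show "(f x * g x) powr (1 - t) * (f y * g y) powr t
      \<le> f ((1 - t) *\<^sub>R x + t *\<^sub>R y) * g ((1 - t) *\<^sub>R x + t *\<^sub>R y)" .
qed (use log_concaveD(1)[OF assms(1)] log_concaveD(1)[OF assms(2)] in auto)

lemma square_convex_combination:
  fixes t v v' :: real
  assumes "0 \<le> t" "t \<le> 1"
  shows "((1 - t) * v + t * v')\<^sup>2 \<le> (1 - t) * v\<^sup>2 + t * v'\<^sup>2"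
proof -
  have "(1 - t) * v\<^sup>2 + t * v'\<^sup>2 - ((1 - t) * v + t * v')\<^sup>2 = t * (1 - t) * (v - v')\<^sup>2"
    by (simp add: power2_eq_square algebra_simps)
  also have "\<dots> \<ge> 0" using assms by simp
  finally show ?thesis by simp
qed

text \<open>Composition with a linear form lets the density of one coordinate act as a log-concave
  factor on a product space.\<close>

lemma log_concave_std_normal_density:
  assumes "linear l"
  shows "log_concave (\<lambda>x. std_normal_density (l x))"
proof (rule log_concaveI)
  fix x y and t :: real assume t: "0 < t" "t < 1"
  define a where "a = l x"
  define b where "b = l y"
  define c where "c = 1 / sqrt (2 * pi)"
  have c: "c > 0" by (simp add: c_def)
  have l: "l ((1 - t) *\<^sub>R x + t *\<^sub>R y) = (1 - t) * a + t * b"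
    using assms by (simp add: linear_add linear_scale a_def b_def)
  have "((1 - t) * a + t * b)\<^sup>2 \<le> (1 - t) * a\<^sup>2 + t * b\<^sup>2"
    using t by (intro square_convex_combination) auto
  then have "exp ((1 - t) * (- a\<^sup>2 / 2) + t * (- b\<^sup>2 / 2)) \<le> exp (- ((1 - t) * a + t * b)\<^sup>2 / 2)"
    by simp
  moreover have "(c * exp (- a\<^sup>2 / 2)) powr (1 - t) * (c * exp (- b\<^sup>2 / 2)) powr t
    = c * exp ((1 - t) * (- a\<^sup>2 / 2) + t * (- b\<^sup>2 / 2))"
  proof -
    have "(c * exp (- a\<^sup>2 / 2)) powr (1 - t) * (c * exp (- b\<^sup>2 / 2)) powr t
      = (c powr (1 - t) * c powr t) * (exp ((1 - t) * (- a\<^sup>2 / 2)) * exp (t * (- b\<^sup>2 / 2)))"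
      using c by (simp add: powr_mult exp_powr_real mult_ac)
    also have "c powr (1 - t) * c powr t = c" using c by (simp flip: powr_add)
    finally show ?thesis by (simp only: exp_add)
  qed
  ultimately show "std_normal_density (l x) powr (1 - t) * std_normal_density (l y) powr t
    \<le> std_normal_density (l ((1 - t) *\<^sub>R x + t *\<^sub>R y))"
    using c unfolding l std_normal_density_def a_def[symmetric] b_def[symmetric] c_def[symmetric] by simp
qed simp

text \<open>The inequality for \<open>G\<close> between \<open>(p, x)\<close> and
  \<open>(q, y)\<close> is exactly the hypothesis of the one-dimensional Prekopa--Leindler
  inequality for three sections of \<open>G\<close>.\<close>

lemma log_concave_marginal:
  fixes G :: "'v::real_vector \<times> real \<Rightarrow> real"
  assumes G: "log_concave G" and int: "\<And>p. integrable lborel (\<lambda>z. G (p, z))"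
    and bound: "\<And>p. G p \<le> K"
  shows "log_concave (\<lambda>p. \<integral>z. G (p, z) \<partial>lborel)"
proof (rule log_concaveI)
  fix p q and t :: real assume t: "0 < t" "t < 1"
  show "(\<integral>z. G (p, z) \<partial>lborel) powr (1 - t) * (\<integral>z. G (q, z) \<partial>lborel) powr t
     \<le> (\<integral>z. G ((1 - t) *\<^sub>R p + t *\<^sub>R q, z) \<partial>lborel)"
  proof (rule prekopa_leindler_real[where K=K])
    fix x y
    show "G (p, x) powr (1 - t) * G (q, y) powr t \<le> G ((1 - t) *\<^sub>R p + t *\<^sub>R q, (1 - t) * x + t * y)"
      using log_concaveD(2)[OF G t, of "(p, x)" "(q, y)"] by simp
  qed (use int bound t log_concaveD(1)[OF G] in auto)
qed (use log_concaveD(1)[OF G] in simp)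

section \<open>Gaussian integrals of Gaussian functions\<close>

lemma gaussian_integral_aux:
  fixes A m \<sigma> :: real
  assumes "0 \<le> A"
  shows "std_normal_density z * exp (- A * (m + \<sigma> * z)\<^sup>2 / 2) =
    exp (- A * m\<^sup>2 / (2 * (1 + A * \<sigma>\<^sup>2))) / sqrt (1 + A * \<sigma>\<^sup>2) *
      normal_density (- A * \<sigma> * m / (1 + A * \<sigma>\<^sup>2)) (1 / sqrt (1 + A * \<sigma>\<^sup>2)) z"
proof -
  define B where "B = 1 + A * \<sigma>\<^sup>2"
  have B: "B > 0" using assms by (simp add: B_def add_pos_nonneg)
  have "- z\<^sup>2 / 2 + - A * (m + \<sigma> * z)\<^sup>2 / 2 = - A * m\<^sup>2 / (2 * B) + - (z + A * \<sigma> * m / B)\<^sup>2 / (2 * (1 / B))"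
  proof -
    have "B * (- z\<^sup>2 / 2 + - A * (m + \<sigma> * z)\<^sup>2 / 2) = B * (- A * m\<^sup>2 / (2 * B) + - (z + A * \<sigma> * m / B)\<^sup>2 / (2 * (1 / B)))"
    proof -
      have "B * (- A * m\<^sup>2 / (2 * B) + - (z + A * \<sigma> * m / B)\<^sup>2 / (2 * (1 / B))) = - A * m\<^sup>2 / 2 - (B * z + A * \<sigma> * m)\<^sup>2 / 2"
        using B by (simp add: field_simps power2_eq_square)
      also have "\<dots> = B * (- z\<^sup>2 / 2 + - A * (m + \<sigma> * z)\<^sup>2 / 2)"
        by (simp add: B_def field_simps power2_eq_square)
      finally show ?thesis by (rule sym)
    qed
    then show ?thesis using B by (metis mult_left_cancel less_irrefl)
  qed
  then have e: "exp (- z\<^sup>2 / 2) * exp (- A * (m + \<sigma> * z)\<^sup>2 / 2) = exp (- A * m\<^sup>2 / (2 * B)) * exp (- (z + A * \<sigma> * m / B)\<^sup>2 / (2 * (1 / B)))"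
    by (simp only: flip: exp_add)
  have n: "normal_density (- A * \<sigma> * m / B) (1 / sqrt B) z = sqrt B / sqrt (2 * pi) * exp (- (z + A * \<sigma> * m / B)\<^sup>2 / (2 * (1 / B)))"
    using B by (simp add: normal_density_def power_divide real_sqrt_divide)
  have "std_normal_density z * exp (- A * (m + \<sigma> * z)\<^sup>2 / 2) = 1 / sqrt (2 * pi) * (exp (- z\<^sup>2 / 2) * exp (- A * (m + \<sigma> * z)\<^sup>2 / 2))"
    by (simp add: std_normal_density_def)
  also have "\<dots> = exp (- A * m\<^sup>2 / (2 * B)) / sqrt B * normal_density (- A * \<sigma> * m / B) (1 / sqrt B) z"
    unfolding e n using B by simp
  finally show ?thesis unfolding B_def .
qed

lemma gaussian_integral:
  fixes A m \<sigma> :: real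
  assumes "0 \<le> A"
  shows "integrable lborel (\<lambda>z. std_normal_density z * exp (- A * (m + \<sigma> * z)\<^sup>2 / 2))"
    and "(\<integral>z. std_normal_density z * exp (- A * (m + \<sigma> * z)\<^sup>2 / 2) \<partial>lborel)
      = exp (- A * m\<^sup>2 / (2 * (1 + A * \<sigma>\<^sup>2))) / sqrt (1 + A * \<sigma>\<^sup>2)"
proof -
  have B: "1 + A * \<sigma>\<^sup>2 > 0" using assms by (simp add: add_pos_nonneg)
  show "integrable lborel (\<lambda>z. std_normal_density z * exp (- A * (m + \<sigma> * z)\<^sup>2 / 2))"
    unfolding gaussian_integral_aux[OF assms] using B by (intro integrable_mult_right integrable_normal_density) auto
  show "(\<integral>z. std_normal_density z * exp (- A * (m + \<sigma> * z)\<^sup>2 / 2) \<partial>lborel)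
      = exp (- A * m\<^sup>2 / (2 * (1 + A * \<sigma>\<^sup>2))) / sqrt (1 + A * \<sigma>\<^sup>2)"
    unfolding gaussian_integral_aux[OF assms] using B by simp
qed

section \<open>Quadratic functionals of a Gaussian autoregression\<close>

lemma nn_integral_exp_atLeast:
  fixes s d :: real
  assumes s: "0 < s"
  shows "(\<integral>\<^sup>+x. ennreal (exp (- s * x)) * indicator {d..} x \<partial>lborel) = ennreal (exp (- s * d) / s)"
proof -
  have "(\<integral>\<^sup>+x. ennreal (exp (- s * x)) * indicator {d..} x \<partial>lborel) = ennreal (0 - (- exp (- s * d) / s))"
  proof (rule nn_integral_FTC_atLeast)
    have "filterlim (\<lambda>x. s * x) at_top at_top"
      by (rule filterlim_tendsto_pos_mult_at_top[OF tendsto_const s filterlim_ident])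
    then have "((\<lambda>x. exp (- (s * x))) \<longlongrightarrow> 0) at_top"
      by (intro filterlim_compose[OF exp_at_bot]) (simp add: filterlim_uminus_at_bot)
    from tendsto_divide[OF tendsto_minus[OF this] tendsto_const, of s]
    show "((\<lambda>x. - exp (- s * x) / s) \<longlongrightarrow> 0) at_top" using s by simp
  qed (use s in \<open>auto intro!: derivative_eq_intros\<close>)
  then show ?thesis by simp
qed

text \<open>Backward step of dynamic programming: if \<open>f (x, v)\<close> is the probability that
  the cost still to come from state \<open>v\<close> is at most \<open>x\<close>, then
  \<open>ou_step\<close> is the same probability one step earlier, after paying
  \<open>w * v^2 / 2\<close> in state \<open>v\<close> and moving to
  \<open>\<rho> * v + \<sigma> * z\<close>.\<close>

definition ou_step :: "real \<Rightarrow> real \<Rightarrow> real \<Rightarrow> (real \<times> real \<Rightarrow> real) \<Rightarrow> real \<times> real \<Rightarrow> real" where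
  "ou_step \<rho> \<sigma> w f = (\<lambda>p. \<integral>z. std_normal_density z * f (fst p - w * (snd p)\<^sup>2 / 2, \<rho> * snd p + \<sigma> * z) \<partial>lborel)"

text \<open>Log-concavity in the pair of level and starting point is what survives the averaging
  step; monotonicity in the level absorbs the concave shift \<open>- w * v\<^sup>2 / 2\<close>.\<close>

definition lc_cdf :: "(real \<times> real \<Rightarrow> real) \<Rightarrow> bool" where
  "lc_cdf f \<longleftrightarrow> f \<in> borel_measurable borel \<and> log_concave f \<and> (\<forall>p. f p \<le> 1) \<and>
     (\<forall>x v. x < 0 \<longrightarrow> f (x, v) = 0) \<and> (\<forall>x y v. x \<le> y \<longrightarrow> f (x, v) \<le> f (y, v))"

lemma lc_cdf_integrable:
  assumes "lc_cdf f"
  shows "integrable lborel (\<lambda>z. std_normal_density z * f (x, a + \<sigma> * z))"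
proof (rule Bochner_Integration.integrable_bound)
  have [measurable]: "f \<in> borel_measurable (borel \<Otimes>\<^sub>M borel)"
    using assms by (simp add: lc_cdf_def borel_prod)
  show "(\<lambda>z. std_normal_density z * f (x, a + \<sigma> * z)) \<in> borel_measurable lborel" by measurable
  show "integrable lborel std_normal_density" by simp
  show "AE z in lborel. norm (std_normal_density z * f (x, a + \<sigma> * z)) \<le> norm (std_normal_density z)"
    using assms by (intro AE_I2) (auto simp: lc_cdf_def log_concave_def abs_mult intro!: mult_left_le)
qed

lemma lc_cdf_ou_step:
  assumes f: "lc_cdf f" and w: "0 \<le> w"
  shows "lc_cdf (ou_step \<rho> \<sigma> w f)"
proof -
  have [measurable]: "f \<in> borel_measurable (borel \<Otimes>\<^sub>M borel)"
    using f by (simp add: lc_cdf_def borel_prod)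
  have lc: "log_concave f" and mono: "\<And>x y v. x \<le> y \<Longrightarrow> f (x, v) \<le> f (y, v)"
    and le1: "\<And>p. f p \<le> 1" and neg: "\<And>x v. x < 0 \<Longrightarrow> f (x, v) = 0"
    and nn: "\<And>p. 0 \<le> f p"
    using f by (auto simp: lc_cdf_def log_concave_def)
  note int = lc_cdf_integrable[OF f]
  have "log_concave (\<lambda>q. f (fst (fst q) - w * (snd (fst q))\<^sup>2 / 2, \<rho> * snd (fst q) + \<sigma> * snd q))"
  proof (rule log_concaveI)
    fix q q' :: "(real \<times> real) \<times> real" and t :: real assume t: "0 < t" "t < 1"
    obtain x v z where q: "q = ((x, v), z)" by (metis prod.exhaust)
    obtain x' v' z' where q': "q' = ((x', v'), z')" by (metis prod.exhaust)
    have "((1 - t) * v + t * v')\<^sup>2 \<le> (1 - t) * v\<^sup>2 + t * v'\<^sup>2"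
      using t by (intro square_convex_combination) auto
    from mult_left_mono[OF this w]
    have "((1 - t) * x + t * x') - w * ((1 - t) * v\<^sup>2 + t * v'\<^sup>2) / 2
       \<le> ((1 - t) * x + t * x') - w * ((1 - t) * v + t * v')\<^sup>2 / 2"
      by linarith
    then have le: "(1 - t) * (x - w * v\<^sup>2 / 2) + t * (x' - w * v'\<^sup>2 / 2)
       \<le> ((1 - t) * x + t * x') - w * ((1 - t) * v + t * v')\<^sup>2 / 2"
      by (rule order_trans[OF eq_refl, rotated]) (simp add: field_simps)
    have "f (x - w * v\<^sup>2 / 2, \<rho> * v + \<sigma> * z) powr (1 - t) * f (x' - w * v'\<^sup>2 / 2, \<rho> * v' + \<sigma> * z') powr t
      \<le> f ((1 - t) * (x - w * v\<^sup>2 / 2) + t * (x' - w * v'\<^sup>2 / 2),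
           (1 - t) * (\<rho> * v + \<sigma> * z) + t * (\<rho> * v' + \<sigma> * z'))"
      using log_concaveD(2)[OF lc t, of "(x - w * v\<^sup>2 / 2, \<rho> * v + \<sigma> * z)" "(x' - w * v'\<^sup>2 / 2, \<rho> * v' + \<sigma> * z')"] by simp
    also have "(1 - t) * (\<rho> * v + \<sigma> * z) + t * (\<rho> * v' + \<sigma> * z') =
        \<rho> * ((1 - t) * v + t * v') + \<sigma> * ((1 - t) * z + t * z')" by (simp add: algebra_simps)
    finally show "f (fst (fst q) - w * (snd (fst q))\<^sup>2 / 2, \<rho> * snd (fst q) + \<sigma> * snd q) powr (1 - t) *
        f (fst (fst q') - w * (snd (fst q'))\<^sup>2 / 2, \<rho> * snd (fst q') + \<sigma> * snd q') powr t
        \<le> f (fst (fst ((1 - t) *\<^sub>R q + t *\<^sub>R q')) - w * (snd (fst ((1 - t) *\<^sub>R q + t *\<^sub>R q')))\<^sup>2 / 2,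
              \<rho> * snd (fst ((1 - t) *\<^sub>R q + t *\<^sub>R q')) + \<sigma> * snd ((1 - t) *\<^sub>R q + t *\<^sub>R q'))"
      using mono[OF le] unfolding q q' by simp (meson order_trans)
  qed (use nn in auto)
  moreover have "log_concave (\<lambda>q::(real \<times> real) \<times> real. std_normal_density (snd q))"
    by (rule log_concave_std_normal_density) (rule linear_snd)
  ultimately have G: "log_concave (\<lambda>q. std_normal_density (snd q) *
      f (fst (fst q) - w * (snd (fst q))\<^sup>2 / 2, \<rho> * snd (fst q) + \<sigma> * snd q))"
    using log_concave_mult by blast
  have bd: "std_normal_density z \<le> 1 / sqrt (2 * pi)" for z
    by (simp add: std_normal_density_def divide_right_mono)
  have lcs: "log_concave (ou_step \<rho> \<sigma> w f)"
    unfolding ou_step_def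
    using log_concave_marginal[OF G, of "1 / sqrt (2 * pi)"] int bd le1 nn
    by (simp add: mult_mono[of _ "1 / sqrt (2 * pi)" _ 1, simplified])
  have meas: "ou_step \<rho> \<sigma> w f \<in> borel_measurable borel"
  proof -
    have "(\<lambda>p. \<integral>z. std_normal_density z * f (fst p - w * (snd p)\<^sup>2 / 2, \<rho> * snd p + \<sigma> * z) \<partial>lborel)
      \<in> borel_measurable (borel \<Otimes>\<^sub>M borel)"
      by measurable
    then show ?thesis by (simp add: ou_step_def borel_prod)
  qed
  have up: "ou_step \<rho> \<sigma> w f p \<le> 1" for p
  proof -
    have "ou_step \<rho> \<sigma> w f p \<le> (\<integral>z. std_normal_density z \<partial>lborel)"
      unfolding ou_step_def using le1 nn by (intro integral_mono int) (auto intro!: mult_left_le)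
    then show ?thesis by simp
  qed
  have neg': "ou_step \<rho> \<sigma> w f (x, v) = 0" if "x < 0" for x v
  proof -
    have "x - w * v\<^sup>2 / 2 < 0" using that w by (smt (verit) divide_nonneg_nonneg mult_nonneg_nonneg zero_le_power2)
    then show ?thesis by (simp add: ou_step_def neg)
  qed
  have mono': "ou_step \<rho> \<sigma> w f (x, v) \<le> ou_step \<rho> \<sigma> w f (y, v)" if "x \<le> y" for x y v
    unfolding ou_step_def using that by (intro integral_mono int) (auto intro!: mult_left_mono mono)
  show ?thesis using lcs meas up neg' mono' by (auto simp: lc_cdf_def)
qed

text \<open>After exchanging the integrals, the shift of the level becomes the factor
  \<open>exp (- s * d)\<close>, and the inner transform, Gaussian in the state by \<open>L\<close>,
  is averaged by completing the square. The form \<open>C * exp (- A * v^2 / 2)\<close> is thus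
  preserved and only \<open>C\<close> and \<open>A\<close> change; the change of \<open>A\<close> is
  a discrete Riccati step.\<close>

lemma laplace_ou_step:
  assumes f: "lc_cdf f" and "0 \<le> A" "0 \<le> C" and w: "0 \<le> w"
    and L: "\<And>v. (\<integral>\<^sup>+x. ennreal (exp (- s * x) * f (x, v)) \<partial>lborel) = ennreal (C * exp (- A * v\<^sup>2 / 2))"
  shows "(\<integral>\<^sup>+x. ennreal (exp (- s * x) * ou_step \<rho> \<sigma> w f (x, v)) \<partial>lborel)
    = ennreal (C / sqrt (1 + A * \<sigma>\<^sup>2) * exp (- (s * w + \<rho>\<^sup>2 * A / (1 + A * \<sigma>\<^sup>2)) * v\<^sup>2 / 2))"
proof -
  have [measurable]: "f \<in> borel_measurable (borel \<Otimes>\<^sub>M borel)"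
    using f by (simp add: lc_cdf_def borel_prod)
  have nn: "\<And>p. 0 \<le> f p"
    using f by (auto simp: lc_cdf_def log_concave_def)
  note int = lc_cdf_integrable[OF f]
  define d where "d = w * v\<^sup>2 / 2"
  have "(\<integral>\<^sup>+x. ennreal (exp (- s * x) * ou_step \<rho> \<sigma> w f (x, v)) \<partial>lborel)
    = (\<integral>\<^sup>+x. \<integral>\<^sup>+z. ennreal (exp (- s * x) * (std_normal_density z * f (x - d, \<rho> * v + \<sigma> * z))) \<partial>lborel \<partial>lborel)"
  proof (intro nn_integral_cong)
    fix x :: real
    have "ennreal (ou_step \<rho> \<sigma> w f (x, v)) = (\<integral>\<^sup>+z. ennreal (std_normal_density z * f (x - d, \<rho> * v + \<sigma> * z)) \<partial>lborel)"
      unfolding ou_step_def using int nn by (subst nn_integral_eq_integral) (auto simp: d_def)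
    then have "ennreal (exp (- s * x) * ou_step \<rho> \<sigma> w f (x, v)) =
       ennreal (exp (- s * x)) * (\<integral>\<^sup>+z. ennreal (std_normal_density z * f (x - d, \<rho> * v + \<sigma> * z)) \<partial>lborel)"
      by (simp add: ennreal_mult')
    also have "\<dots> = (\<integral>\<^sup>+z. ennreal (exp (- s * x) * (std_normal_density z * f (x - d, \<rho> * v + \<sigma> * z))) \<partial>lborel)"
      by (subst nn_integral_cmult[symmetric]) (auto simp: ennreal_mult')
    finally show "ennreal (exp (- s * x) * ou_step \<rho> \<sigma> w f (x, v)) = (\<integral>\<^sup>+z. ennreal (exp (- s * x) * (std_normal_density z * f (x - d, \<rho> * v + \<sigma> * z))) \<partial>lborel)" .
  qed
  also have "\<dots> = (\<integral>\<^sup>+z. \<integral>\<^sup>+x. ennreal (exp (- s * x) * (std_normal_density z * f (x - d, \<rho> * v + \<sigma> * z))) \<partial>lborel \<partial>lborel)"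
    by (rule lborel_pair.Fubini'[symmetric]) measurable
  also have "\<dots> = (\<integral>\<^sup>+z. ennreal (C * exp (- s * d) * (std_normal_density z * exp (- A * (\<rho> * v + \<sigma> * z)\<^sup>2 / 2))) \<partial>lborel)"
  proof (intro nn_integral_cong)
    fix z :: real
    have "(\<integral>\<^sup>+x. ennreal (exp (- s * x) * (std_normal_density z * f (x - d, \<rho> * v + \<sigma> * z))) \<partial>lborel)
      = (\<integral>\<^sup>+x. ennreal (exp (- s * (d + 1 * x)) * (std_normal_density z * f (d + 1 * x - d, \<rho> * v + \<sigma> * z))) \<partial>lborel)"
      by (subst nn_integral_real_affine[where c=1 and t=d]) auto
    also have "\<dots> = (\<integral>\<^sup>+x. ennreal (exp (- s * d) * std_normal_density z) * ennreal (exp (- s * x) * f (x, \<rho> * v + \<sigma> * z)) \<partial>lborel)"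
    proof (intro nn_integral_cong)
      fix x :: real
      have "exp (- s * (d + 1 * x)) = exp (- s * d) * exp (- s * x)"
        by (simp add: algebra_simps flip: exp_add)
      then show "ennreal (exp (- s * (d + 1 * x)) * (std_normal_density z * f (d + 1 * x - d, \<rho> * v + \<sigma> * z)))
        = ennreal (exp (- s * d) * std_normal_density z) * ennreal (exp (- s * x) * f (x, \<rho> * v + \<sigma> * z))"
        using nn by (simp add: mult_ac flip: ennreal_mult)
    qed
    also have "\<dots> = ennreal (exp (- s * d) * std_normal_density z) * ennreal (C * exp (- A * (\<rho> * v + \<sigma> * z)\<^sup>2 / 2))"
      by (subst nn_integral_cmult) (measurable, simp only: L)
    also have "\<dots> = ennreal (C * exp (- s * d) * (std_normal_density z * exp (- A * (\<rho> * v + \<sigma> * z)\<^sup>2 / 2)))"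
      using \<open>0 \<le> C\<close> by (simp add: mult_ac flip: ennreal_mult)
    finally show "(\<integral>\<^sup>+x. ennreal (exp (- s * x) * (std_normal_density z * f (x - d, \<rho> * v + \<sigma> * z))) \<partial>lborel) = \<dots>" .
  qed
  also have "\<dots> = ennreal (C * exp (- s * d) * (exp (- A * (\<rho> * v)\<^sup>2 / (2 * (1 + A * \<sigma>\<^sup>2))) / sqrt (1 + A * \<sigma>\<^sup>2)))"
    using gaussian_integral[OF \<open>0 \<le> A\<close>, of "\<rho> * v" \<sigma>] \<open>0 \<le> C\<close>
    by (subst nn_integral_eq_integral) auto
  also have "C * exp (- s * d) * (exp (- A * (\<rho> * v)\<^sup>2 / (2 * (1 + A * \<sigma>\<^sup>2))) / sqrt (1 + A * \<sigma>\<^sup>2))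
    = C / sqrt (1 + A * \<sigma>\<^sup>2) * (exp (- s * d) * exp (- A * (\<rho> * v)\<^sup>2 / (2 * (1 + A * \<sigma>\<^sup>2))))" by simp
  also have "exp (- s * d) * exp (- A * (\<rho> * v)\<^sup>2 / (2 * (1 + A * \<sigma>\<^sup>2)))
     = exp (- (s * w + \<rho>\<^sup>2 * A / (1 + A * \<sigma>\<^sup>2)) * v\<^sup>2 / 2)"
  proof -
    have "0 < 1 + A * \<sigma>\<^sup>2" using \<open>0 \<le> A\<close> by (simp add: add_pos_nonneg)
    then have "- s * d + - A * (\<rho> * v)\<^sup>2 / (2 * B) = - (s * w + \<rho>\<^sup>2 * A / B) * v\<^sup>2 / 2" if "B = 1 + A * \<sigma>\<^sup>2" for B
      using that by (simp add: d_def power_mult_distrib field_simps)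
    then show ?thesis by (simp only: flip: exp_add)
  qed
  finally show ?thesis .
qed

text \<open>\<open>ou_laplace \<rho> \<sigma> \<tau> w k A\<close> is the expectation of
  \<open>exp (- (\<Sum>j<k. w j * V j ^ 2) / 2 - A * V k ^ 2 / 2)\<close> for the Gaussian autoregression
  \<open>V (j + 1) = \<rho> V j + \<sigma> Z j\<close> started with variance \<open>\<tau>\<^sup>2\<close>.\<close>

primrec ou_laplace :: "real \<Rightarrow> real \<Rightarrow> real \<Rightarrow> (nat \<Rightarrow> real) \<Rightarrow> nat \<Rightarrow> real \<Rightarrow> real" where
  "ou_laplace \<rho> \<sigma> \<tau> w 0 A = 1 / sqrt (1 + A * \<tau>\<^sup>2)"
| "ou_laplace \<rho> \<sigma> \<tau> w (Suc k) A =
     1 / sqrt (1 + A * \<sigma>\<^sup>2) * ou_laplace \<rho> \<sigma> \<tau> w k (w k + \<rho>\<^sup>2 * A / (1 + A * \<sigma>\<^sup>2))"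

text \<open>The base case is a step with correlation 0 and weight 0: it draws the initial state
  \<open>\<tau> * z\<close> whatever the second argument is, so the later evaluation at
  \<open>(x, 0)\<close> is no restriction.\<close>

primrec ou_cdf :: "real \<Rightarrow> real \<Rightarrow> real \<Rightarrow> (nat \<Rightarrow> real) \<Rightarrow> nat \<Rightarrow> (real \<times> real \<Rightarrow> real) \<Rightarrow> real \<times> real \<Rightarrow> real" where
  "ou_cdf \<rho> \<sigma> \<tau> w 0 f = ou_step 0 \<tau> 0 f"
| "ou_cdf \<rho> \<sigma> \<tau> w (Suc k) f = ou_cdf \<rho> \<sigma> \<tau> w k (ou_step \<rho> \<sigma> (w k) f)"

lemma lc_cdf_ou_cdf:
  assumes "lc_cdf f" "\<And>j. 0 \<le> w j"
  shows "lc_cdf (ou_cdf \<rho> \<sigma> \<tau> w k f)"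
  using assms by (induction k arbitrary: f) (auto intro: lc_cdf_ou_step)

lemma laplace_ou_cdf:
  assumes "lc_cdf f" "0 \<le> A" "0 \<le> C" "\<And>j. 0 \<le> w j" "0 \<le> s"
    and "\<And>v. (\<integral>\<^sup>+x. ennreal (exp (- s * x) * f (x, v)) \<partial>lborel) = ennreal (C * exp (- A * v\<^sup>2 / 2))"
  shows "(\<integral>\<^sup>+x. ennreal (exp (- s * x) * ou_cdf \<rho> \<sigma> \<tau> w k f (x, 0)) \<partial>lborel)
    = ennreal (C * ou_laplace \<rho> \<sigma> \<tau> (\<lambda>j. s * w j) k A)"
  using assms
proof (induction k arbitrary: f A C)
  case 0
  show ?case using laplace_ou_step[OF 0(1-3) order_refl 0(6), of 0 \<tau> 0] by simp
next
  case (Suc k)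
  have "0 < 1 + A * \<sigma>\<^sup>2" using Suc.prems(2) by (simp add: add_pos_nonneg)
  then have "(\<integral>\<^sup>+x. ennreal (exp (- s * x) * ou_cdf \<rho> \<sigma> \<tau> w k (ou_step \<rho> \<sigma> (w k) f) (x, 0)) \<partial>lborel)
    = ennreal (C / sqrt (1 + A * \<sigma>\<^sup>2) * ou_laplace \<rho> \<sigma> \<tau> (\<lambda>j. s * w j) k (s * w k + \<rho>\<^sup>2 * A / (1 + A * \<sigma>\<^sup>2)))"
    using Suc.prems by (intro Suc.IH lc_cdf_ou_step laplace_ou_step) auto
  then show ?case by simp
qed

text \<open>Backward averaging starts from the indicator of the convex set
  \<open>w k * v^2 / 2 \<le> x\<close>, the distribution function of the deterministic cost of the
  last state. The resulting function is tied to the process through its Laplace transform alone,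
  which suffices for the passage to the limit.\<close>

lemma exists_log_concave_with_laplace:
  assumes w: "\<And>j. 0 \<le> w j"
  shows "\<exists>F. log_concave F \<and> mono F \<and> (\<forall>x. 0 \<le> F x \<and> F x \<le> (1::real)) \<and> (\<forall>x<0. F x = 0) \<and>
    (\<forall>s>0. (\<integral>\<^sup>+x. ennreal (exp (- s * x) * F x) \<partial>lborel)
       = ennreal (ou_laplace \<rho> \<sigma> \<tau> (\<lambda>j. s * w j) k (s * w k) / s))"
proof -
  define f :: "real \<times> real \<Rightarrow> real" where "f p = indicator {p. w k * (snd p)\<^sup>2 / 2 \<le> fst p} p" for p
  have f01: "f p = 0 \<or> f p = 1" for p by (simp add: f_def indicator_def)
  have conv: "convex {p. w k * (snd p)\<^sup>2 / 2 \<le> fst p}"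
  proof (rule convexI)
    fix p q :: "real \<times> real" and u t :: real
    assume p: "p \<in> {p. w k * (snd p)\<^sup>2 / 2 \<le> fst p}" and q: "q \<in> {p. w k * (snd p)\<^sup>2 / 2 \<le> fst p}"
      and u: "0 \<le> u" and t: "0 \<le> t" and ut: "u + t = 1"
    obtain x v where pe: "p = (x, v)" by (metis prod.exhaust)
    obtain x' v' where qe: "q = (x', v')" by (metis prod.exhaust)
    have "(u * v + t * v')\<^sup>2 \<le> u * v\<^sup>2 + t * v'\<^sup>2"
      using square_convex_combination[of t v v'] t u ut by (simp add: eq_diff_eq[symmetric])
    from mult_left_mono[OF this w[of k]]
    have "w k * (u * v + t * v')\<^sup>2 / 2 \<le> w k * (u * v\<^sup>2 + t * v'\<^sup>2) / 2" by simp
    also have "\<dots> = u * (w k * v\<^sup>2 / 2) + t * (w k * v'\<^sup>2 / 2)"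
      by (simp add: field_simps)
    also have "\<dots> \<le> u * x + t * x'"
      using p q u t by (intro add_mono mult_left_mono) (auto simp: pe qe)
    finally show "u *\<^sub>R p + t *\<^sub>R q \<in> {p. w k * (snd p)\<^sup>2 / 2 \<le> fst p}" by (simp add: pe qe)
  qed
  have "lc_cdf f"
    unfolding lc_cdf_def
  proof (intro conjI allI impI)
    show "f \<in> borel_measurable borel"
      unfolding f_def by (intro borel_measurable_indicator borel_closed closed_Collect_le continuous_on_divide continuous_on_mult continuous_on_power
          continuous_on_const continuous_on_fst continuous_on_snd continuous_on_id) auto
    show "log_concave f"
    proof (rule log_concaveI)
      fix x y and t :: real assume t: "0 < t" "t < 1"
      show "f x powr (1 - t) * f y powr t \<le> f ((1 - t) *\<^sub>R x + t *\<^sub>R y)"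
      proof (cases "f x = 0 \<or> f y = 0")
        case True then show ?thesis using f01[of "(1 - t) *\<^sub>R x + t *\<^sub>R y"] by auto
      next
        case False
        then have "x \<in> {p. w k * (snd p)\<^sup>2 / 2 \<le> fst p}" "y \<in> {p. w k * (snd p)\<^sup>2 / 2 \<le> fst p}"
          by (auto simp: f_def indicator_def split: if_splits)
        then have "(1 - t) *\<^sub>R x + t *\<^sub>R y \<in> {p. w k * (snd p)\<^sup>2 / 2 \<le> fst p}"
          using t by (intro convexD[OF conv]) auto
        then have "f ((1 - t) *\<^sub>R x + t *\<^sub>R y) = 1" by (simp add: f_def)
        then show ?thesis using f01[of x] f01[of y] by auto
      qed
    qed (simp add: f_def)
    fix x v :: real assume "x < 0"
    moreover have "0 \<le> w k * v\<^sup>2 / 2" using w by simp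
    ultimately show "f (x, v) = 0" by (simp add: f_def)
  qed (auto simp: f_def indicator_def)
  note lc = lc_cdf_ou_cdf[OF this w, where \<rho>=\<rho> and \<sigma>=\<sigma> and \<tau>=\<tau> and k=k]
  define F where "F x = ou_cdf \<rho> \<sigma> \<tau> w k f (x, 0)" for x
  have "log_concave F"
  proof (rule log_concaveI)
    fix x y t :: real assume t: "0 < t" "t < 1"
    show "F x powr (1 - t) * F y powr t \<le> F ((1 - t) *\<^sub>R x + t *\<^sub>R y)"
      using lc log_concaveD(2)[of "ou_cdf \<rho> \<sigma> \<tau> w k f" t "(x, 0)" "(y, 0)"] t
      unfolding F_def lc_cdf_def by simp
  qed (use lc in \<open>auto simp: F_def lc_cdf_def log_concave_def\<close>)
  moreover have "(\<integral>\<^sup>+x. ennreal (exp (- s * x) * F x) \<partial>lborel)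
       = ennreal (ou_laplace \<rho> \<sigma> \<tau> (\<lambda>j. s * w j) k (s * w k) / s)" if s: "s > 0" for s
  proof -
    have "(\<integral>\<^sup>+x. ennreal (exp (- s * x) * f (x, v)) \<partial>lborel) = ennreal (1 / s * exp (- (s * w k) * v\<^sup>2 / 2))" for v
    proof -
      define d where "d = w k * v\<^sup>2 / 2"
      have "(\<integral>\<^sup>+x. ennreal (exp (- s * x) * f (x, v)) \<partial>lborel) = (\<integral>\<^sup>+x. ennreal (exp (- s * x)) * indicator {d..} x \<partial>lborel)"
        by (intro nn_integral_cong) (auto simp: f_def d_def indicator_def)
      also have "\<dots> = ennreal (1 / s * exp (- (s * w k) * v\<^sup>2 / 2))"
        unfolding nn_integral_exp_atLeast[OF s] by (simp add: d_def mult.assoc)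
      finally show ?thesis .
    qed
    with laplace_ou_cdf[OF \<open>lc_cdf f\<close> _ _ w, of "s * w k" "1 / s" s] s w
    show ?thesis by (simp add: F_def)
  qed
  ultimately show ?thesis
    using lc by (intro exI[of _ F]) (auto simp: F_def lc_cdf_def log_concave_def intro!: monoI)
qed

section \<open>Characteristic functions and the Laplace transform of the autoregression\<close>

lemma gaussian_rv_moments:
  assumes "prob_space M" and Y: "gaussian_rv M Y"
  shows "integrable M Y" "integrable M (\<lambda>\<omega>. (Y \<omega>)\<^sup>2)"
    and "(\<integral>\<omega>. Y \<omega> \<partial>M) = 0 \<Longrightarrow> (\<integral>\<omega>. iexp (Y \<omega>) \<partial>M) = of_real (exp (- (\<integral>\<omega>. (Y \<omega>)\<^sup>2 \<partial>M) / 2))"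
proof -
  interpret prob_space M by fact
  have [measurable]: "Y \<in> borel_measurable M" using Y by (simp add: gaussian_rv_def)
  consider m where "AE \<omega> in M. Y \<omega> = m"
    | m s where "s > 0" "distributed M lborel Y (\<lambda>x. ennreal (normal_density m s x))"
    using Y unfolding gaussian_rv_def by blast
  then have "integrable M Y \<and> integrable M (\<lambda>\<omega>. (Y \<omega>)\<^sup>2) \<and>
    ((\<integral>\<omega>. Y \<omega> \<partial>M) = 0 \<longrightarrow> (\<integral>\<omega>. iexp (Y \<omega>) \<partial>M) = of_real (exp (- (\<integral>\<omega>. (Y \<omega>)\<^sup>2 \<partial>M) / 2)))"
  proof cases
    case 1
    have "integrable M Y \<longleftrightarrow> integrable M (\<lambda>_. m)" "integrable M (\<lambda>\<omega>. (Y \<omega>)\<^sup>2) \<longleftrightarrow> integrable M (\<lambda>_. m\<^sup>2)"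
      using 1 by (intro integrable_cong_AE; auto)+
    moreover have "(\<integral>\<omega>. Y \<omega> \<partial>M) = (\<integral>\<omega>. m \<partial>M)" "(\<integral>\<omega>. (Y \<omega>)\<^sup>2 \<partial>M) = (\<integral>\<omega>. m\<^sup>2 \<partial>M)" "(\<integral>\<omega>. iexp (Y \<omega>) \<partial>M) = (\<integral>\<omega>. iexp m \<partial>M)"
      using 1 by (intro integral_cong_AE; auto)+
    ultimately show ?thesis by (simp add: prob_space)
  next
    case 2
    define Z where "Z \<omega> = (Y \<omega> - m) / s" for \<omega>
    have [measurable]: "Z \<in> borel_measurable M" unfolding Z_def by measurable
    have dZ: "distr M borel Z = std_normal_distribution"
    proof -
      have "distributed M lborel Z std_normal_density"
        using 2 normal_standard_normal_convert[OF 2(1), of Y m] by (simp add: Z_def[abs_def])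
      then have "distr M lborel Z = std_normal_distribution" by (rule distributed_distr_eq_density)
      moreover have "distr M borel Z = distr M lborel Z" by (rule distr_cong) auto
      ultimately show ?thesis by simp
    qed
    have YZ: "Y \<omega> = m + s * Z \<omega>" for \<omega> using 2(1) by (simp add: Z_def)
    have iZ: "integrable M (\<lambda>\<omega>. (Z \<omega>) ^ k)" for k
      using integrable_std_normal_distribution_moment[of k] unfolding dZ[symmetric]
      by (subst (asm) integrable_distr_eq) auto
    have i1: "integrable M Z" using iZ[of 1] by simp
    have eY: "(\<integral>\<omega>. Y \<omega> \<partial>M) = m" by (rule normal_distributed_expectation[OF 2])
    have i2: "integrable M Y" "integrable M (\<lambda>\<omega>. (Y \<omega>)\<^sup>2)"
    proof -
      have "Y = (\<lambda>\<omega>. m + s * Z \<omega>)" using YZ by auto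
      moreover have "integrable M (\<lambda>\<omega>. m + s * Z \<omega>)" using i1 by simp
      ultimately show "integrable M Y" by simp
      have "(\<lambda>\<omega>. (Y \<omega>)\<^sup>2) = (\<lambda>\<omega>. m\<^sup>2 + 2 * m * s * Z \<omega> + s\<^sup>2 * (Z \<omega>)\<^sup>2)"
        by (simp add: YZ power2_eq_square algebra_simps)
      moreover have "integrable M (\<lambda>\<omega>. m\<^sup>2 + 2 * m * s * Z \<omega> + s\<^sup>2 * (Z \<omega>)\<^sup>2)"
        using i1 iZ[of 2] by simp
      ultimately show "integrable M (\<lambda>\<omega>. (Y \<omega>)\<^sup>2)" by simp
    qed
    have "(\<integral>\<omega>. iexp (Y \<omega>) \<partial>M) = of_real (exp (- (\<integral>\<omega>. (Y \<omega>)\<^sup>2 \<partial>M) / 2))" if "m = 0"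
    proof -
      have "(\<integral>\<omega>. (Y \<omega>)\<^sup>2 \<partial>M) = s\<^sup>2"
        using normal_distributed_variance[OF 2] eY that by simp
      moreover have "(\<integral>\<omega>. iexp (Y \<omega>) \<partial>M) = char (distr M borel Z) s"
        unfolding char_def using that by (subst integral_distr) (auto simp: YZ)
      ultimately show ?thesis unfolding dZ char_std_normal_distribution by simp
    qed
    then show ?thesis using i2 eY by simp
  qed
  then show "integrable M Y" "integrable M (\<lambda>\<omega>. (Y \<omega>)\<^sup>2)"
    and "(\<integral>\<omega>. Y \<omega> \<partial>M) = 0 \<Longrightarrow> (\<integral>\<omega>. iexp (Y \<omega>) \<partial>M) = of_real (exp (- (\<integral>\<omega>. (Y \<omega>)\<^sup>2 \<partial>M) / 2))"
    by auto
qed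

text \<open>A Gaussian square is a mixture of characters, which turns expectations of Gaussian
  functionals into integrals of characteristic functions.\<close>

lemma gaussian_square_mixture:
  fixes R :: "'a \<Rightarrow> complex"
  assumes M: "prob_space M" and [measurable]: "X \<in> borel_measurable M" "R \<in> borel_measurable M"
    and R: "\<And>\<omega>. norm (R \<omega>) \<le> B" and w: "0 \<le> w"
  shows "(\<integral>\<omega>. R \<omega> * of_real (exp (- w * (X \<omega>)\<^sup>2 / 2)) \<partial>M)
    = (\<integral>g. (\<integral>\<omega>. R \<omega> * iexp (sqrt w * g * X \<omega>) \<partial>M) \<partial>std_normal_distribution)"
proof -
  interpret M: prob_space M by fact
  interpret N: real_distribution std_normal_distribution by (rule real_dist_normal_dist)
  interpret P: pair_prob_space M std_normal_distribution ..
  have e: "of_real (exp (- w * x\<^sup>2 / 2)) = (\<integral>g. iexp (sqrt w * g * x) \<partial>std_normal_distribution)" for x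
  proof -
    have "of_real (exp (- (sqrt w * x)\<^sup>2 / 2)) = char std_normal_distribution (sqrt w * x)"
      by (simp only: char_std_normal_distribution)
    then show ?thesis using w by (simp add: char_def power_mult_distrib mult_ac)
  qed
  have int: "integrable (M \<Otimes>\<^sub>M std_normal_distribution) (\<lambda>(\<omega>, g). R \<omega> * iexp (sqrt w * g * X \<omega>))"
    by (rule P.P.integrable_const_bound[where B=B]) (use R in \<open>auto simp: norm_mult\<close>)
  have "(\<integral>\<omega>. R \<omega> * of_real (exp (- w * (X \<omega>)\<^sup>2 / 2)) \<partial>M)
     = (\<integral>\<omega>. (\<integral>g. R \<omega> * iexp (sqrt w * g * X \<omega>) \<partial>std_normal_distribution) \<partial>M)"
    unfolding e by (simp only: integral_mult_right_zero)
  also have "\<dots> = (\<integral>g. (\<integral>\<omega>. R \<omega> * iexp (sqrt w * g * X \<omega>) \<partial>M) \<partial>std_normal_distribution)"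
    by (rule P.Fubini_integral[OF int, symmetric])
  finally show ?thesis .
qed

text \<open>The joint law enters as a characteristic function, so no innovations have to be
  constructed. \<open>markov\<close> is the trace that the recursion
  \<open>V (Suc k) = \<rho> * V k + \<sigma> * Z k\<close> leaves in the covariances, and
  \<open>var\<close> says that it preserves the variance \<open>\<tau>\<^sup>2\<close>.\<close>

locale gaussian_autoregression = prob_space M for M :: "'a measure" +
  fixes V :: "nat \<Rightarrow> 'a \<Rightarrow> real" and N :: nat and \<rho> \<sigma> \<tau> :: real and \<Gamma> :: "nat \<Rightarrow> nat \<Rightarrow> real"
  assumes V[measurable]: "\<And>j. V j \<in> borel_measurable M"
    and char: "\<And>c. (\<integral>\<omega>. iexp (\<Sum>j\<le>N. c j * V j \<omega>) \<partial>M) = of_real (exp (- (\<Sum>i\<le>N. \<Sum>j\<le>N. c i * c j * \<Gamma> i j) / 2))"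
    and sym: "\<And>i j. \<Gamma> i j = \<Gamma> j i" and diag: "\<And>i. \<Gamma> i i = \<tau>\<^sup>2"
    and markov: "\<And>j k. j \<le> k \<Longrightarrow> Suc k \<le> N \<Longrightarrow> \<Gamma> j (Suc k) = \<rho> * \<Gamma> j k"
    and \<tau>: "0 < \<tau>" and var: "\<sigma>\<^sup>2 + \<rho>\<^sup>2 * \<tau>\<^sup>2 = \<tau>\<^sup>2"
begin

text \<open>Written as a mixture of characters, the Gaussian square adds \<open>sqrt A * g\<close>
  to the coefficient of \<open>V m\<close>. The joint characteristic function then gives the
  exponential of a quadratic polynomial in \<open>g\<close>, to be integrated against the standard
  normal density.\<close>

lemma char_square:
  assumes m: "m \<le> N" and A: "0 \<le> A"
  shows "(\<integral>\<omega>. iexp (\<Sum>j\<le>N. c j * V j \<omega>) * of_real (exp (- A * (V m \<omega>)\<^sup>2 / 2)) \<partial>M)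
    = of_real (exp (- (\<Sum>i\<le>N. \<Sum>j\<le>N. c i * c j * \<Gamma> i j) / 2
        + A / (1 + A * \<tau>\<^sup>2) * (\<Sum>j\<le>N. c j * \<Gamma> j m)\<^sup>2 / 2) / sqrt (1 + A * \<tau>\<^sup>2))"
proof -
  define Q where "Q = (\<Sum>i\<le>N. \<Sum>j\<le>N. c i * c j * \<Gamma> i j)"
  define B where "B = (\<Sum>j\<le>N. c j * \<Gamma> j m)"
  define D where "D = 1 + A * \<tau>\<^sup>2"
  have D: "0 < D" using A by (simp add: D_def add_pos_nonneg)
  have "(\<integral>\<omega>. iexp (\<Sum>j\<le>N. c j * V j \<omega>) * of_real (exp (- A * (V m \<omega>)\<^sup>2 / 2)) \<partial>M)
    = (\<integral>g. (\<integral>\<omega>. iexp (\<Sum>j\<le>N. c j * V j \<omega>) * iexp (sqrt A * g * V m \<omega>) \<partial>M) \<partial>std_normal_distribution)"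
    by (rule gaussian_square_mixture[where B=1]) (use A in \<open>auto intro: prob_space_axioms\<close>)
  also have "\<dots> = (\<integral>g. of_real (exp (- (Q + 2 * (sqrt A * g) * B + (sqrt A * g)\<^sup>2 * \<tau>\<^sup>2) / 2)) \<partial>std_normal_distribution)"
  proof (intro Bochner_Integration.integral_cong refl)
    fix g
    define q where "q = sqrt A * g"
    define d where "d j = (if j = m then q else 0)" for j
    have s1: "(\<Sum>j\<le>N. d j * f j) = q * f m" for f :: "nat \<Rightarrow> real"
    proof -
      have "(\<Sum>j\<le>N. d j * f j) = (\<Sum>j\<le>N. if j = m then q * f j else 0)"
        by (intro sum.cong) (auto simp: d_def)
      then show ?thesis using m by (simp add: sum.delta)
    qed
    have "(\<integral>\<omega>. iexp (\<Sum>j\<le>N. c j * V j \<omega>) * iexp (sqrt A * g * V m \<omega>) \<partial>M) = (\<integral>\<omega>. iexp (\<Sum>j\<le>N. (c j + d j) * V j \<omega>) \<partial>M)"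
    proof (intro Bochner_Integration.integral_cong refl)
      fix \<omega>
      have "(\<Sum>j\<le>N. (c j + d j) * V j \<omega>) = (\<Sum>j\<le>N. c j * V j \<omega>) + sqrt A * g * V m \<omega>"
        by (simp add: distrib_right sum.distrib s1 q_def)
      then show "iexp (\<Sum>j\<le>N. c j * V j \<omega>) * iexp (sqrt A * g * V m \<omega>) = iexp (\<Sum>j\<le>N. (c j + d j) * V j \<omega>)"
        by (simp only: of_real_add distrib_left exp_add)
    qed
    also have "\<dots> = of_real (exp (- (\<Sum>i\<le>N. \<Sum>j\<le>N. (c i + d i) * (c j + d j) * \<Gamma> i j) / 2))" by (rule char)
    also have "(\<Sum>i\<le>N. \<Sum>j\<le>N. (c i + d i) * (c j + d j) * \<Gamma> i j) = Q + 2 * q * B + q\<^sup>2 * \<tau>\<^sup>2"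
    proof -
      have in1: "(\<Sum>j\<le>N. (c i + d i) * (c j + d j) * \<Gamma> i j) = (\<Sum>j\<le>N. c i * c j * \<Gamma> i j) + d i * (\<Sum>j\<le>N. c j * \<Gamma> i j) + q * (c i * \<Gamma> i m) + d i * (q * \<Gamma> i m)" for i
      proof -
        have "(\<Sum>j\<le>N. (c i + d i) * (c j + d j) * \<Gamma> i j) = (\<Sum>j\<le>N. c i * c j * \<Gamma> i j + d i * (c j * \<Gamma> i j) + c i * (d j * \<Gamma> i j) + d i * (d j * \<Gamma> i j))"
          by (intro sum.cong) (auto simp: algebra_simps)
        then show ?thesis by (simp add: sum.distrib s1 flip: sum_distrib_left)
      qed
      have "(\<Sum>j\<le>N. c j * \<Gamma> m j) = B" unfolding B_def by (intro sum.cong) (auto simp: sym)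
      then show ?thesis unfolding in1
        by (simp add: sum.distrib s1 Q_def diag power2_eq_square B_def flip: sum_distrib_left)
    qed
    finally show "(\<integral>\<omega>. iexp (\<Sum>j\<le>N. c j * V j \<omega>) * iexp (sqrt A * g * V m \<omega>) \<partial>M) = of_real (exp (- (Q + 2 * (sqrt A * g) * B + (sqrt A * g)\<^sup>2 * \<tau>\<^sup>2) / 2))"
      by (simp add: q_def)
  qed
  also have "\<dots> = of_real (\<integral>g. exp (- (Q + 2 * (sqrt A * g) * B + (sqrt A * g)\<^sup>2 * \<tau>\<^sup>2) / 2) \<partial>std_normal_distribution)"
    by (rule integral_complex_of_real)
  \<comment> \<open>Completing the square needs the division by \<open>\<tau>\<close>; afterwards
    the Gaussian integral applies with precision 1, mean \<open>B / \<tau>\<close> and slope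
    \<open>sqrt A * \<tau>\<close>.\<close>
  also have "(\<integral>g. exp (- (Q + 2 * (sqrt A * g) * B + (sqrt A * g)\<^sup>2 * \<tau>\<^sup>2) / 2) \<partial>std_normal_distribution)
    = (\<integral>g. exp (- Q / 2 + (B / \<tau>)\<^sup>2 / 2) * (std_normal_density g * exp (- 1 * (B / \<tau> + sqrt A * \<tau> * g)\<^sup>2 / 2)) \<partial>lborel)"
  proof (subst integral_density)
    have "exp (- (Q + 2 * (sqrt A * g) * B + (sqrt A * g)\<^sup>2 * \<tau>\<^sup>2) / 2) = exp (- Q / 2 + (B / \<tau>)\<^sup>2 / 2) * exp (- 1 * (B / \<tau> + sqrt A * \<tau> * g)\<^sup>2 / 2)" for g
    proof -
      have "(B / \<tau> + sqrt A * \<tau> * g)\<^sup>2 = (B / \<tau>)\<^sup>2 + 2 * (sqrt A * g) * B + (sqrt A * g)\<^sup>2 * \<tau>\<^sup>2"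
        using \<tau> by (simp add: power2_eq_square field_simps)
      then show ?thesis unfolding exp_add[symmetric] by (simp add: field_simps)
    qed
    then show "(LINT g|lborel. std_normal_density g *\<^sub>R exp (- (Q + 2 * (sqrt A * g) * B + (sqrt A * g)\<^sup>2 * \<tau>\<^sup>2) / 2)) =
       (\<integral>g. exp (- Q / 2 + (B / \<tau>)\<^sup>2 / 2) * (std_normal_density g * exp (- 1 * (B / \<tau> + sqrt A * \<tau> * g)\<^sup>2 / 2)) \<partial>lborel)"
      by (simp only: real_scaleR_def mult.left_commute)
  qed auto
  also have "\<dots> = exp (- Q / 2 + (B / \<tau>)\<^sup>2 / 2) * (exp (- 1 * (B / \<tau>)\<^sup>2 / (2 * (1 + 1 * (sqrt A * \<tau>)\<^sup>2))) / sqrt (1 + 1 * (sqrt A * \<tau>)\<^sup>2))"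
    by (subst integral_mult_right_zero) (subst gaussian_integral(2), simp_all)
  also have "1 + 1 * (sqrt A * \<tau>)\<^sup>2 = D" using A by (simp add: D_def power_mult_distrib)
  also have "exp (- Q / 2 + (B / \<tau>)\<^sup>2 / 2) * (exp (- 1 * (B / \<tau>)\<^sup>2 / (2 * D)) / sqrt D) = exp (- Q / 2 + A / D * B\<^sup>2 / 2) / sqrt D"
  proof -
    have "(B / \<tau>)\<^sup>2 / 2 + - 1 * (B / \<tau>)\<^sup>2 / (2 * D) = A / D * B\<^sup>2 / 2"
    proof -
      have "X / 2 + - 1 * X / (2 * D) = X * (D - 1) / (2 * D)" for X using D by (simp add: field_simps)
      then have "(B / \<tau>)\<^sup>2 / 2 + - 1 * (B / \<tau>)\<^sup>2 / (2 * D) = (B / \<tau>)\<^sup>2 * (D - 1) / (2 * D)" .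
      also have "\<dots> = (B / \<tau>)\<^sup>2 * (A * \<tau>\<^sup>2) / (2 * D)" by (simp add: D_def)
      also have "\<dots> = A / D * B\<^sup>2 / 2" using \<tau> by (simp add: power_divide mult_ac)
      finally show ?thesis .
    qed
    then have "- Q / 2 + A / D * B\<^sup>2 / 2 = (- Q / 2 + (B / \<tau>)\<^sup>2 / 2) + - 1 * (B / \<tau>)\<^sup>2 / (2 * D)" by linarith
    then show ?thesis by (simp only: exp_add times_divide_eq_right)
  qed
  finally show ?thesis by (simp only: Q_def B_def D_def)
qed

text \<open>The subtracted term is what the conditional expectation of the first one given
  \<open>V k\<close> would be, by the Gaussian integral with mean
  \<open>\<rho> * V k\<close>.\<close>

definition elim :: "nat \<Rightarrow> real \<Rightarrow> 'a \<Rightarrow> complex" where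
  "elim k A \<omega> = of_real (exp (- A * (V (Suc k) \<omega>)\<^sup>2 / 2)) -
     of_real (1 / sqrt (1 + A * \<sigma>\<^sup>2)) * of_real (exp (- (\<rho>\<^sup>2 * A / (1 + A * \<sigma>\<^sup>2)) * (V k \<omega>)\<^sup>2 / 2))"

lemma elim_measurable[measurable]: "elim k A \<in> borel_measurable M"
  unfolding elim_def by measurable

lemma norm_elim_le:
  assumes "0 \<le> A" shows "norm (elim k A \<omega>) \<le> 2"
proof -
  have 1: "1 \<le> 1 + A * \<sigma>\<^sup>2" using assms by simp
  then have p: "0 < 1 + A * \<sigma>\<^sup>2" by linarith
  have "norm (elim k A \<omega>) \<le> norm (complex_of_real (exp (- A * (V (Suc k) \<omega>)\<^sup>2 / 2))) +
     norm (complex_of_real (1 / sqrt (1 + A * \<sigma>\<^sup>2)) * of_real (exp (- (\<rho>\<^sup>2 * A / (1 + A * \<sigma>\<^sup>2)) * (V k \<omega>)\<^sup>2 / 2)))"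
    unfolding elim_def by (rule norm_triangle_ineq4)
  also have "\<dots> \<le> 1 + 1 * 1"
    unfolding norm_mult norm_of_real
  proof (intro add_mono mult_mono)
    have "0 \<le> \<rho>\<^sup>2 * A / (1 + A * \<sigma>\<^sup>2) * (V k \<omega>)\<^sup>2 / 2" using assms p by simp
    then have "- (\<rho>\<^sup>2 * A / (1 + A * \<sigma>\<^sup>2)) * (V k \<omega>)\<^sup>2 / 2 \<le> 0" by linarith
    then show "\<bar>exp (- (\<rho>\<^sup>2 * A / (1 + A * \<sigma>\<^sup>2)) * (V k \<omega>)\<^sup>2 / 2)\<bar> \<le> 1" by (simp only: abs_exp_cancel exp_le_one_iff)
    show "\<bar>1 / sqrt (1 + A * \<sigma>\<^sup>2)\<bar> \<le> 1" using 1 by simp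
  qed (use assms in auto)
  finally show ?thesis by simp
qed

text \<open>Orthogonality to functionals of the past replaces conditioning. For \<open>m = 0\<close>
  the two values of \<open>char_square\<close> agree: covariances with \<open>V (Suc k)\<close> are
  \<open>\<rho>\<close> times those with \<open>V k\<close> because \<open>c\<close> lives on
  indices up to \<open>k\<close>, and \<open>var\<close> gives
  \<open>1 + a * \<tau>^2 = (1 + A * \<tau>^2) / (1 + A * \<sigma>^2)\<close>. A further Gaussian
  factor in \<open>V m\<close> with \<open>m \<le> k\<close> is a mixture of characters, so it only
  alters \<open>c m\<close>; hence \<open>c\<close> is arbitrary in the induction.\<close>

lemma integral_elim_0:
  assumes A: "0 \<le> A" and k: "Suc k \<le> N" and w: "\<And>j. 0 \<le> w j"
    and c: "\<And>j. k < j \<Longrightarrow> c j = 0" and m: "m \<le> Suc k"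
  shows "(\<integral>\<omega>. iexp (\<Sum>j\<le>N. c j * V j \<omega>) * of_real (exp (- (\<Sum>j<m. w j * (V j \<omega>)\<^sup>2) / 2)) * elim k A \<omega> \<partial>M) = 0"
  using c m
proof (induction m arbitrary: c)
  case 0
  define a where "a = \<rho>\<^sup>2 * A / (1 + A * \<sigma>\<^sup>2)"
  have S: "0 < 1 + A * \<sigma>\<^sup>2" using A by (simp add: add_pos_nonneg)
  have T: "0 < 1 + A * \<tau>\<^sup>2" using A by (simp add: add_pos_nonneg)
  have a: "0 \<le> a" using A S by (simp add: a_def)
  have aT: "1 + a * \<tau>\<^sup>2 = (1 + A * \<tau>\<^sup>2) / (1 + A * \<sigma>\<^sup>2)"
  proof -
    have "1 + a * \<tau>\<^sup>2 = (1 + A * (\<sigma>\<^sup>2 + \<rho>\<^sup>2 * \<tau>\<^sup>2)) / (1 + A * \<sigma>\<^sup>2)"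
      using S by (simp add: a_def field_simps)
    then show ?thesis by (simp only: var)
  qed
  have aa: "a / (1 + a * \<tau>\<^sup>2) = \<rho>\<^sup>2 * (A / (1 + A * \<tau>\<^sup>2))"
    unfolding aT using S T by (simp add: a_def)
  have B: "(\<Sum>j\<le>N. c j * \<Gamma> j (Suc k)) = \<rho> * (\<Sum>j\<le>N. c j * \<Gamma> j k)"
  proof -
    have "c j * \<Gamma> j (Suc k) = \<rho> * (c j * \<Gamma> j k)" for j
      using 0 markov[of j k] k by (cases "j \<le> k") auto
    then show ?thesis by (simp only: sum_distrib_left)
  qed
  define Q where "Q = (\<Sum>i\<le>N. \<Sum>j\<le>N. c i * c j * \<Gamma> i j)"
  define b where "b = (\<Sum>j\<le>N. c j * \<Gamma> j k)"
  have bdd: "integrable M (\<lambda>\<omega>. iexp (\<Sum>j\<le>N. c j * V j \<omega>) * of_real (exp (- r * (V i \<omega>)\<^sup>2 / 2)))" if "0 \<le> r" for r i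
    by (rule integrable_const_bound[where B=1]) (use that in \<open>auto simp: norm_mult\<close>)
  have eq: "iexp (\<Sum>j\<le>N. c j * V j \<omega>) * of_real (exp (- (\<Sum>j<0. w j * (V j \<omega>)\<^sup>2) / 2)) * elim k A \<omega>
    = iexp (\<Sum>j\<le>N. c j * V j \<omega>) * of_real (exp (- A * (V (Suc k) \<omega>)\<^sup>2 / 2)) -
      of_real (1 / sqrt (1 + A * \<sigma>\<^sup>2)) * (iexp (\<Sum>j\<le>N. c j * V j \<omega>) * of_real (exp (- a * (V k \<omega>)\<^sup>2 / 2)))" for \<omega>
    by (simp add: elim_def a_def algebra_simps)
  have "(\<integral>\<omega>. iexp (\<Sum>j\<le>N. c j * V j \<omega>) * of_real (exp (- (\<Sum>j<0. w j * (V j \<omega>)\<^sup>2) / 2)) * elim k A \<omega> \<partial>M)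
    = (\<integral>\<omega>. iexp (\<Sum>j\<le>N. c j * V j \<omega>) * of_real (exp (- A * (V (Suc k) \<omega>)\<^sup>2 / 2)) \<partial>M) -
      of_real (1 / sqrt (1 + A * \<sigma>\<^sup>2)) * (\<integral>\<omega>. (iexp (\<Sum>j\<le>N. c j * V j \<omega>) * of_real (exp (- a * (V k \<omega>)\<^sup>2 / 2))) \<partial>M)"
    unfolding eq Bochner_Integration.integral_diff[OF bdd[OF A] integrable_mult_right[OF bdd[OF a]]]
    by (simp only: integral_mult_right_zero)
  also have "\<dots> = of_real (exp (- Q / 2 + A / (1 + A * \<tau>\<^sup>2) * (\<rho> * b)\<^sup>2 / 2) / sqrt (1 + A * \<tau>\<^sup>2) -
     1 / sqrt (1 + A * \<sigma>\<^sup>2) * (exp (- Q / 2 + a / (1 + a * \<tau>\<^sup>2) * b\<^sup>2 / 2) / sqrt (1 + a * \<tau>\<^sup>2)))"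
    unfolding char_square[OF k A] char_square[OF Suc_leD[OF k] a] B Q_def b_def
    by (simp only: of_real_diff of_real_mult)
  also have "\<dots> = 0"
    unfolding aa unfolding aT using S T by (simp add: real_sqrt_divide power_mult_distrib)
  finally show ?case .
next
  case (Suc m)
  have split: "iexp (\<Sum>j\<le>N. c j * V j \<omega>) * of_real (exp (- (\<Sum>j<Suc m. w j * (V j \<omega>)\<^sup>2) / 2)) * elim k A \<omega>
    = (iexp (\<Sum>j\<le>N. c j * V j \<omega>) * of_real (exp (- (\<Sum>j<m. w j * (V j \<omega>)\<^sup>2) / 2)) * elim k A \<omega>) * of_real (exp (- w m * (V m \<omega>)\<^sup>2 / 2))" for \<omega>
  proof -
    have "- (\<Sum>j<Suc m. w j * (V j \<omega>)\<^sup>2) / 2 = - (\<Sum>j<m. w j * (V j \<omega>)\<^sup>2) / 2 + - w m * (V m \<omega>)\<^sup>2 / 2"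
      by (simp add: field_simps)
    then show ?thesis by (simp only: exp_add of_real_mult mult_ac)
  qed
  have bd: "norm (iexp (\<Sum>j\<le>N. c j * V j \<omega>) * of_real (exp (- (\<Sum>j<m. w j * (V j \<omega>)\<^sup>2) / 2)) * elim k A \<omega>) \<le> 1 * 1 * 2" for \<omega>
    unfolding norm_mult
  proof (intro mult_mono norm_elim_le A)
    have "0 \<le> (\<Sum>j<m. w j * (V j \<omega>)\<^sup>2)" by (intro sum_nonneg mult_nonneg_nonneg w) auto
    then show "norm (complex_of_real (exp (- (\<Sum>j<m. w j * (V j \<omega>)\<^sup>2) / 2))) \<le> 1" by simp
  qed auto
  have "(\<integral>\<omega>. iexp (\<Sum>j\<le>N. c j * V j \<omega>) * of_real (exp (- (\<Sum>j<Suc m. w j * (V j \<omega>)\<^sup>2) / 2)) * elim k A \<omega> \<partial>M)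
    = (\<integral>g. (\<integral>\<omega>. (iexp (\<Sum>j\<le>N. c j * V j \<omega>) * of_real (exp (- (\<Sum>j<m. w j * (V j \<omega>)\<^sup>2) / 2)) * elim k A \<omega>)
        * iexp (sqrt (w m) * g * V m \<omega>) \<partial>M) \<partial>std_normal_distribution)"
    unfolding split by (rule gaussian_square_mixture[OF prob_space_axioms _ _ bd w]) measurable
  also have "\<dots> = (\<integral>g. 0 \<partial>std_normal_distribution)"
  proof (intro Bochner_Integration.integral_cong refl)
    fix g
    define d where "d j = (if j = m then sqrt (w m) * g else 0)" for j
    have s1: "(\<Sum>j\<le>N. d j * f j) = sqrt (w m) * g * f m" for f :: "nat \<Rightarrow> real"
    proof -
      have "(\<Sum>j\<le>N. d j * f j) = (\<Sum>j\<le>N. if j = m then sqrt (w m) * g * f j else 0)"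
        by (intro sum.cong) (auto simp: d_def)
      then show ?thesis using Suc.prems(2) k by (simp add: sum.delta)
    qed
    have e: "iexp (\<Sum>j\<le>N. c j * V j \<omega>) * iexp (sqrt (w m) * g * V m \<omega>) = iexp (\<Sum>j\<le>N. (c j + d j) * V j \<omega>)" for \<omega>
    proof -
      have "(\<Sum>j\<le>N. (c j + d j) * V j \<omega>) = (\<Sum>j\<le>N. c j * V j \<omega>) + sqrt (w m) * g * V m \<omega>"
        by (simp add: distrib_right sum.distrib s1)
      then show ?thesis by (simp only: of_real_add distrib_left exp_add)
    qed
    have "(iexp (\<Sum>j\<le>N. c j * V j \<omega>) * of_real (exp (- (\<Sum>j<m. w j * (V j \<omega>)\<^sup>2) / 2)) * elim k A \<omega>) * iexp (sqrt (w m) * g * V m \<omega>)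
      = iexp (\<Sum>j\<le>N. (c j + d j) * V j \<omega>) * of_real (exp (- (\<Sum>j<m. w j * (V j \<omega>)\<^sup>2) / 2)) * elim k A \<omega>" for \<omega>
    proof -
      have "I * E * L * J = K * E * L" if "I * J = K" for I E L J K :: complex
        using that[symmetric] by (simp only: mult_ac)
      then show ?thesis using e[of \<omega>] by blast
    qed
    moreover have "(\<integral>\<omega>. iexp (\<Sum>j\<le>N. (c j + d j) * V j \<omega>) * of_real (exp (- (\<Sum>j<m. w j * (V j \<omega>)\<^sup>2) / 2)) * elim k A \<omega> \<partial>M) = 0"
      using Suc.prems by (intro Suc.IH) (auto simp: d_def)
    ultimately show "(\<integral>\<omega>. (iexp (\<Sum>j\<le>N. c j * V j \<omega>) * of_real (exp (- (\<Sum>j<m. w j * (V j \<omega>)\<^sup>2) / 2)) * elim k A \<omega>)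
        * iexp (sqrt (w m) * g * V m \<omega>) \<partial>M) = 0" by (simp only:)
  qed
  finally show ?case by simp
qed

text \<open>Removing the last variable converts its weight \<open>A\<close> into the additional
  weight \<open>\<rho>\<^sup>2 * A / (1 + A * \<sigma>\<^sup>2)\<close> on its predecessor, which is
  the recursion of \<open>ou_laplace\<close>. Orthogonality is used with the trivial character, all
  \<open>c j\<close> being 0.\<close>

lemma laplace_eq_ou_laplace:
  assumes w: "\<And>j. 0 \<le> w j" and "k \<le> N" and "0 \<le> A"
  shows "(\<integral>\<omega>. exp (- ((\<Sum>j<k. w j * (V j \<omega>)\<^sup>2) + A * (V k \<omega>)\<^sup>2) / 2) \<partial>M) = ou_laplace \<rho> \<sigma> \<tau> w k A"
  using assms(2,3)
proof (induction k arbitrary: A)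
  case 0
  have "complex_of_real (\<integral>\<omega>. exp (- ((\<Sum>j<0. w j * (V j \<omega>)\<^sup>2) + A * (V 0 \<omega>)\<^sup>2) / 2) \<partial>M)
    = (\<integral>\<omega>. of_real (exp (- ((\<Sum>j<0. w j * (V j \<omega>)\<^sup>2) + A * (V 0 \<omega>)\<^sup>2) / 2)) \<partial>M)"
    by (rule integral_complex_of_real[symmetric])
  also have "\<dots> = of_real (1 / sqrt (1 + A * \<tau>\<^sup>2))"
    using char_square[of 0 A "\<lambda>_. 0"] 0 by simp
  finally show ?case by (simp only: of_real_eq_iff ou_laplace.simps)
next
  case (Suc k)
  define a where "a = \<rho>\<^sup>2 * A / (1 + A * \<sigma>\<^sup>2)"
  have S: "0 < 1 + A * \<sigma>\<^sup>2" using Suc.prems by (simp add: add_pos_nonneg)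
  have a: "0 \<le> a" using Suc.prems S by (simp add: a_def)
  define P where "P \<omega> = exp (- (\<Sum>j<Suc k. w j * (V j \<omega>)\<^sup>2) / 2)" for \<omega>
  define E1 where "E1 \<omega> = exp (- A * (V (Suc k) \<omega>)\<^sup>2 / 2)" for \<omega>
  define E2 where "E2 \<omega> = exp (- a * (V k \<omega>)\<^sup>2 / 2)" for \<omega>
  have [measurable]: "P \<in> borel_measurable M" "E1 \<in> borel_measurable M" "E2 \<in> borel_measurable M"
    unfolding P_def E1_def E2_def by measurable
  have P01: "\<bar>P \<omega>\<bar> \<le> 1" "\<bar>E1 \<omega>\<bar> \<le> 1" "\<bar>E2 \<omega>\<bar> \<le> 1" for \<omega>
  proof -
    have "0 \<le> (\<Sum>j<Suc k. w j * (V j \<omega>)\<^sup>2)" by (intro sum_nonneg mult_nonneg_nonneg w) auto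
    then show "\<bar>P \<omega>\<bar> \<le> 1" unfolding P_def abs_exp_cancel exp_le_one_iff by linarith
    show "\<bar>E1 \<omega>\<bar> \<le> 1" "\<bar>E2 \<omega>\<bar> \<le> 1" using Suc.prems a by (auto simp: E1_def E2_def)
  qed
  have int: "integrable M (\<lambda>\<omega>. P \<omega> * E1 \<omega>)" "integrable M (\<lambda>\<omega>. P \<omega> * E2 \<omega>)"
    by (intro integrable_const_bound[where B=1] AE_I2; use P01 in \<open>simp add: abs_mult mult_le_one\<close>)+
  have "complex_of_real (\<integral>\<omega>. P \<omega> * E1 \<omega> - 1 / sqrt (1 + A * \<sigma>\<^sup>2) * (P \<omega> * E2 \<omega>) \<partial>M)
    = (\<integral>\<omega>. of_real (P \<omega> * E1 \<omega> - 1 / sqrt (1 + A * \<sigma>\<^sup>2) * (P \<omega> * E2 \<omega>)) \<partial>M)"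
    by (rule integral_complex_of_real[symmetric])
  also have "\<dots> = (\<integral>\<omega>. iexp (\<Sum>j\<le>N. (\<lambda>_. 0) j * V j \<omega>) * of_real (exp (- (\<Sum>j<Suc k. w j * (V j \<omega>)\<^sup>2) / 2)) * elim k A \<omega> \<partial>M)"
    by (intro Bochner_Integration.integral_cong refl)
      (simp add: elim_def P_def E1_def E2_def a_def right_diff_distrib mult_ac del: sum.lessThan_Suc)
  also have "\<dots> = 0"
    by (rule integral_elim_0) (use Suc.prems w in auto)
  finally have "(\<integral>\<omega>. P \<omega> * E1 \<omega> - 1 / sqrt (1 + A * \<sigma>\<^sup>2) * (P \<omega> * E2 \<omega>) \<partial>M) = 0" by simp
  then have "(\<integral>\<omega>. P \<omega> * E1 \<omega> \<partial>M) = 1 / sqrt (1 + A * \<sigma>\<^sup>2) * (\<integral>\<omega>. P \<omega> * E2 \<omega> \<partial>M)"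
    using int by (subst (asm) Bochner_Integration.integral_diff) auto
  also have "(\<integral>\<omega>. P \<omega> * E2 \<omega> \<partial>M) = (\<integral>\<omega>. exp (- ((\<Sum>j<k. w j * (V j \<omega>)\<^sup>2) + (w k + a) * (V k \<omega>)\<^sup>2) / 2) \<partial>M)"
    by (intro Bochner_Integration.integral_cong refl) (simp add: P_def E2_def field_simps flip: exp_add)
  also have "\<dots> = ou_laplace \<rho> \<sigma> \<tau> w k (w k + a)"
    by (rule Suc.IH) (use Suc.prems w a in auto)
  also have "(\<integral>\<omega>. P \<omega> * E1 \<omega> \<partial>M) = (\<integral>\<omega>. exp (- ((\<Sum>j<Suc k. w j * (V j \<omega>)\<^sup>2) + A * (V (Suc k) \<omega>)\<^sup>2) / 2) \<partial>M)"
    by (intro Bochner_Integration.integral_cong refl) (simp add: P_def E1_def field_simps flip: exp_add del: sum.lessThan_Suc)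
  finally show ?case by (simp add: a_def)
qed

end

section \<open>Convergence of moment generating functions\<close>

text \<open>Each term of the exponential series at \<open>K * \<bar>y\<bar>\<close> is at most
  \<open>exp (K * \<bar>y\<bar>)\<close>, so one exponential moment justifies termwise integration
  and bounds the coefficients geometrically. A complex \<open>z\<close> covers both the moment
  generating function and the characteristic function.\<close>

lemma exp_moment_sums:
  assumes M: "real_distribution M" and K: "0 \<le> K" and int: "integrable M (\<lambda>y. exp (K * \<bar>y\<bar>))"
    and z: "norm (z::complex) \<le> K"
  shows "(\<lambda>k. of_real ((\<integral>y. y ^ k \<partial>M) / fact k) * z ^ k) sums (\<integral>y. exp (z * of_real y) \<partial>M)"
    and "\<bar>(\<integral>y. y ^ k \<partial>M) / fact k\<bar> * K ^ k \<le> (\<integral>y. exp (K * \<bar>y\<bar>) \<partial>M)"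
proof -
  interpret real_distribution M by fact
  have pw: "(K * \<bar>y\<bar>) ^ k / fact k \<le> exp (K * \<bar>y\<bar>)" for y :: real and k
  proof -
    have "(K * \<bar>y\<bar>) ^ k / fact k = (\<Sum>j\<in>{k}. (K * \<bar>y\<bar>) ^ j /\<^sub>R fact j)" by (simp add: divide_inverse mult.commute)
    also have "\<dots> \<le> (\<Sum>j. (K * \<bar>y\<bar>) ^ j /\<^sub>R fact j)"
      using K by (intro sum_le_suminf summable_exp_generic) auto
    finally show ?thesis by (simp add: exp_def)
  qed
  have int1: "integrable M (\<lambda>y. (K * \<bar>y\<bar>) ^ k / fact k)" for k
    by (rule Bochner_Integration.integrable_bound[OF int]) (use pw K in \<open>auto intro!: AE_I2\<close>)
  show "\<bar>(\<integral>y. y ^ k \<partial>M) / fact k\<bar> * K ^ k \<le> (\<integral>y. exp (K * \<bar>y\<bar>) \<partial>M)"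
  proof -
    have "\<bar>(\<integral>y. y ^ k \<partial>M) / fact k\<bar> * K ^ k = \<bar>\<integral>y. y ^ k * (K ^ k / fact k) \<partial>M\<bar>"
      using K by (simp add: abs_mult)
    also have "\<dots> \<le> (\<integral>y. \<bar>y ^ k * (K ^ k / fact k)\<bar> \<partial>M)"
      by (rule integral_abs_bound)
    also have "\<dots> = (\<integral>y. (K * \<bar>y\<bar>) ^ k / fact k \<partial>M)"
      using K by (intro Bochner_Integration.integral_cong) (auto simp: abs_mult power_mult_distrib power_abs)
    also have "\<dots> \<le> (\<integral>y. exp (K * \<bar>y\<bar>) \<partial>M)"
      by (intro integral_mono int int1 pw)
    finally show ?thesis .
  qed
  define f where "f k y = of_real (y ^ k / fact k) * z ^ k" for k and y :: real
  have fn: "norm (f k y) \<le> (K * \<bar>y\<bar>) ^ k / fact k" for k y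
  proof -
    have "norm (f k y) = (norm z * \<bar>y\<bar>) ^ k / fact k"
      by (simp add: f_def norm_mult norm_power norm_divide power_mult_distrib power_abs)
    also have "\<dots> \<le> (K * \<bar>y\<bar>) ^ k / fact k"
      by (intro divide_right_mono power_mono mult_right_mono z) auto
    finally show ?thesis .
  qed
  have fint: "integrable M (f k)" for k
  proof (rule Bochner_Integration.integrable_bound[OF int1[of k]])
    show "f k \<in> borel_measurable M" unfolding f_def by measurable
    show "AE y in M. norm (f k y) \<le> norm ((K * \<bar>y\<bar>) ^ k / fact k)"
      using fn K by (intro AE_I2) auto
  qed
  have expsums: "(\<lambda>k. (K * \<bar>y\<bar>) ^ k / fact k) sums exp (K * \<bar>y\<bar>)" for y :: real
    using exp_converges[of "K * \<bar>y\<bar>"] by (simp add: divide_inverse mult.commute)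
  have "(\<lambda>k. integral\<^sup>L M (f k)) sums (\<integral>y. (\<Sum>k. f k y) \<partial>M)"
  proof (rule sums_integral)
    show "AE y in M. summable (\<lambda>k. norm (f k y))"
    proof (intro AE_I2)
      fix y
      show "summable (\<lambda>k. norm (f k y))"
        by (rule summable_comparison_test[OF _ sums_summable[OF expsums[of y]]]) (use fn in auto)
    qed
    show "summable (\<lambda>k. \<integral>y. norm (f k y) \<partial>M)"
    proof (rule bounded_imp_summable)
      show "0 \<le> (\<integral>y. norm (f k y) \<partial>M)" for k by simp
      fix n
      have "(\<Sum>k\<le>n. \<integral>y. norm (f k y) \<partial>M) = (\<integral>y. (\<Sum>k\<le>n. norm (f k y)) \<partial>M)"
        using fint by (subst Bochner_Integration.integral_sum) auto
      also have "\<dots> \<le> (\<integral>y. exp (K * \<bar>y\<bar>) \<partial>M)"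
      proof (intro integral_mono int)
        fix y
        have "(\<Sum>k\<le>n. norm (f k y)) \<le> (\<Sum>k\<le>n. (K * \<bar>y\<bar>) ^ k / fact k)" by (intro sum_mono fn)
        also have "\<dots> \<le> exp (K * \<bar>y\<bar>)"
          using sum_le_suminf[OF sums_summable[OF expsums[of y]], of "{..n}"] K sums_unique[OF expsums[of y]] by simp
        finally show "(\<Sum>k\<le>n. norm (f k y)) \<le> exp (K * \<bar>y\<bar>)" .
      qed (use fint in auto)
      finally show "(\<Sum>k\<le>n. \<integral>y. norm (f k y) \<partial>M) \<le> (\<integral>y. exp (K * \<bar>y\<bar>) \<partial>M)" .
    qed
  qed (rule fint)
  also have "(\<lambda>y. \<Sum>k. f k y) = (\<lambda>y. exp (z * of_real y))"
  proof
    fix y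
    have "(\<lambda>k. (z * of_real y) ^ k /\<^sub>R fact k) sums exp (z * of_real y)" by (rule exp_converges)
    also have "(\<lambda>k. (z * of_real y) ^ k /\<^sub>R fact k) = (\<lambda>k. f k y)"
      by (simp add: f_def fun_eq_iff power_mult_distrib scaleR_conv_of_real divide_inverse mult_ac)
    finally show "(\<Sum>k. f k y) = exp (z * of_real y)" by (rule sums_unique[symmetric])
  qed
  also have "(\<lambda>k. integral\<^sup>L M (f k)) = (\<lambda>k. of_real ((\<integral>y. y ^ k \<partial>M) / fact k) * z ^ k)"
  proof
    fix k
    have "integral\<^sup>L M (f k) = (\<integral>y. of_real (y ^ k / fact k) \<partial>M) * z ^ k"
      unfolding f_def by (rule integral_mult_left_zero)
    also have "(\<integral>y. complex_of_real (y ^ k / fact k) \<partial>M) = of_real (\<integral>y. y ^ k / fact k \<partial>M)"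
      by (rule integral_complex_of_real)
    finally show "integral\<^sup>L M (f k) = of_real ((\<integral>y. y ^ k \<partial>M) / fact k) * z ^ k" by simp
  qed
  finally show "(\<lambda>k. of_real ((\<integral>y. y ^ k \<partial>M) / fact k) * z ^ k) sums (\<integral>y. exp (z * of_real y) \<partial>M)" .
qed

text \<open>Convergence on a real interval suffices, by induction on \<open>k\<close>: once the
  earlier coefficients vanish in the limit, dividing the series by \<open>x ^ k\<close> leaves
  \<open>e n k\<close> up to a tail of size at most \<open>x * (2 * B / K ^ Suc k)\<close>, which is
  small for a small fixed \<open>x\<close>, uniformly in \<open>n\<close>.\<close>

lemma power_series_coeff_tendsto_0:
  fixes e :: "nat \<Rightarrow> nat \<Rightarrow> real"
  assumes K: "0 < K" and bound: "\<And>n k. \<bar>e n k\<bar> * K ^ k \<le> B"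
    and lim: "\<And>x. 0 < x \<Longrightarrow> x < K \<Longrightarrow> (\<lambda>n. \<Sum>k. e n k * x ^ k) \<longlonglongrightarrow> 0"
  shows "(\<lambda>n. e n k) \<longlonglongrightarrow> 0"
proof (induction k rule: less_induct)
  case (less k)
  have B: "0 \<le> B" using bound[of 0 0] abs_ge_zero[of "e 0 0"] by simp
  have bd: "norm (e n j * x ^ j) \<le> B * (x / K) ^ j" if "0 < x" for n j x
  proof -
    have "norm (e n j * x ^ j) = (\<bar>e n j\<bar> * K ^ j) * (x / K) ^ j"
      using K that by (simp add: abs_mult power_divide)
    also have "\<dots> \<le> B * (x / K) ^ j" using K that by (intro mult_right_mono bound) auto
    finally show ?thesis .
  qed
  have summ: "summable (\<lambda>j. e n j * x ^ j)" if "0 < x" "x < K" for n x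
    by (rule summable_comparison_test'[of "\<lambda>j. B * (x / K) ^ j" 0]) (use K that bd in \<open>auto intro!: summable_mult summable_geometric\<close>)
  have key: "\<bar>e n k\<bar> \<le> \<bar>\<Sum>j. e n j * x ^ j\<bar> / x ^ k + (\<Sum>j<k. \<bar>e n j\<bar> * x ^ j) / x ^ k + x * (2 * B / K ^ Suc k)"
    if x: "0 < x" "x \<le> K / 2" for n x
  proof -
    have xK: "x < K" using x K by linarith
    define T where "T = (\<Sum>j. e n (j + Suc k) * x ^ (j + Suc k))"
    have "(\<Sum>j. e n j * x ^ j) = T + (\<Sum>j<Suc k. e n j * x ^ j)"
      unfolding T_def by (rule suminf_split_initial_segment) (rule summ[OF x(1) xK])
    then have "e n k * x ^ k = (\<Sum>j. e n j * x ^ j) - (\<Sum>j<k. e n j * x ^ j) - T" by simp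
    moreover have "\<bar>e n k\<bar> * x ^ k = \<bar>e n k * x ^ k\<bar>" using x by (simp add: abs_mult)
    ultimately have "\<bar>e n k\<bar> * x ^ k \<le> \<bar>\<Sum>j. e n j * x ^ j\<bar> + \<bar>\<Sum>j<k. e n j * x ^ j\<bar> + \<bar>T\<bar>"
      by linarith
    also have "\<bar>\<Sum>j<k. e n j * x ^ j\<bar> \<le> (\<Sum>j<k. \<bar>e n j\<bar> * x ^ j)"
      using x by (intro order_trans[OF sum_abs]) (auto simp: abs_mult)
    also have "\<bar>T\<bar> \<le> (\<Sum>j. B * (x / K) ^ (j + Suc k))"
      unfolding T_def real_norm_def[symmetric]
    proof (rule norm_suminf_le)
      show "summable (\<lambda>j. B * (x / K) ^ (j + Suc k))"
        using x K xK by (subst summable_iff_shift[of "\<lambda>j. B * (x / K) ^ j"]) (auto intro!: summable_mult summable_geometric)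
    qed (rule bd[OF x(1)])
    also have "(\<Sum>j. B * (x / K) ^ (j + Suc k)) = (\<Sum>j. B * (x / K) ^ Suc k * (x / K) ^ j)"
      by (simp add: power_add mult_ac)
    also have "\<dots> = B * (x / K) ^ Suc k * (1 / (1 - x / K))"
      using x K xK by (subst suminf_mult) (auto intro!: summable_geometric simp: suminf_geometric)
    also have "\<dots> \<le> B * (x / K) ^ Suc k * 2"
      using x K xK B by (intro mult_left_mono) (auto simp: field_simps)
    finally have "\<bar>e n k\<bar> * x ^ k \<le> \<bar>\<Sum>j. e n j * x ^ j\<bar> + (\<Sum>j<k. \<bar>e n j\<bar> * x ^ j) + B * (x / K) ^ Suc k * 2"
      by simp
    then have "\<bar>e n k\<bar> \<le> (\<bar>\<Sum>j. e n j * x ^ j\<bar> + (\<Sum>j<k. \<bar>e n j\<bar> * x ^ j) + B * (x / K) ^ Suc k * 2) / x ^ k"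
      using x by (simp add: pos_le_divide_eq)
    also have "\<dots> = \<bar>\<Sum>j. e n j * x ^ j\<bar> / x ^ k + (\<Sum>j<k. \<bar>e n j\<bar> * x ^ j) / x ^ k + (B * (x / K) ^ Suc k * 2) / x ^ k"
      by (simp add: add_divide_distrib)
    also have "(B * (x / K) ^ Suc k * 2) / x ^ k = x * (2 * B / K ^ Suc k)"
      using x by (simp add: power_divide)
    finally show ?thesis .
  qed
  show ?case
  proof (rule LIMSEQ_I)
    fix r :: real assume r: "0 < r"
    \<comment> \<open>The summand 1 keeps \<open>D\<close> positive when \<open>B = 0\<close>. In
      the choice of \<open>x\<close>, the bound \<open>K / 2\<close> makes the geometric factor at
      most 2, and \<open>r / (2 * D)\<close> makes the tail at most \<open>r / 2\<close>.\<close>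
    define D where "D = 2 * B / K ^ Suc k + 1"
    have D: "D > 0" using B K by (simp add: D_def add_nonneg_pos)
    define x where "x = min (K / 2) (r / (2 * D))"
    have x: "0 < x" "x \<le> K / 2" using K r D by (auto simp: x_def)
    have xD: "x * (2 * B / K ^ Suc k) \<le> r / 2"
    proof -
      have "x * (2 * B / K ^ Suc k) \<le> x * D" using x by (intro mult_left_mono) (auto simp: D_def)
      also have "\<dots> \<le> r / (2 * D) * D" using D by (intro mult_right_mono) (auto simp: x_def)
      finally show ?thesis using D by simp
    qed
    have "(\<lambda>n. \<bar>\<Sum>j. e n j * x ^ j\<bar> / x ^ k + (\<Sum>j<k. \<bar>e n j\<bar> * x ^ j) / x ^ k)
        \<longlonglongrightarrow> \<bar>0\<bar> / x ^ k + (\<Sum>j<k. \<bar>0\<bar> * x ^ j) / x ^ k"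
      using x K by (intro tendsto_intros lim less.IH) auto
    then have "(\<lambda>n. \<bar>\<Sum>j. e n j * x ^ j\<bar> / x ^ k + (\<Sum>j<k. \<bar>e n j\<bar> * x ^ j) / x ^ k) \<longlonglongrightarrow> 0" by simp
    then have "eventually (\<lambda>n. \<bar>\<Sum>j. e n j * x ^ j\<bar> / x ^ k + (\<Sum>j<k. \<bar>e n j\<bar> * x ^ j) / x ^ k < r / 2) sequentially"
      by (rule order_tendstoD) (use r in auto)
    then have "eventually (\<lambda>n. \<bar>e n k\<bar> < r) sequentially"
    proof eventually_elim
      case (elim n)
      with key[OF x, of n] xD show ?case by linarith
    qed
    then show "\<exists>no. \<forall>n\<ge>no. norm (e n k - 0) < r" by (simp add: eventually_sequentially)
  qed
qed

text \<open>Real exponential moments determine the limit of every Taylor coefficient, and the same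
  coefficients evaluated at \<open>\<i> * t\<close> give the characteristic function. The uniform
  bound \<open>B\<close> dominates the series geometrically because
  \<open>\<bar>t\<bar> < K\<close>.\<close>

lemma char_tendsto_of_mgf_bounded:
  assumes Mn: "\<And>n. real_distribution (M n)" and M: "real_distribution N" and K: "0 < K"
    and int: "\<And>n. integrable (M n) (\<lambda>y. exp (K * \<bar>y\<bar>))" "integrable N (\<lambda>y. exp (K * \<bar>y\<bar>))"
    and bnd: "\<And>n. (\<integral>y. exp (K * \<bar>y\<bar>) \<partial>M n) \<le> B"
    and lim: "\<And>x. 0 < x \<Longrightarrow> x < K \<Longrightarrow> (\<lambda>n. \<integral>y. exp (x * y) \<partial>M n) \<longlonglongrightarrow> (\<integral>y. exp (x * y) \<partial>N)"
    and t: "\<bar>t\<bar> < K"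
  shows "(\<lambda>n. char (M n) t) \<longlonglongrightarrow> char N t"
proof -
  define c where "c n k = (\<integral>y. y ^ k \<partial>M n) / fact k" for n k
  define d where "d k = (\<integral>y. y ^ k \<partial>N) / fact k" for k
  have K0: "0 \<le> K" using K by simp
  note Sn = exp_moment_sums(1)[OF Mn K0 int(1), folded c_def]
  note S = exp_moment_sums(1)[OF M K0 int(2), folded d_def]
  have cb: "\<bar>c n k\<bar> * K ^ k \<le> B" for n k
    using exp_moment_sums(2)[OF Mn K0 int(1), of 0 n k] K bnd[of n] by (simp add: c_def)
  have db: "\<bar>d k\<bar> * K ^ k \<le> (\<integral>y. exp (K * \<bar>y\<bar>) \<partial>N)" for k
    using exp_moment_sums(2)[OF M K0 int(2), of 0 k] K by (simp add: d_def)
  have realS: "(\<lambda>k. (\<integral>y. y ^ k \<partial>P) / fact k * x ^ k) sums (\<integral>y. exp (x * y) \<partial>P)"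
    if "real_distribution P" "integrable P (\<lambda>y. exp (K * \<bar>y\<bar>))" "0 < x" "x < K" for P x
  proof -
    have "(\<lambda>k. of_real ((\<integral>y. y ^ k \<partial>P) / fact k) * complex_of_real x ^ k) sums (\<integral>y. exp (complex_of_real x * of_real y) \<partial>P)"
      by (rule exp_moment_sums(1)[OF that(1) K0 that(2)]) (use that in auto)
    also have "(\<integral>y. exp (complex_of_real x * of_real y) \<partial>P) = (\<integral>y. complex_of_real (exp (x * y)) \<partial>P)"
      by (simp only: exp_of_real flip: of_real_mult)
    also have "\<dots> = of_real (\<integral>y. exp (x * y) \<partial>P)" by (rule integral_complex_of_real)
    finally have "(\<lambda>k. complex_of_real ((\<integral>y. y ^ k \<partial>P) / fact k * x ^ k)) sums of_real (\<integral>y. exp (x * y) \<partial>P)"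
      by simp
    then show ?thesis by (simp only: sums_of_real_iff)
  qed
  have "(\<lambda>n. c n k - d k) \<longlonglongrightarrow> 0" for k
  proof (rule power_series_coeff_tendsto_0[OF K])
    show "\<bar>c n k - d k\<bar> * K ^ k \<le> B + (\<integral>y. exp (K * \<bar>y\<bar>) \<partial>N)" for n k
    proof -
      have "\<bar>c n k - d k\<bar> * K ^ k \<le> (\<bar>c n k\<bar> + \<bar>d k\<bar>) * K ^ k" using K by (intro mult_right_mono) auto
      then show ?thesis using cb[of n k] db[of k] by (simp add: distrib_right)
    qed
    fix x assume x: "0 < x" "x < K"
    have "(\<lambda>k. (c n k - d k) * x ^ k) sums ((\<integral>y. exp (x * y) \<partial>M n) - (\<integral>y. exp (x * y) \<partial>N))" for n
      using sums_diff[OF realS[OF Mn int(1) x] realS[OF M int(2) x], of n] by (simp add: c_def d_def left_diff_distrib)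
    then have "(\<lambda>n. \<Sum>k. (c n k - d k) * x ^ k) = (\<lambda>n. (\<integral>y. exp (x * y) \<partial>M n) - (\<integral>y. exp (x * y) \<partial>N))"
      by (simp add: sums_iff)
    then show "(\<lambda>n. \<Sum>k. (c n k - d k) * x ^ k) \<longlonglongrightarrow> 0"
      using lim[OF x] by (simp add: LIM_zero)
  qed
  then have cd: "(\<lambda>n. c n k) \<longlonglongrightarrow> d k" for k by (simp add: LIM_zero_iff)
  let ?z = "\<i> * of_real t"
  have nz: "norm ?z \<le> K" using t by (simp add: norm_mult)
  have ch: "char P t = (\<integral>y. exp (?z * of_real y) \<partial>P)" for P
    unfolding char_def by (simp add: mult_ac)
  have "(\<lambda>n. \<Sum>k. of_real (c n k) * ?z ^ k) \<longlonglongrightarrow> (\<Sum>k. of_real (d k) * ?z ^ k)"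
  proof (rule tannerys_theorem[THEN conjunct2, THEN conjunct2])
    show "summable (\<lambda>k. B * (\<bar>t\<bar> / K) ^ k)" using t K by (intro summable_mult summable_geometric) auto
    show "\<forall>\<^sub>F (k, n) in at_top \<times>\<^sub>F sequentially. norm (complex_of_real (c n k) * ?z ^ k) \<le> B * (\<bar>t\<bar> / K) ^ k"
    proof (rule always_eventually, clarify)
      fix k n
      have "norm (complex_of_real (c n k) * ?z ^ k) = \<bar>c n k\<bar> * K ^ k * (\<bar>t\<bar> / K) ^ k"
        using K by (simp add: norm_mult norm_power power_divide)
      also have "\<dots> \<le> B * (\<bar>t\<bar> / K) ^ k" using K by (intro mult_right_mono cb) auto
      finally show "norm (complex_of_real (c n k) * ?z ^ k) \<le> B * (\<bar>t\<bar> / K) ^ k" .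
    qed
  qed (auto intro!: tendsto_intros cd)
  then show ?thesis
    using sums_unique[OF Sn[OF nz]] sums_unique[OF S[OF nz]] by (simp add: ch)
qed

text \<open>Levy continuity needs each \<open>t\<close> separately, so the radius \<open>K\<close>
  may depend on \<open>t\<close>. Integrability is required only eventually, as tilted densities
  have a given exponential moment only for large \<open>n\<close>; the initial terms are shifted
  away.\<close>

lemma weak_conv_of_mgf:
  assumes Mn: "\<And>n. real_distribution (M n)" and M: "real_distribution N"
    and int: "\<And>x. eventually (\<lambda>n. integrable (M n) (\<lambda>y. exp (x * y))) sequentially" "\<And>x. integrable N (\<lambda>y. exp (x * y))"
    and lim: "\<And>x. (\<lambda>n. \<integral>y. exp (x * y) \<partial>M n) \<longlonglongrightarrow> (\<integral>y. exp (x * y) \<partial>N)"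
  shows "weak_conv_m M N"
proof (rule levy_continuity[OF Mn M])
  fix t :: real
  define K where "K = \<bar>t\<bar> + 1"
  have K: "K > 0" "\<bar>t\<bar> < K" by (auto simp: K_def)
  have le: "exp (K * \<bar>y\<bar>) \<le> exp (K * y) + exp (- K * y)" for y :: real
    by (cases "0 \<le> y") auto
  have abs_int: "integrable P (\<lambda>y. exp (K * \<bar>y\<bar>)) \<and> (\<integral>y. exp (K * \<bar>y\<bar>) \<partial>P) \<le> (\<integral>y. exp (K * y) \<partial>P) + (\<integral>y. exp (- K * y) \<partial>P)"
    if P: "real_distribution P" "integrable P (\<lambda>y. exp (K * y))" "integrable P (\<lambda>y. exp (- K * y))" for P
  proof -
    interpret real_distribution P by fact
    have 1: "integrable P (\<lambda>y. exp (K * y) + exp (- K * y))" using that by simp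
    have 2: "integrable P (\<lambda>y. exp (K * \<bar>y\<bar>))"
      by (rule Bochner_Integration.integrable_bound[OF 1]) (use le in \<open>auto intro!: AE_I2 simp: abs_of_nonneg\<close>)
    have "(\<integral>y. exp (K * \<bar>y\<bar>) \<partial>P) \<le> (\<integral>y. exp (K * y) + exp (- K * y) \<partial>P)"
      by (intro integral_mono 1 2 le)
    then show ?thesis using 2 that by simp
  qed
  define B where "B = (\<integral>y. exp (K * y) \<partial>N) + 1 + ((\<integral>y. exp (- K * y) \<partial>N) + 1)"
  have "eventually (\<lambda>n. integrable (M n) (\<lambda>y. exp (K * y)) \<and> integrable (M n) (\<lambda>y. exp (- K * y)) \<and>
     (\<integral>y. exp (K * y) \<partial>M n) < (\<integral>y. exp (K * y) \<partial>N) + 1 \<and>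
     (\<integral>y. exp (- K * y) \<partial>M n) < (\<integral>y. exp (- K * y) \<partial>N) + 1) sequentially"
    by (intro eventually_conj int order_tendstoD[OF lim]) auto
  then obtain n0 where n0: "\<And>n. n \<ge> n0 \<Longrightarrow> integrable (M n) (\<lambda>y. exp (K * y)) \<and> integrable (M n) (\<lambda>y. exp (- K * y)) \<and>
     (\<integral>y. exp (K * y) \<partial>M n) < (\<integral>y. exp (K * y) \<partial>N) + 1 \<and>
     (\<integral>y. exp (- K * y) \<partial>M n) < (\<integral>y. exp (- K * y) \<partial>N) + 1"
    unfolding eventually_sequentially by blast
  have "(\<lambda>n. char (M (n + n0)) t) \<longlonglongrightarrow> char N t"
  proof (rule char_tendsto_of_mgf_bounded[where K = K and B = B])
    fix n
    show "integrable (M (n + n0)) (\<lambda>y. exp (K * \<bar>y\<bar>))" "(\<integral>y. exp (K * \<bar>y\<bar>) \<partial>M (n + n0)) \<le> B"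
      using n0[of "n + n0"] abs_int[OF Mn[of "n + n0"]] by (auto simp: B_def)
    show "integrable N (\<lambda>y. exp (K * \<bar>y\<bar>))" using abs_int[OF M int(2) int(2)] by simp
  next
    fix x
    show "(\<lambda>n. \<integral>y. exp (x * y) \<partial>M (n + n0)) \<longlonglongrightarrow> (\<integral>y. exp (x * y) \<partial>N)"
      by (rule LIMSEQ_ignore_initial_segment[OF lim])
  qed (use K Mn M in auto)
  then show "(\<lambda>n. char (M n) t) \<longlonglongrightarrow> char N t" by (rule LIMSEQ_offset)
qed

section \<open>A Tauberian theorem for log-concave functions\<close>

lemma measure_density_le:
  assumes [measurable]: "g \<in> borel_measurable borel" and "a \<le> b" and "0 \<le> c"
    and "\<And>x. a < x \<Longrightarrow> x \<le> b \<Longrightarrow> g x \<le> c"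
  shows "measure (density lborel (\<lambda>x. ennreal (g x))) {a<..b} \<le> c * (b - a)"
proof -
  have "emeasure (density lborel (\<lambda>x. ennreal (g x))) {a<..b} = (\<integral>\<^sup>+x. ennreal (g x) * indicator {a<..b} x \<partial>lborel)"
    by (rule emeasure_density) auto
  also have "\<dots> \<le> (\<integral>\<^sup>+x. ennreal c * indicator {a<..b} x \<partial>lborel)"
    using assms by (intro nn_integral_mono) (auto simp: indicator_def intro!: ennreal_leI)
  also have "\<dots> = ennreal (c * (b - a))"
    using assms by (subst nn_integral_cmult_indicator) (auto simp: ennreal_mult)
  finally show ?thesis
    using assms by (simp add: measure_def enn2real_leI)
qed

lemma measure_density_ge:
  assumes [measurable]: "g \<in> borel_measurable borel" and "a \<le> b" and "0 \<le> c"
    and "finite_measure (density lborel (\<lambda>x. ennreal (g x)))"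
    and "\<And>x. a < x \<Longrightarrow> x \<le> b \<Longrightarrow> c \<le> g x"
  shows "c * (b - a) \<le> measure (density lborel (\<lambda>x. ennreal (g x))) {a<..b}"
proof -
  interpret finite_measure "density lborel (\<lambda>x. ennreal (g x))" by fact
  have "ennreal (c * (b - a)) = (\<integral>\<^sup>+x. ennreal c * indicator {a<..b} x \<partial>lborel)"
    using assms by (subst nn_integral_cmult_indicator) (auto simp: ennreal_mult)
  also have "\<dots> \<le> (\<integral>\<^sup>+x. ennreal (g x) * indicator {a<..b} x \<partial>lborel)"
    using assms by (intro nn_integral_mono) (auto simp: indicator_def intro!: ennreal_leI)
  also have "\<dots> = emeasure (density lborel (\<lambda>x. ennreal (g x))) {a<..b}"
    by (rule emeasure_density[symmetric]) auto
  finally show ?thesis by (simp add: emeasure_eq_measure)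
qed

lemma weak_conv_m_Ioc:
  assumes Mn: "\<And>n. real_distribution (M n)" and N: "real_distribution N"
    and wc: "weak_conv_m M N" and na: "\<And>x. measure N {x} = 0" and ab: "a < b"
  shows "(\<lambda>n. measure (M n) {a<..b}) \<longlonglongrightarrow> measure N {a<..b}"
proof -
  interpret N: real_distribution N by fact
  interpret Mn: real_distribution "M n" for n by fact
  have fN: "finite_borel_measure N" and fM: "\<And>n. finite_borel_measure (M n)"
    by (rule N.finite_borel_measure_M Mn.finite_borel_measure_M)+
  have "(\<lambda>n. cdf (M n) x) \<longlonglongrightarrow> cdf N x" for x
    using wc na finite_borel_measure.isCont_cdf[OF fN] by (auto simp: weak_conv_m_def weak_conv_def)
  then have "(\<lambda>n. cdf (M n) b - cdf (M n) a) \<longlonglongrightarrow> cdf N b - cdf N a" by (intro tendsto_diff)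
  then show ?thesis
    using finite_borel_measure.cdf_diff_eq[OF fN ab] finite_borel_measure.cdf_diff_eq[OF fM ab] by simp
qed

lemma normal_density_antimono_abs:
  assumes "0 < \<sigma>" "\<bar>x\<bar> \<le> \<bar>y\<bar>"
  shows "normal_density 0 \<sigma> y \<le> normal_density 0 \<sigma> x"
proof -
  have "x\<^sup>2 \<le> y\<^sup>2" using assms(2) by (simp add: abs_le_square_iff)
  then show ?thesis using assms(1) by (auto simp: normal_density_def intro!: divide_right_mono)
qed

text \<open>Two-sided mass near a point gives large values on both sides of it, and log-concavity
  fills the gap between them: this bounds \<open>g n\<close> from below. If \<open>g n 0\<close>
  stayed above the limit density, interpolation with the value at \<open>1/2\<close> would keep
  \<open>g n\<close> too large on a whole interval \<open>{0<..b}\<close>, contradicting its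
  limiting mass. Only points of \<open>{-1..1}\<close> enter, so log-concavity is assumed
  there.\<close>

lemma local_limit_of_log_concave:
  fixes g :: "nat \<Rightarrow> real \<Rightarrow> real"
  assumes g[measurable]: "\<And>n. g n \<in> borel_measurable borel" and nn: "\<And>n x. 0 \<le> g n x"
    and ps: "\<And>n. prob_space (density lborel (\<lambda>x. ennreal (g n x)))" and \<sigma>: "0 < \<sigma>"
    and wc: "weak_conv_m (\<lambda>n. density lborel (\<lambda>x. ennreal (g n x))) (density lborel (\<lambda>x. ennreal (normal_density 0 \<sigma> x)))"
    and lc: "eventually (\<lambda>n. \<forall>x\<in>{-1..1}. \<forall>y\<in>{-1..1}. \<forall>t\<in>{0<..<1}.
        g n x powr (1 - t) * g n y powr t \<le> g n ((1 - t) * x + t * y)) sequentially"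
  shows "(\<lambda>n. g n 0) \<longlonglongrightarrow> normal_density 0 \<sigma> 0"
proof -
  let ?N = "density lborel (\<lambda>x. ennreal (normal_density 0 \<sigma> x))"
  let ?M = "\<lambda>n. density lborel (\<lambda>x. ennreal (g n x))"
  let ?\<gamma> = "normal_density 0 \<sigma>"
  have rM: "real_distribution (?M n)" for n
    using ps by (simp add: real_distribution_def real_distribution_axioms_def)
  have rN: "real_distribution ?N"
    using prob_space_normal_density[OF \<sigma>] by (simp add: real_distribution_def real_distribution_axioms_def)
  have fN: "finite_measure ?N" and fM: "\<And>n. finite_measure (?M n)"
    using prob_space_normal_density[OF \<sigma>] ps by (auto simp: prob_space_def)
  have na: "measure ?N {x} = 0" for x
  proof -
    have "AE y in lborel. y \<in> {x} \<longrightarrow> ennreal (normal_density 0 \<sigma> y) = 0"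
      using AE_lborel_singleton[of x] by eventually_elim auto
    then have "{x} \<in> null_sets ?N" by (subst null_sets_density_iff) auto
    then show ?thesis by (rule measure_eq_0_null_sets)
  qed
  have conv: "(\<lambda>n. measure (?M n) {a<..b}) \<longlonglongrightarrow> measure ?N {a<..b}" if "a < b" for a b
    by (rule weak_conv_m_Ioc[OF rM rN wc na that])
  \<comment> \<open>For \<open>0 \<le> p\<close> the minimum of the normal density over
    \<open>{p - r..p + r}\<close> is its value at \<open>p + r\<close>. The general \<open>p\<close>
    is needed twice, at 0 and at \<open>1/2\<close>.\<close>
  have lower0: "eventually (\<lambda>n. c < g n p) sequentially"
    if p: "0 \<le> p" and r: "0 < r" "p + r \<le> 1" and c: "0 < c" "c < ?\<gamma> (p + r)" for p r c
  proof -
    have 1: "c * r < measure ?N {p - r<..p}" "c * r < measure ?N {p<..p + r}"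
    proof -
      have "c * r < ?\<gamma> (p + r) * r" using c r by simp
      moreover have "?\<gamma> (p + r) * (p - (p - r)) \<le> measure ?N {p - r<..p}"
        using r p by (intro measure_density_ge fN normal_density_antimono_abs \<sigma>) auto
      moreover have "?\<gamma> (p + r) * (p + r - p) \<le> measure ?N {p<..p + r}"
        using r p by (intro measure_density_ge fN normal_density_antimono_abs \<sigma>) auto
      ultimately show "c * r < measure ?N {p - r<..p}" "c * r < measure ?N {p<..p + r}" by auto
    qed
    have "eventually (\<lambda>n. c * r < measure (?M n) {p - r<..p}) sequentially"
      using r by (intro order_tendstoD[OF conv] 1) auto
    moreover have "eventually (\<lambda>n. c * r < measure (?M n) {p<..p + r}) sequentially"
      using r by (intro order_tendstoD[OF conv] 1) auto
    ultimately show ?thesis using lc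
    proof eventually_elim
      case (elim n)
      have "\<exists>u. p - r < u \<and> u \<le> p \<and> c < g n u"
      proof (rule ccontr)
        assume "\<not> ?thesis"
        then have "measure (?M n) {p - r<..p} \<le> c * (p - (p - r))"
          using r c by (intro measure_density_le) (auto simp: not_less)
        then show False using elim(1) by simp
      qed
      then obtain u where u: "p - r < u" "u \<le> p" "c < g n u" by blast
      have "\<exists>v. p < v \<and> v \<le> p + r \<and> c < g n v"
      proof (rule ccontr)
        assume "\<not> ?thesis"
        then have "measure (?M n) {p<..p + r} \<le> c * (p + r - p)"
          using r c by (intro measure_density_le) (auto simp: not_less)
        then show False using elim(2) by simp
      qed
      then obtain v where v: "p < v" "v \<le> p + r" "c < g n v" by blast
      show "c < g n p"
      proof (cases "u = p")
        case False
        define t where "t = (p - u) / (v - u)"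
        have uv: "u < p" "u < v" using False u v by auto
        have t: "0 < t" "t < 1" using uv v by (auto simp: t_def)
        have "(1 - t) * u + t * v = u + t * (v - u)" by (simp add: algebra_simps)
        also have "\<dots> = p" using uv by (simp add: t_def)
        finally have "(1 - t) * u + t * v = p" .
        moreover have "g n u powr (1 - t) * g n v powr t \<le> g n ((1 - t) * u + t * v)"
          using elim(3) t u v r p by auto
        moreover have "c powr (1 - t) * c powr t < g n u powr (1 - t) * g n v powr t"
          using u v t c by (intro mult_strict_mono powr_less_mono2) auto
        moreover have "c powr (1 - t) * c powr t = c" using c by (simp flip: powr_add)
        ultimately show ?thesis by simp
      qed (use u in simp)
    qed
  qed
  have cont: "isCont ?\<gamma> x" for x unfolding normal_density_def using \<sigma> by (intro continuous_intros) auto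
  have lower: "eventually (\<lambda>n. c < g n 0) sequentially" if c: "0 < c" "c < ?\<gamma> 0" for c
  proof -
    have "((\<lambda>r. ?\<gamma> (0 + r)) \<longlongrightarrow> ?\<gamma> (0 + 0)) (at_right 0)"
      by (rule isCont_tendsto_compose[OF cont]) (auto intro!: tendsto_eq_intros)
    then have "eventually (\<lambda>r. c < ?\<gamma> r) (at_right 0)"
      using c by (intro order_tendstoD) auto
    moreover have "eventually (\<lambda>r::real. r \<in> {0<..<1}) (at_right 0)"
      by (rule eventually_at_right_real) simp
    ultimately have "eventually (\<lambda>r. c < ?\<gamma> r \<and> r \<in> {0<..<1}) (at_right 0)" by eventually_elim auto
    then obtain r where "c < ?\<gamma> r" "0 < r" "r < 1"
      using eventually_happens'[of "at_right (0::real)"] by auto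
    then show ?thesis using lower0[of 0 r c] c by auto
  qed
  have upper: "eventually (\<lambda>n. g n 0 < d) sequentially" if d: "?\<gamma> 0 < d" for d
  proof -
    \<comment> \<open>A crude eventual lower bound for \<open>g n (1/2)\<close>. Since
      \<open>d powr (1 - \<eta>) * c powr \<eta>\<close> tends to \<open>d\<close> as
      \<open>\<eta>\<close> decreases to 0, some \<open>\<eta>\<close> keeps it above the density at
      0; \<open>b = \<eta> / 2\<close> because \<open>y\<close> is the combination of 0 and
      \<open>1/2\<close> with parameter \<open>t = 2 * y\<close>.\<close>
    define c where "c = ?\<gamma> (1/2 + 1/4) / 2"
    have "0 < ?\<gamma> (1/2 + 1/4)" by (rule normal_density_pos[OF \<sigma>])
    moreover have "?\<gamma> (1/2 + 1/4) \<le> ?\<gamma> 0" by (rule normal_density_antimono_abs[OF \<sigma>]) simp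
    ultimately have c: "0 < c" "c < ?\<gamma> (1/2 + 1/4)" "c < d" using d by (auto simp: c_def)
    have d0: "0 < d" using c by simp
    have "((\<lambda>\<eta>. d powr (1 - \<eta>) * c powr \<eta>) \<longlongrightarrow> d powr (1 - 0) * c powr 0) (at_right 0)"
      using c d0 by (intro tendsto_intros) auto
    then have "eventually (\<lambda>\<eta>. ?\<gamma> 0 < d powr (1 - \<eta>) * c powr \<eta>) (at_right 0)"
      using d d0 c by (intro order_tendstoD) auto
    moreover have "eventually (\<lambda>r::real. r \<in> {0<..<1}) (at_right 0)"
      by (rule eventually_at_right_real) simp
    ultimately have "eventually (\<lambda>r. ?\<gamma> 0 < d powr (1 - r) * c powr r \<and> r \<in> {0<..<1}) (at_right 0)" by eventually_elim auto
    then obtain \<eta> where \<eta>: "?\<gamma> 0 < d powr (1 - \<eta>) * c powr \<eta>" "0 < \<eta>" "\<eta> < 1"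
      using eventually_happens'[of "at_right (0::real)"] by auto
    define e where "e = d powr (1 - \<eta>) * c powr \<eta>"
    define b where "b = \<eta> / 2"
    have b: "0 < b" "b < 1/2" using \<eta> by (auto simp: b_def)
    have e0: "0 < e" using c d0 by (simp add: e_def)
    have "measure ?N {0<..b} \<le> ?\<gamma> 0 * (b - 0)"
      using b by (intro measure_density_le normal_density_antimono_abs \<sigma>) auto
    also have "\<dots> < e * b" using \<eta> b by (simp add: e_def)
    finally have "eventually (\<lambda>n. measure (?M n) {0<..b} < e * b) sequentially"
      using b by (intro order_tendstoD[OF conv]) auto
    moreover have "eventually (\<lambda>n. c < g n (1/2)) sequentially"
      by (rule lower0[of "1/2" "1/4"]) (use c in auto)
    ultimately show ?thesis using lc
    proof eventually_elim
      case (elim n)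
      show "g n 0 < d"
      proof (rule ccontr)
        assume "\<not> g n 0 < d"
        then have gd: "d \<le> g n 0" by simp
        have "e \<le> g n y" if y: "0 < y" "y \<le> b" for y
        proof -
          define t where "t = 2 * y"
          have t: "0 < t" "t \<le> \<eta>" "t < 1" using y b \<eta> by (auto simp: t_def b_def)
          have "e = d * (c / d) powr \<eta>" using c d0 by (simp add: e_def powr_divide powr_diff)
          also have "\<dots> \<le> d * (c / d) powr t"
            using c d0 t by (intro mult_left_mono powr_mono') auto
          also have "\<dots> = d powr (1 - t) * c powr t" using c d0 by (simp add: powr_divide powr_diff)
          also have "\<dots> \<le> g n 0 powr (1 - t) * g n (1/2) powr t"
            using gd elim(2) c d0 t by (intro mult_mono powr_mono2) auto
          also have "\<dots> \<le> g n ((1 - t) * 0 + t * (1/2))"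
            by (rule elim(3)[rule_format]) (use t in auto)
          also have "(1 - t) * 0 + t * (1/2) = y" by (simp add: t_def)
          finally show ?thesis .
        qed
        then have "e * (b - 0) \<le> measure (?M n) {0<..b}"
          using b e0 by (intro measure_density_ge fM) auto
        then show False using elim(1) by simp
      qed
    qed
  qed
  show ?thesis
  proof (rule order_tendstoI)
    fix c assume c: "c < ?\<gamma> 0"
    \<comment> \<open>The maximum supplies the positive constant that \<open>lower\<close> asks
      for.\<close>
    have "eventually (\<lambda>n. max c (?\<gamma> 0 / 2) < g n 0) sequentially"
      using c normal_density_pos[OF \<sigma>, of 0 0] by (intro lower) (auto simp: max_def)
    then show "eventually (\<lambda>n. c < g n 0) sequentially" by eventually_elim auto
  qed (rule upper)
qed

lemma normal_mgf:
  assumes \<sigma>: "0 < \<sigma>"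
  shows "integrable lborel (\<lambda>y. normal_density 0 \<sigma> y * exp (x * y))"
    and "(\<integral>y. normal_density 0 \<sigma> y * exp (x * y) \<partial>lborel) = exp (\<sigma>\<^sup>2 * x\<^sup>2 / 2)"
proof -
  have "normal_density 0 \<sigma> y * exp (x * y) = exp (\<sigma>\<^sup>2 * x\<^sup>2 / 2) * normal_density (\<sigma>\<^sup>2 * x) \<sigma> y" for y
  proof -
    have "- (y - 0)\<^sup>2 / (2 * \<sigma>\<^sup>2) + x * y = \<sigma>\<^sup>2 * x\<^sup>2 / 2 + - (y - \<sigma>\<^sup>2 * x)\<^sup>2 / (2 * \<sigma>\<^sup>2)"
      using \<sigma> by (simp add: field_simps power2_eq_square)
    then have "exp (- (y - 0)\<^sup>2 / (2 * \<sigma>\<^sup>2)) * exp (x * y) = exp (\<sigma>\<^sup>2 * x\<^sup>2 / 2) * exp (- (y - \<sigma>\<^sup>2 * x)\<^sup>2 / (2 * \<sigma>\<^sup>2))"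
      by (simp only: flip: exp_add)
    then show ?thesis by (simp add: normal_density_def)
  qed
  then show "integrable lborel (\<lambda>y. normal_density 0 \<sigma> y * exp (x * y))"
    "(\<integral>y. normal_density 0 \<sigma> y * exp (x * y) \<partial>lborel) = exp (\<sigma>\<^sup>2 * x\<^sup>2 / 2)"
    using \<sigma> by simp_all
qed

text \<open>For the density proportional to \<open>exp (- s * x) * F x\<close>, moment generating
  functions are quotients of values of \<open>H\<close>. Near the saddle point these quotients have
  a Gaussian limit, and the local limit theorem evaluates the density at the centre, that is,
  \<open>F\<close> itself.\<close>

lemma log_concave_tauberian:
  fixes F H :: "real \<Rightarrow> real"
  assumes F[measurable]: "F \<in> borel_measurable borel" and nn: "\<And>x. 0 \<le> F x"
    and lc: "\<And>x y t. 0 < x \<Longrightarrow> 0 < y \<Longrightarrow> 0 < t \<Longrightarrow> t < 1 \<Longrightarrow> F x powr (1 - t) * F y powr t \<le> F ((1 - t) * x + t * y)"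
    and H: "\<And>s. 0 < s \<Longrightarrow> has_bochner_integral lborel (\<lambda>x. exp (- s * x) * F x) (H s)"
    and Hpos: "\<And>s. 0 < s \<Longrightarrow> 0 < H s"
    and a: "0 < a" and C: "0 < C"
    and lim: "((\<lambda>s. H s * s powr (5 / 4) * exp (a * sqrt s)) \<longlongrightarrow> C) at_top"
  shows "((\<lambda>x. F x / x * exp (a\<^sup>2 / (4 * x))) \<longlongrightarrow> C * (2 / a) powr (3 / 2) / sqrt pi) (at_right 0)"
proof (rule tendsto_at_right_sequentially[where b = 1])
  fix X :: "nat \<Rightarrow> real" assume X: "\<And>n. 0 < X n" "\<And>n. X n < 1" "X \<longlonglongrightarrow> 0"
  \<comment> \<open>\<open>s n\<close> is the saddle point for the level \<open>X n\<close>, so the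
    tilted law is centred near \<open>X n\<close>. The second derivative of
    \<open>- a * sqrt s\<close> there is \<open>2 * X n ^ 3 / a^2\<close>; hence the scale
    \<open>\<delta> n = X n powr (3/2)\<close> and, below,
    \<open>\<sigma> = sqrt 2 / a\<close>.\<close>
  define r where "r n = sqrt (X n)" for n
  define s where "s n = a\<^sup>2 / (4 * (X n)\<^sup>2)" for n
  define \<delta> where "\<delta> n = X n * r n" for n
  have r: "0 < r n" "r n < 1" "(r n)\<^sup>2 = X n" for n using X(1,2)[of n] by (auto simp: r_def)
  have r0: "r \<longlonglongrightarrow> 0" using tendsto_real_sqrt[OF X(3)] by (simp add: r_def[abs_def])
  have s: "0 < s n" for n using X(1)[of n] a by (simp add: s_def)
  have \<delta>: "0 < \<delta> n" for n using X(1)[of n] r(1)[of n] by (simp add: \<delta>_def)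
  have sqs: "a * sqrt (s n) = a\<^sup>2 / (2 * X n)" for n
    using X(1)[of n] a by (simp add: s_def real_sqrt_divide real_sqrt_mult power2_eq_square)
  have sx: "s n * X n = a\<^sup>2 / (4 * X n)" for n using X(1)[of n] by (simp add: s_def power2_eq_square)
  have sinf: "filterlim s at_top sequentially"
  proof -
    have "filterlim (\<lambda>n. (X n)\<^sup>2) (at_right 0) sequentially"
      unfolding filterlim_at using X tendsto_power[OF X(3), of 2] by (auto intro!: always_eventually simp: less_imp_neq[symmetric])
    then have "filterlim (\<lambda>n. inverse ((X n)\<^sup>2)) at_top sequentially"
      by (rule filterlim_compose[OF filterlim_inverse_at_top_right])
    then have "filterlim (\<lambda>n. a\<^sup>2 / 4 * inverse ((X n)\<^sup>2)) at_top sequentially"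
      by (rule filterlim_tendsto_pos_mult_at_top[OF tendsto_const, rotated]) (use a in simp)
    also have "(\<lambda>n. a\<^sup>2 / 4 * inverse ((X n)\<^sup>2)) = s" by (auto simp: s_def fun_eq_iff inverse_eq_divide)
    finally show ?thesis .
  qed
  define h where "h s = H s * s powr (5 / 4) * exp (a * sqrt s)" for s
  have hpos: "0 < h s" if "0 < s" for s using Hpos[OF that] that by (simp add: h_def)
  have Hh: "H s = h s * s powr (- (5 / 4)) * exp (- (a * sqrt s))" if "0 < s" for s
    using that by (simp add: h_def powr_minus exp_minus field_simps)
  have hlim: "(h \<longlongrightarrow> C) at_top" using lim by (simp add: h_def[abs_def])
  \<comment> \<open>The tilted density, normalised by \<open>H (s n)\<close>, recentred at
    \<open>X n\<close> and rescaled by \<open>\<delta> n\<close>; at \<open>y = 0\<close> it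
    contains the value \<open>F (X n)\<close>.\<close>
  define g where "g n y = \<delta> n / H (s n) * (exp (- s n * (X n + \<delta> n * y)) * F (X n + \<delta> n * y))" for n y
  have gm[measurable]: "g n \<in> borel_measurable borel" for n unfolding g_def by measurable
  have gnn: "0 \<le> g n y" for n y using \<delta>[of n] Hpos[OF s[of n]] nn by (simp add: g_def)
  \<comment> \<open>The factor \<open>exp (l * y)\<close> merely changes the tilt from
    \<open>s n\<close> to \<open>s n - l / \<delta> n\<close>.\<close>
  have mgf: "has_bochner_integral lborel (\<lambda>y. g n y * exp (l * y)) (exp (- l * X n / \<delta> n) * H (s n - l / \<delta> n) / H (s n))"
    if "0 < s n - l / \<delta> n" for n l
  proof -
    let ?q = "\<lambda>u. exp (- (s n - l / \<delta> n) * u) * F u"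
    note 1 = H[OF that]
    have "has_bochner_integral lborel (\<lambda>y. ?q (X n + \<delta> n * y)) (H (s n - l / \<delta> n) /\<^sub>R \<bar>\<delta> n\<bar>)"
      by (rule lborel_has_bochner_integral_real_affine_iff[where c="\<delta> n" and t="X n", THEN iffD1, OF _ 1]) (use \<delta>[of n] in simp)
    then have "has_bochner_integral lborel (\<lambda>y. (\<delta> n / H (s n) * exp (- l * X n / \<delta> n)) * ?q (X n + \<delta> n * y))
       ((\<delta> n / H (s n) * exp (- l * X n / \<delta> n)) * (H (s n - l / \<delta> n) /\<^sub>R \<bar>\<delta> n\<bar>))"
      by (rule has_bochner_integral_mult_right)
    also have "(\<delta> n / H (s n) * exp (- l * X n / \<delta> n)) * (H (s n - l / \<delta> n) /\<^sub>R \<bar>\<delta> n\<bar>) = exp (- l * X n / \<delta> n) * H (s n - l / \<delta> n) / H (s n)"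
      using \<delta>[of n] by (simp add: divide_inverse)
    also have "(\<lambda>y. (\<delta> n / H (s n) * exp (- l * X n / \<delta> n)) * ?q (X n + \<delta> n * y)) = (\<lambda>y. g n y * exp (l * y))"
    proof
      fix y
      have "- l * X n / \<delta> n + - (s n - l / \<delta> n) * (X n + \<delta> n * y) = - s n * (X n + \<delta> n * y) + l * y"
        using \<delta>[of n] by (simp add: field_simps)
      then have e: "exp (- l * X n / \<delta> n) * exp (- (s n - l / \<delta> n) * (X n + \<delta> n * y)) = exp (- s n * (X n + \<delta> n * y)) * exp (l * y)"
        by (simp only: flip: exp_add)
      have "(\<delta> n / H (s n) * exp (- l * X n / \<delta> n)) * ?q (X n + \<delta> n * y)
        = \<delta> n / H (s n) * ((exp (- l * X n / \<delta> n) * exp (- (s n - l / \<delta> n) * (X n + \<delta> n * y))) * F (X n + \<delta> n * y))"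
        by (simp only: mult.assoc)
      also have "\<dots> = g n y * exp (l * y)"
        unfolding e g_def by (simp only: mult_ac)
      finally show "(\<delta> n / H (s n) * exp (- l * X n / \<delta> n)) * ?q (X n + \<delta> n * y) = g n y * exp (l * y)" .
    qed
    finally show ?thesis .
  qed
  have ps: "prob_space (density lborel (\<lambda>y. ennreal (g n y)))" for n
  proof
    have "has_bochner_integral lborel (g n) 1"
      using mgf[of n 0] s[of n] Hpos[OF s[of n]] by simp
    then have "(\<integral>\<^sup>+y. ennreal (g n y) \<partial>lborel) = ennreal 1"
      by (subst nn_integral_eq_integral) (auto simp: gnn has_bochner_integral_iff)
    then show "emeasure (density lborel (\<lambda>y. ennreal (g n y))) (space (density lborel (\<lambda>y. ennreal (g n y)))) = 1"
      by (simp add: emeasure_density)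
  qed
  define \<sigma> where "\<sigma> = sqrt 2 / a"
  have \<sigma>: "0 < \<sigma>" using a by (simp add: \<sigma>_def)
  \<comment> \<open>The relative change of the tilt is of order \<open>r n\<close>, so the shifted
    tilt is eventually positive and also tends to infinity.\<close>
  have sl: "s n - l / \<delta> n = s n * (1 - 4 * l * r n / a\<^sup>2)" for n l
  proof -
    have "l / \<delta> n = a\<^sup>2 / (4 * (X n)\<^sup>2) * (4 * l * r n / a\<^sup>2)"
      using a r[of n] by (simp add: \<delta>_def r(3)[symmetric] power2_eq_square field_simps)
    then show ?thesis by (simp only: s_def right_diff_distrib mult_1_right)
  qed
  have u1: "(\<lambda>n. 1 - 4 * l * r n / a\<^sup>2) \<longlonglongrightarrow> 1 - 4 * l * 0 / a\<^sup>2" for l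
    by (intro tendsto_intros r0) (use a in simp)
  have upos: "eventually (\<lambda>n. 1/2 < 1 - 4 * l * r n / a\<^sup>2) sequentially" for l
    by (rule order_tendstoD(1)[OF u1]) simp
  have slpos: "eventually (\<lambda>n. 0 < s n - l / \<delta> n) sequentially" for l
    using upos[of l] by eventually_elim (use s in \<open>simp add: sl zero_less_mult_iff\<close>)
  have mgf_lim: "(\<lambda>n. exp (- l * X n / \<delta> n) * H (s n - l / \<delta> n) / H (s n)) \<longlonglongrightarrow> exp (\<sigma>\<^sup>2 * l\<^sup>2 / 2)" for l
  proof -
    define u where "u n = 1 - 4 * l * r n / a\<^sup>2" for n
    have u1': "u \<longlonglongrightarrow> 1" using u1[of l] by (simp add: u_def[abs_def])
    have "eventually (\<lambda>n. 1/2 * s n \<le> s n - l / \<delta> n) sequentially"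
      using upos[of l] by eventually_elim (use s in \<open>simp add: sl less_imp_le\<close>)
    moreover have "filterlim (\<lambda>n. 1/2 * s n) at_top sequentially"
      by (rule filterlim_tendsto_pos_mult_at_top[OF tendsto_const _ sinf]) simp
    ultimately have "filterlim (\<lambda>n. s n - l / \<delta> n) at_top sequentially"
      by (rule filterlim_at_top_mono[rotated])
    then have h1: "(\<lambda>n. h (s n - l / \<delta> n)) \<longlonglongrightarrow> C" by (rule filterlim_compose[OF hlim])
    have h2: "(\<lambda>n. h (s n)) \<longlonglongrightarrow> C" by (rule filterlim_compose[OF hlim sinf])
    \<comment> \<open>For nonzero \<open>l\<close> the exponent
      \<open>a * sqrt (s n) * (1 - sqrt (u n)) - l * X n / \<delta> n\<close> is a difference of
      diverging terms. Rationalising it gives exactly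
      \<open>4 * l^2 / (a^2 * (1 + sqrt (u n))^2)\<close>, whose limit is visible.\<close>
    have "(\<lambda>n. h (s n - l / \<delta> n) / h (s n) * u n powr (- (5 / 4)) * exp (4 * l\<^sup>2 / (a\<^sup>2 * (1 + sqrt (u n))\<^sup>2)))
      \<longlonglongrightarrow> C / C * 1 powr (- (5 / 4)) * exp (4 * l\<^sup>2 / (a\<^sup>2 * (1 + sqrt 1)\<^sup>2))"
      by (intro tendsto_intros h1 h2 u1') (use a C in auto)
    also have "C / C * 1 powr (- (5 / 4)) * exp (4 * l\<^sup>2 / (a\<^sup>2 * (1 + sqrt 1)\<^sup>2)) = exp (\<sigma>\<^sup>2 * l\<^sup>2 / 2)"
      using C by (simp add: \<sigma>_def power_divide)
    finally have L: "(\<lambda>n. h (s n - l / \<delta> n) / h (s n) * u n powr (- (5 / 4)) * exp (4 * l\<^sup>2 / (a\<^sup>2 * (1 + sqrt (u n))\<^sup>2)))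
      \<longlonglongrightarrow> exp (\<sigma>\<^sup>2 * l\<^sup>2 / 2)" .
    have "eventually (\<lambda>n. h (s n - l / \<delta> n) / h (s n) * u n powr (- (5 / 4)) * exp (4 * l\<^sup>2 / (a\<^sup>2 * (1 + sqrt (u n))\<^sup>2))
      = exp (- l * X n / \<delta> n) * H (s n - l / \<delta> n) / H (s n)) sequentially"
      using upos[of l]
    proof eventually_elim
      case (elim n)
      then have u: "0 < u n" by (simp add: u_def)
      have sp: "0 < s n" and s'p: "0 < s n - l / \<delta> n" using s[of n] u by (auto simp: sl u_def[symmetric])
      have s'u: "s n - l / \<delta> n = s n * u n" by (simp add: sl u_def)
      define w where "w = sqrt (u n)"
      have w: "0 < w" "w\<^sup>2 = u n" using u by (auto simp: w_def)
      have "4 * l\<^sup>2 / (a\<^sup>2 * (1 + w)\<^sup>2) = a\<^sup>2 / (2 * X n) * (1 - w) - l / r n"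
      proof -
        have l: "l = (1 - w\<^sup>2) * a\<^sup>2 / (4 * r n)" using r(1)[of n] a unfolding w(2) u_def by simp
        have "a\<^sup>2 / (2 * X n) * (1 - w) - l / r n = a\<^sup>2 / (4 * (r n)\<^sup>2) * (1 - w)\<^sup>2"
          unfolding l r(3)[symmetric] using r(1)[of n] by (simp add: field_simps power2_eq_square)
        also have "\<dots> = 4 * l\<^sup>2 / (a\<^sup>2 * (1 + w)\<^sup>2)"
        proof -
          have "l = (1 - w) * (1 + w) * a\<^sup>2 / (4 * r n)" unfolding l by (simp add: power2_eq_square algebra_simps)
          then have l2: "l\<^sup>2 = (1 - w)\<^sup>2 * (1 + w)\<^sup>2 * a\<^sup>2 * a\<^sup>2 / (16 * (r n)\<^sup>2)" by (simp add: power_divide power_mult_distrib power2_eq_square)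
          have gen: "A / (4 * R) * P = 4 * (P * Q * A * A / (16 * R)) / (A * Q)" if "A \<noteq> 0" "Q \<noteq> 0" for A P Q R :: real
            using that by (simp add: field_simps)
          show ?thesis unfolding l2 by (rule gen) (use w a in auto)
        qed
        finally show ?thesis by simp
      qed
      also have "l / r n = l * X n / \<delta> n" using X(1)[of n] r(1)[of n] by (simp add: \<delta>_def)
      also have "a\<^sup>2 / (2 * X n) * (1 - w) = a * sqrt (s n) - a * sqrt (s n * u n)"
      proof -
        have "a * sqrt (s n * u n) = a * sqrt (s n) * w" by (simp add: real_sqrt_mult w_def)
        then show ?thesis by (simp only: sqs right_diff_distrib mult_1_right)
      qed
      finally have e: "exp (4 * l\<^sup>2 / (a\<^sup>2 * (1 + w)\<^sup>2)) = exp (a * sqrt (s n)) * exp (- (a * sqrt (s n * u n))) * exp (- l * X n / \<delta> n)"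
        by (simp flip: exp_add)
      show ?case
        unfolding w_def[symmetric] e Hh[OF sp] Hh[OF s'p] unfolding s'u
        using sp u hpos[OF sp] by (simp add: powr_mult exp_minus field_simps)
    qed
    with L show ?thesis by (rule Lim_transform_eventually)
  qed
  have wc: "weak_conv_m (\<lambda>n. density lborel (\<lambda>y. ennreal (g n y))) (density lborel (\<lambda>y. ennreal (normal_density 0 \<sigma> y)))"
  proof (rule weak_conv_of_mgf)
    show "real_distribution (density lborel (\<lambda>y. ennreal (g n y)))" for n
      using ps by (simp add: real_distribution_def real_distribution_axioms_def)
    show "real_distribution (density lborel (\<lambda>y. ennreal (normal_density 0 \<sigma> y)))"
      using prob_space_normal_density[OF \<sigma>] by (simp add: real_distribution_def real_distribution_axioms_def)
    fix l
    show "eventually (\<lambda>n. integrable (density lborel (\<lambda>y. ennreal (g n y))) (\<lambda>y. exp (l * y))) sequentially"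
      using slpos[of l]
    proof eventually_elim
      case (elim n)
      from mgf[OF this] show ?case by (subst integrable_density) (auto simp: gnn has_bochner_integral_iff)
    qed
    show "integrable (density lborel (\<lambda>y. ennreal (normal_density 0 \<sigma> y))) (\<lambda>y. exp (l * y))"
      using normal_mgf(1)[OF \<sigma>] by (subst integrable_density) auto
    have "eventually (\<lambda>n. exp (- l * X n / \<delta> n) * H (s n - l / \<delta> n) / H (s n) = (\<integral>y. exp (l * y) \<partial>density lborel (\<lambda>y. ennreal (g n y)))) sequentially"
      using slpos[of l]
    proof eventually_elim
      case (elim n)
      from mgf[OF this] show ?case by (subst integral_density) (auto simp: gnn has_bochner_integral_iff)
    qed
    moreover have "(\<integral>y. exp (l * y) \<partial>density lborel (\<lambda>y. ennreal (normal_density 0 \<sigma> y))) = exp (\<sigma>\<^sup>2 * l\<^sup>2 / 2)"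
      using normal_mgf(2)[OF \<sigma>] by (subst integral_density) auto
    ultimately show "(\<lambda>n. \<integral>y. exp (l * y) \<partial>density lborel (\<lambda>y. ennreal (g n y)))
       \<longlonglongrightarrow> (\<integral>y. exp (l * y) \<partial>density lborel (\<lambda>y. ennreal (normal_density 0 \<sigma> y)))"
      using Lim_transform_eventually[OF mgf_lim[of l]] by simp
  qed
  have "(\<lambda>n. g n 0) \<longlonglongrightarrow> normal_density 0 \<sigma> 0"
  proof (rule local_limit_of_log_concave[OF gm gnn ps \<sigma> wc], rule always_eventually, intro allI ballI)
    fix n x y t assume xy: "x \<in> {-1..1::real}" "y \<in> {-1..1::real}" and t: "t \<in> {0<..<1::real}"
    \<comment> \<open>\<open>F\<close> is log-concave only along positive arguments;
      \<open>\<delta> n < X n\<close> keeps the rescaled window inside them. The exponential tilt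
      contributes an equality.\<close>
    have pos: "0 < X n + \<delta> n * z" if "z \<in> {-1..1}" for z
    proof -
      have "\<delta> n < X n" using X(1)[of n] r[of n] by (simp add: \<delta>_def)
      moreover have "\<delta> n * (-1) \<le> \<delta> n * z" using \<delta>[of n] that by (intro mult_left_mono) auto
      ultimately show ?thesis by simp
    qed
    define A where "A = \<delta> n / H (s n)"
    have A: "0 < A" using \<delta>[of n] Hpos[OF s[of n]] by (simp add: A_def)
    define p where "p = X n + \<delta> n * x"
    define q where "q = X n + \<delta> n * y"
    have pq: "X n + \<delta> n * ((1 - t) * x + t * y) = (1 - t) * p + t * q" by (simp add: p_def q_def algebra_simps)
    have "g n x powr (1 - t) * g n y powr t = (A powr (1 - t) * A powr t) * (exp (- s n * p) powr (1 - t) * exp (- s n * q) powr t) * (F p powr (1 - t) * F q powr t)"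
    proof -
      have "g n x = A * (exp (- s n * p) * F p)" "g n y = A * (exp (- s n * q) * F q)"
        by (simp_all only: g_def A_def p_def q_def)
      then show ?thesis using A nn[of p] nn[of q] by (simp add: powr_mult mult_ac)
    qed
    also have "A powr (1 - t) * A powr t = A" using A by (simp flip: powr_add)
    also have "exp (- s n * p) powr (1 - t) * exp (- s n * q) powr t = exp (- s n * ((1 - t) * p + t * q))"
      by (simp add: exp_powr_real algebra_simps flip: exp_add)
    also have "A * exp (- s n * ((1 - t) * p + t * q)) * (F p powr (1 - t) * F q powr t) \<le> A * exp (- s n * ((1 - t) * p + t * q)) * F ((1 - t) * p + t * q)"
      using A t pos xy by (intro mult_left_mono lc) (auto simp: p_def q_def)
    also have "\<dots> = g n ((1 - t) * x + t * y)"
      unfolding g_def pq A_def by (simp only: mult.assoc)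
    finally show "g n x powr (1 - t) * g n y powr t \<le> g n ((1 - t) * x + t * y)" .
  qed
  \<comment> \<open>The normalisation is undone here: \<open>s n powr (- 5/4)\<close> equals
    \<open>(2 / a) powr (5/2) * X n * \<delta> n\<close>.\<close>
  then have "(\<lambda>n. g n 0 * h (s n) * (2 / a) powr (5 / 2)) \<longlonglongrightarrow> normal_density 0 \<sigma> 0 * C * (2 / a) powr (5 / 2)"
    by (intro tendsto_mult filterlim_compose[OF hlim sinf] tendsto_const)
  also have "(\<lambda>n. g n 0 * h (s n) * (2 / a) powr (5 / 2)) = (\<lambda>n. F (X n) / X n * exp (a\<^sup>2 / (4 * X n)))"
  proof
    fix n
    have x: "0 < X n" by (rule X)
    have p: "s n powr (- (5 / 4)) = (2 / a) powr (5 / 2) * (X n * \<delta> n)"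
    proof -
      have "s n = (a / 2 * inverse (X n)) powr 2"
        using x a by (simp add: s_def powr_numeral power_divide field_simps)
      then have "s n powr (- (5 / 4)) = (a / 2 * inverse (X n)) powr (- (5 / 2))"
        by (simp add: powr_powr)
      also have "\<dots> = (2 / a) powr (5 / 2) * X n powr (5 / 2)"
        using x a by (simp add: powr_mult powr_minus powr_divide inverse_eq_divide)
      also have "X n powr (5 / 2) = X n powr (1 + 1 + 1/2)" by simp
      also have "\<dots> = X n * \<delta> n" unfolding powr_add using x by (simp add: \<delta>_def r_def powr_half_sqrt)
      finally show ?thesis .
    qed
    have e: "exp (- s n * X n) = exp (- (a\<^sup>2 / (4 * X n)))" using sx[of n] by simp
    have "2 * (a\<^sup>2 / (4 * X n)) = a\<^sup>2 / (2 * X n)" by simp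
    then have e2: "exp (- (a * sqrt (s n))) = exp (- (a\<^sup>2 / (4 * X n))) * exp (- (a\<^sup>2 / (4 * X n)))"
      by (simp add: sqs flip: exp_add)
    have "g n 0 * h (s n) * (2 / a) powr (5 / 2) = \<delta> n * h (s n) * (2 / a) powr (5 / 2) / H (s n) * exp (- s n * X n) * F (X n)"
      by (simp add: g_def)
    also have "\<dots> = F (X n) / X n * exp (a\<^sup>2 / (4 * X n))"
      unfolding Hh[OF s] p e e2 using hpos[OF s[of n]] x \<delta>[of n] a
      by (simp add: exp_minus field_simps)
    finally show "g n 0 * h (s n) * (2 / a) powr (5 / 2) = F (X n) / X n * exp (a\<^sup>2 / (4 * X n))" .
  qed
  also have "normal_density 0 \<sigma> 0 * C * (2 / a) powr (5 / 2) = C * (2 / a) powr (3 / 2) / sqrt pi"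
  proof -
    have "(2 / a) powr (5 / 2) = (2 / a) powr (3 / 2 + 1)" by simp
    also have "\<dots> = (2 / a) powr (3 / 2) * (2 / a)" unfolding powr_add using a by simp
    finally have 1: "(2 / a) powr (5 / 2) = (2 / a) powr (3 / 2) * (2 / a)" .
    have "2 * pi * \<sigma>\<^sup>2 = (2 / a)\<^sup>2 * pi" by (simp add: \<sigma>_def power_divide)
    then have "sqrt (2 * pi * \<sigma>\<^sup>2) = sqrt ((2 / a)\<^sup>2 * pi)" by (rule arg_cong)
    also have "\<dots> = 2 / a * sqrt pi" using a by (simp add: real_sqrt_mult)
    finally have "sqrt (2 * pi * \<sigma>\<^sup>2) = 2 / a * sqrt pi" .
    then have "normal_density 0 \<sigma> 0 = 1 / (2 / a * sqrt pi)" by (simp add: normal_density_def)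
    then show ?thesis using 1 a by simp
  qed
  finally show "(\<lambda>n. F (X n) / X n * exp (a\<^sup>2 / (4 * X n))) \<longlonglongrightarrow> C * (2 / a) powr (3 / 2) / sqrt pi" .
qed simp

section \<open>Log-concavity and limits of Laplace transforms\<close>

lemma integrable_exp_mult_bounded:
  fixes f :: "real \<Rightarrow> real"
  assumes [measurable]: "f \<in> borel_measurable borel" and s: "0 < s"
    and "\<And>x. x < 0 \<Longrightarrow> f x = 0" and "\<And>x. \<bar>f x\<bar> \<le> B"
  shows "integrable lborel (\<lambda>x. exp (- s * x) * f x)"
proof (rule Bochner_Integration.integrable_bound)
  have "has_bochner_integral lborel (\<lambda>x. x ^ 0 * exp (- x) * indicator {0..} x) (fact 0 :: real)"
    by (rule has_bochner_integral_I0i_power_exp_m')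
  then have "integrable lborel (\<lambda>x. exp (- x) * indicator {0..} x :: real)" by (auto simp: has_bochner_integral_iff)
  then have "integrable lborel (\<lambda>x. exp (- (0 + s * x)) * indicator {0..} (0 + s * x) :: real)"
    using s by (subst lborel_integrable_real_affine_iff[where c=s and t=0 and f="\<lambda>x. exp (- x) * indicator {0..} x"]) auto
  then show "integrable lborel (\<lambda>x. exp (- (0 + s * x)) * indicator {0..} (0 + s * x) * B)"
    by (rule integrable_mult_left)
  show "AE x in lborel. norm (exp (- s * x) * f x) \<le> norm (exp (- (0 + s * x)) * indicator {0..} (0 + s * x) * B)"
  proof (intro AE_I2)
    fix x
    have "\<bar>f x\<bar> \<le> \<bar>B\<bar>" using assms(4)[of x] by linarith
    then show "norm (exp (- s * x) * f x) \<le> norm (exp (- (0 + s * x)) * indicator {0..} (0 + s * x) * B)"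
      using s assms(3)[of x] by (cases "x < 0") (auto simp: abs_mult zero_le_mult_iff)
  qed
qed simp

text \<open>In the variable \<open>exp (- x)\<close>, the transforms at the integers
  \<open>k + 1\<close> are integrals of the monomials of degree \<open>k\<close> against
  \<open>exp (- x) dx\<close>. Weierstrass approximation on the unit interval passes from
  polynomials to continuous \<open>\<phi>\<close>, with error controlled because
  \<open>exp (- x)\<close> has total mass 1 on the half-line.\<close>

lemma laplace_tendsto_imp_tendsto_integral:
  fixes Fn :: "nat \<Rightarrow> real \<Rightarrow> real" and F \<phi> :: "real \<Rightarrow> real"
  assumes meas[measurable]: "\<And>n. Fn n \<in> borel_measurable borel" "F \<in> borel_measurable borel"
    and Fn: "\<And>n x. 0 \<le> Fn n x" "\<And>n x. Fn n x \<le> 1" "\<And>n x. x < 0 \<Longrightarrow> Fn n x = 0"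
    and F: "\<And>x. 0 \<le> F x" "\<And>x. F x \<le> 1" "\<And>x. x < 0 \<Longrightarrow> F x = 0"
    and lim: "\<And>s. 0 < s \<Longrightarrow> (\<lambda>n. \<integral>x. exp (- s * x) * Fn n x \<partial>lborel) \<longlonglongrightarrow> (\<integral>x. exp (- s * x) * F x \<partial>lborel)"
    and \<phi>: "continuous_on UNIV \<phi>"
  shows "(\<lambda>n. \<integral>x. exp (- x) * (\<phi> (exp (- x)) * Fn n x) \<partial>lborel) \<longlonglongrightarrow> (\<integral>x. exp (- x) * (\<phi> (exp (- x)) * F x) \<partial>lborel)"
proof -
  define I where "I \<psi> f = (\<integral>x. exp (- x) * (\<psi> (exp (- x)) * f x) \<partial>lborel)" for \<psi> f :: "real \<Rightarrow> real"
  define good where "good f \<longleftrightarrow> f \<in> borel_measurable borel \<and> (\<forall>x. 0 \<le> f x \<and> f x \<le> 1) \<and> (\<forall>x<0. f x = 0)" for f :: "real \<Rightarrow> real"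
  have gF: "good F" "\<And>n. good (Fn n)" using meas Fn F by (auto simp: good_def)
  have intI: "integrable lborel (\<lambda>x. exp (- x) * (\<psi> (exp (- x)) * f x))"
    if f: "good f" and \<psi>: "continuous_on UNIV \<psi>" for f \<psi> :: "real \<Rightarrow> real"
  proof -
    have [measurable]: "\<psi> \<in> borel_measurable borel" using \<psi> by (rule borel_measurable_continuous_onI)
    have [measurable]: "f \<in> borel_measurable borel" using f by (simp add: good_def)
    have "compact (\<psi> ` {0..1})" by (intro compact_continuous_image continuous_on_subset[OF \<psi>]) auto
    then have "bounded (\<psi> ` {0..1})" by (rule compact_imp_bounded)
    then obtain B where "\<forall>y\<in>\<psi> ` {0..1}. \<bar>y\<bar> \<le> B" unfolding bounded_real by blast
    then have B: "\<And>u. u \<in> {0..1} \<Longrightarrow> \<bar>\<psi> u\<bar> \<le> B" by blast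
    have "integrable lborel (\<lambda>x. exp (- 1 * x) * (\<psi> (exp (- x)) * f x))"
    proof (rule integrable_exp_mult_bounded[where B = B])
      fix x :: real
      show "\<bar>\<psi> (exp (- x)) * f x\<bar> \<le> B"
      proof (cases "x < 0")
        case True
        then show ?thesis using f B[of 0] by (simp add: good_def)
      next
        case False
        have "\<bar>\<psi> (exp (- x)) * f x\<bar> \<le> B * 1" unfolding abs_mult
          using False f B[of "exp (- x)"] B[of 0] by (intro mult_mono) (auto simp: good_def)
        then show ?thesis by simp
      qed
    qed (use f in \<open>auto simp: good_def\<close>)
    then show ?thesis by simp
  qed
  have e1: "(\<integral>x. exp (- x) * (indicator {0..} x) \<partial>lborel) = (1::real)"
    using has_bochner_integral_I0i_power_exp_m'[of 0] by (simp add: has_bochner_integral_iff)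
  have close: "\<bar>I \<psi> f - I \<psi>' f\<bar> \<le> e"
    if f: "good f" and c: "continuous_on UNIV \<psi>" "continuous_on UNIV \<psi>'"
      and e: "\<And>u. u \<in> {0..1} \<Longrightarrow> \<bar>\<psi> u - \<psi>' u\<bar> \<le> e" for f \<psi> \<psi>' e
  proof -
    have i0: "integrable lborel (\<lambda>x. exp (- x) * (indicator {0..} x)::real)"
      using has_bochner_integral_I0i_power_exp_m'[of 0] by (simp add: has_bochner_integral_iff)
    have "I \<psi> f - I \<psi>' f = (\<integral>x. exp (- x) * (\<psi> (exp (- x)) * f x) - exp (- x) * (\<psi>' (exp (- x)) * f x) \<partial>lborel)"
      unfolding I_def by (intro Bochner_Integration.integral_diff[symmetric] intI f c)
    also have "\<bar>\<dots>\<bar> \<le> (\<integral>x. e * (exp (- x) * indicator {0..} x) \<partial>lborel)"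
      unfolding real_norm_def[symmetric]
    proof (rule Bochner_Integration.integral_norm_bound_integral)
      fix x :: real
      show "norm (exp (- x) * (\<psi> (exp (- x)) * f x) - exp (- x) * (\<psi>' (exp (- x)) * f x)) \<le> e * (exp (- x) * indicator {0..} x)"
      proof (cases "x < 0")
        case True
        then show ?thesis using f by (simp add: good_def)
      next
        case False
        have "exp (- x) * (\<psi> (exp (- x)) * f x) - exp (- x) * (\<psi>' (exp (- x)) * f x) = exp (- x) * ((\<psi> (exp (- x)) - \<psi>' (exp (- x))) * f x)"
          by (simp add: algebra_simps)
        also have "norm \<dots> = exp (- x) * (\<bar>\<psi> (exp (- x)) - \<psi>' (exp (- x))\<bar> * f x)"
          using f by (simp add: abs_mult good_def)
        also have "\<dots> \<le> exp (- x) * (e * 1)"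
          using False f e[of "exp (- x)"] e[of 0] by (intro mult_left_mono mult_mono) (auto simp: good_def)
        finally show ?thesis using False by (simp add: mult.commute)
      qed
    qed (use i0 in \<open>auto intro!: Bochner_Integration.integrable_diff intI f c\<close>)
    also have "\<dots> = e" by (simp add: e1)
    finally show ?thesis .
  qed
  have poly: "(\<lambda>n. I (\<lambda>u. \<Sum>k\<le>N. c k * u ^ k) (Fn n)) \<longlonglongrightarrow> I (\<lambda>u. \<Sum>k\<le>N. c k * u ^ k) F" for N c
  proof -
    have eq: "I (\<lambda>u. \<Sum>k\<le>N. c k * u ^ k) f = (\<Sum>k\<le>N. c k * (\<integral>x. exp (- real (Suc k) * x) * f x \<partial>lborel))" if f: "good f" for f
    proof -
      have "exp (- x) * ((\<Sum>k\<le>N. c k * exp (- x) ^ k) * f x) = (\<Sum>k\<le>N. c k * (exp (- real (Suc k) * x) * f x))" for x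
      proof -
        have "exp (- x) * exp (- x) ^ k = exp (- real (Suc k) * x)" for k
          by (simp add: algebra_simps flip: exp_of_nat_mult exp_add)
        then have "exp (- x) * (c k * exp (- x) ^ k * f x) = c k * (exp (- real (Suc k) * x) * f x)" for k
          by (metis mult.assoc mult.left_commute)
        then show ?thesis by (simp only: sum_distrib_left sum_distrib_right)
      qed
      moreover have "integrable lborel (\<lambda>x. exp (- real (Suc k) * x) * f x)" for k
        by (rule integrable_exp_mult_bounded[where B=1]) (use f in \<open>auto simp: good_def\<close>)
      ultimately show ?thesis
        unfolding I_def by (simp add: Bochner_Integration.integral_sum)
    qed
    show ?thesis unfolding eq[OF gF(1)] eq[OF gF(2)] by (intro tendsto_intros lim) simp
  qed
  have "(\<lambda>n. I \<phi> (Fn n)) \<longlonglongrightarrow> I \<phi> F"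
  proof (rule LIMSEQ_I)
    fix r :: real assume r: "0 < r"
    have "continuous_on {0..1} \<phi>" by (rule continuous_on_subset[OF \<phi>]) simp
    then obtain p where p: "real_polynomial_function p" "\<And>u. u \<in> {0..1} \<Longrightarrow> \<bar>\<phi> u - p u\<bar> < r / 4"
      using Stone_Weierstrass_real_polynomial_function[of "{0..1}" \<phi> "r / 4"] r by auto
    obtain c N where pc: "p = (\<lambda>u. \<Sum>k\<le>N. c k * u ^ k)"
      using real_polynomial_function_imp_sum[OF p(1)] by auto
    have cp: "continuous_on UNIV p" unfolding pc by (intro continuous_intros)
    obtain n0 where n0: "\<And>n. n \<ge> n0 \<Longrightarrow> norm (I p (Fn n) - I p F) < r / 4"
      using LIMSEQ_D[OF poly[of c N], of "r / 4"] r unfolding pc by auto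
    have "norm (I \<phi> (Fn n) - I \<phi> F) < r" if "n \<ge> n0" for n
    proof -
      have "\<bar>I \<phi> (Fn n) - I p (Fn n)\<bar> \<le> r / 4" "\<bar>I \<phi> F - I p F\<bar> \<le> r / 4"
        by (intro close gF \<phi> cp less_imp_le[OF p(2)]; assumption)+
      with n0[OF that] r show ?thesis by (auto simp: abs_if split: if_splits)
    qed
    then show "\<exists>no. \<forall>n\<ge>no. norm (I \<phi> (Fn n) - I \<phi> F) < r" by blast
  qed
  then show ?thesis by (simp add: I_def)
qed

text \<open>Pointwise convergence could fail where \<open>F\<close> jumps, so averages against a
  bump are compared instead. Monotonicity traps an average started at \<open>m\<close> between the
  values at \<open>m\<close> and \<open>m + \<eta>\<close>; the total displacement
  \<open>2 * \<eta>\<close> is removed by right continuity of \<open>F\<close>.\<close>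

lemma log_concave_of_laplace_tendsto:
  fixes Fn :: "nat \<Rightarrow> real \<Rightarrow> real" and F :: "real \<Rightarrow> real"
  assumes Fn: "\<And>n. mono (Fn n)" "\<And>n x. 0 \<le> Fn n x" "\<And>n x. Fn n x \<le> 1" "\<And>n x. x < 0 \<Longrightarrow> Fn n x = 0"
    and lc: "\<And>n x y t. 0 < t \<Longrightarrow> t < 1 \<Longrightarrow> Fn n x powr (1 - t) * Fn n y powr t \<le> Fn n ((1 - t) * x + t * y)"
    and F: "mono F" "\<And>x. 0 \<le> F x" "\<And>x. F x \<le> 1" "\<And>x. x < 0 \<Longrightarrow> F x = 0"
    and rc: "\<And>x. (F \<longlongrightarrow> F x) (at_right x)"
    and lim: "\<And>s. 0 < s \<Longrightarrow> (\<lambda>n. \<integral>x. exp (- s * x) * Fn n x \<partial>lborel) \<longlonglongrightarrow> (\<integral>x. exp (- s * x) * F x \<partial>lborel)"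
    and t: "0 < t" "t < 1"
  shows "F x powr (1 - t) * F y powr t \<le> F ((1 - t) * x + t * y)"
proof -
  have [measurable]: "\<And>n. Fn n \<in> borel_measurable borel" "F \<in> borel_measurable borel"
    using Fn(1) F(1) by (auto intro: borel_measurable_mono)
  let ?m = "(1 - t) * x + t * y"
  have key: "F x powr (1 - t) * F y powr t \<le> F (?m + 2 * \<eta>)" if \<eta>: "0 < \<eta>" for \<eta>
  proof -
    \<comment> \<open>A tent on \<open>{0..\<eta>}\<close>: its support lies to the right of the
      base point, so monotonicity bounds the average below by the value at that point.\<close>
    define \<beta> where "\<beta> u = max 0 (1 - \<bar>2 * u / \<eta> - 1\<bar>)" for u :: real
    have \<beta>0: "\<beta> u = 0" if "u \<le> 0 \<or> \<eta> \<le> u" for u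
    proof -
      have "\<bar>2 * u / \<eta> - 1\<bar> \<ge> 1" using that \<eta> by (auto simp: abs_if field_simps)
      then show ?thesis by (simp add: \<beta>_def)
    qed
    have \<beta>n: "0 \<le> \<beta> u" "\<beta> u \<le> 1" for u by (auto simp: \<beta>_def)
    have \<beta>c: "continuous_on UNIV \<beta>" unfolding \<beta>_def using \<eta> by (intro continuous_intros) auto
    then have \<beta>m[measurable]: "\<beta> \<in> borel_measurable borel" by (rule borel_measurable_continuous_onI)
    have \<beta>int: "integrable lborel (\<lambda>u. \<beta> (u - m) * f u)"
      if [measurable]: "f \<in> borel_measurable borel" and "\<And>u. 0 \<le> f u" "\<And>u. f u \<le> 1" for f :: "real \<Rightarrow> real" and m
    proof (rule Bochner_Integration.integrable_bound)
      show "integrable lborel (indicator {m..m + \<eta>} :: real \<Rightarrow> real)" using \<eta> by simp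
      show "AE u in lborel. norm (\<beta> (u - m) * f u) \<le> norm (indicator {m..m + \<eta>} u :: real)"
      proof (intro AE_I2)
        fix u
        show "norm (\<beta> (u - m) * f u) \<le> norm (indicator {m..m + \<eta>} u :: real)"
          using \<beta>0[of "u - m"] \<beta>n[of "u - m"] that(2,3)[of u]
          by (cases "u \<in> {m..m + \<eta>}") (auto simp: abs_mult intro: mult_le_one)
      qed
    qed simp
    define Z where "Z = (\<integral>u. \<beta> u \<partial>lborel)"
    have Zm: "(\<integral>u. \<beta> (u - m) \<partial>lborel) = Z" for m
      unfolding Z_def using lborel_integral_real_affine[of 1 "\<lambda>u. \<beta> (u - m)" m] by simp
    have Z: "0 < Z"
    proof -
      have "(\<integral>u. 1 / 2 * indicator {\<eta> / 4..3 * \<eta> / 4} u \<partial>lborel) \<le> Z"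
        unfolding Z_def
      proof (rule integral_mono)
        show "integrable lborel (\<lambda>u. 1 / 2 * indicator {\<eta> / 4..3 * \<eta> / 4} u :: real)" using \<eta> by simp
        show "integrable lborel \<beta>" using \<beta>int[of "\<lambda>_. 1" 0] by simp
        fix u
        show "1 / 2 * indicator {\<eta> / 4..3 * \<eta> / 4} u \<le> \<beta> u"
          using \<eta> \<beta>n[of u] by (auto simp: indicator_def \<beta>_def le_max_iff_disj abs_if field_simps)
      qed
      moreover have "(\<integral>u. 1 / 2 * indicator {\<eta> / 4..3 * \<eta> / 4} u \<partial>lborel) = \<eta> / 4"
        using \<eta> by simp
      ultimately show ?thesis using \<eta> by linarith
    qed
    have lo: "Z * f m \<le> (\<integral>u. \<beta> (u - m) * f u \<partial>lborel)" and hi: "(\<integral>u. \<beta> (u - m) * f u \<partial>lborel) \<le> Z * f (m + \<eta>)"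
      if f: "mono f" "\<And>u. 0 \<le> f u" "\<And>u. f u \<le> 1" for f :: "real \<Rightarrow> real" and m
    proof -
      have [measurable]: "f \<in> borel_measurable borel" using f by (intro borel_measurable_mono)
      have i: "integrable lborel (\<lambda>u. \<beta> (u - m) * c)" for c
        using \<beta>int[of "\<lambda>_. 1" m] by simp
      have "Z * f m = (\<integral>u. \<beta> (u - m) * f m \<partial>lborel)" using Zm[of m] by simp
      also have "\<dots> \<le> (\<integral>u. \<beta> (u - m) * f u \<partial>lborel)"
      proof (intro integral_mono i \<beta>int f)
        fix u show "\<beta> (u - m) * f m \<le> \<beta> (u - m) * f u"
          using \<beta>0[of "u - m"] \<beta>n[of "u - m"] monoD[OF f(1), of m u] by (cases "u \<le> m") (auto intro: mult_left_mono)
      qed simp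
      finally show "Z * f m \<le> (\<integral>u. \<beta> (u - m) * f u \<partial>lborel)" .
      have "(\<integral>u. \<beta> (u - m) * f u \<partial>lborel) \<le> (\<integral>u. \<beta> (u - m) * f (m + \<eta>) \<partial>lborel)"
      proof (intro integral_mono i \<beta>int f)
        fix u show "\<beta> (u - m) * f u \<le> \<beta> (u - m) * f (m + \<eta>)"
          using \<beta>0[of "u - m"] \<beta>n[of "u - m"] monoD[OF f(1), of u "m + \<eta>"] by (cases "m + \<eta> \<le> u") (auto intro: mult_left_mono)
      qed simp
      also have "\<dots> = Z * f (m + \<eta>)" using Zm[of m] by simp
      finally show "(\<integral>u. \<beta> (u - m) * f u \<partial>lborel) \<le> Z * f (m + \<eta>)" .
    qed
    have conv: "(\<lambda>n. \<integral>u. \<beta> (u - m) * Fn n u \<partial>lborel) \<longlonglongrightarrow> (\<integral>u. \<beta> (u - m) * F u \<partial>lborel)" for m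
    proof -
      \<comment> \<open>Substituting \<open>v = exp (- u)\<close> requires the test function
        \<open>\<beta> (- ln v - m) / v\<close>, which has to be continuous on all of the line.
        Replacing \<open>v\<close> by \<open>max v c\<close> achieves this without changing any
        integral, as the tent vanishes for \<open>u \<ge> m + \<eta>\<close>.\<close>
      define c where "c = exp (- (m + \<eta>))"
      have c: "0 < c" by (simp add: c_def)
      define \<phi> where "\<phi> v = \<beta> (- ln (max v c) - m) / max v c" for v
      have \<phi>: "continuous_on UNIV \<phi>" unfolding \<phi>_def
        using c by (intro continuous_intros continuous_on_compose2[OF \<beta>c]) (auto simp: max_def)
      have eq: "exp (- u) * (\<phi> (exp (- u)) * r) = \<beta> (u - m) * r" for u r
      proof (cases "c \<le> exp (- u)")
        case True
        then show ?thesis by (simp add: \<phi>_def max_absorb1)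
      next
        case False
        then have "m + \<eta> < u" by (simp add: c_def)
        moreover have "\<phi> (exp (- u)) = \<beta> (- ln c - m) / c" using False by (simp add: \<phi>_def max_def)
        then have "\<phi> (exp (- u)) = 0" using \<beta>0[of \<eta>] by (simp add: c_def)
        ultimately show ?thesis using \<beta>0[of "u - m"] by simp
      qed
      then show ?thesis
        using laplace_tendsto_imp_tendsto_integral[of Fn F \<phi>, OF _ _ Fn(2-4) F(2-4) lim \<phi>] unfolding eq by simp
    qed
    let ?J = "\<lambda>f m. (\<integral>u. \<beta> (u - m) * f u \<partial>lborel) / Z"
    have J0: "0 \<le> ?J f m" if "\<And>u. 0 \<le> f u" for f m using that \<beta>n Z by (intro divide_nonneg_pos integral_nonneg_AE AE_I2) auto
    have Jconv: "(\<lambda>n. ?J (Fn n) m) \<longlonglongrightarrow> ?J F m" for m using Z by (intro tendsto_divide conv tendsto_const) auto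
    have "?J F x powr (1 - t) * ?J F y powr t \<le> ?J F (?m + \<eta>)"
    proof (rule LIMSEQ_le)
      show "(\<lambda>n. ?J (Fn n) x powr (1 - t) * ?J (Fn n) y powr t) \<longlonglongrightarrow> ?J F x powr (1 - t) * ?J F y powr t"
        using t J0 Fn(2) by (intro tendsto_mult tendsto_powr' Jconv tendsto_const disjI2 conjI always_eventually allI) auto
      show "(\<lambda>n. ?J (Fn n) (?m + \<eta>)) \<longlonglongrightarrow> ?J F (?m + \<eta>)" by (rule Jconv)
      have "?J (Fn n) x powr (1 - t) * ?J (Fn n) y powr t \<le> ?J (Fn n) (?m + \<eta>)" for n
      proof -
        have "?J (Fn n) x powr (1 - t) * ?J (Fn n) y powr t \<le> Fn n (x + \<eta>) powr (1 - t) * Fn n (y + \<eta>) powr t"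
          using t J0 Fn(2) hi[OF Fn(1-3)] Z by (intro mult_mono powr_mono2) (auto simp: pos_divide_le_eq mult.commute)
        also have "\<dots> \<le> Fn n ((1 - t) * (x + \<eta>) + t * (y + \<eta>))" by (rule lc[OF t])
        also have "(1 - t) * (x + \<eta>) + t * (y + \<eta>) = ?m + \<eta>" by (simp add: algebra_simps)
        also have "Fn n (?m + \<eta>) \<le> ?J (Fn n) (?m + \<eta>)" using lo[OF Fn(1-3)] Z by (simp add: pos_le_divide_eq mult.commute)
        finally show ?thesis .
      qed
      then show "\<exists>N. \<forall>n\<ge>N. ?J (Fn n) x powr (1 - t) * ?J (Fn n) y powr t \<le> ?J (Fn n) (?m + \<eta>)" by blast
    qed
    moreover have "F x powr (1 - t) * F y powr t \<le> ?J F x powr (1 - t) * ?J F y powr t"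
      using t F(2) lo[OF F(1-3)] Z by (intro mult_mono powr_mono2) (auto simp: pos_le_divide_eq mult.commute)
    moreover have "?J F (?m + \<eta>) \<le> F (?m + 2 * \<eta>)"
      using hi[OF F(1-3), of "?m + \<eta>"] Z by (simp add: pos_divide_le_eq mult.commute add.assoc)
    ultimately show ?thesis by linarith
  qed
  show ?thesis
  proof (rule tendsto_lowerbound[OF rc[of ?m]])
    have "eventually (\<lambda>z. z \<in> {?m<..<?m + 1}) (at_right ?m)" by (rule eventually_at_right_real) simp
    then show "eventually (\<lambda>z. F x powr (1 - t) * F y powr t \<le> F z) (at_right ?m)"
    proof eventually_elim
      case (elim z)
      have "m + 2 * ((z - m) / 2) = z" for m by (simp add: field_simps)
      then show ?case using key[of "(z - ?m) / 2"] elim by (simp only:) simp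
    qed
  qed simp
qed

section \<open>Exact discretisation of the Riccati equation\<close>

lemma mvt_within_unit_interval:
  fixes f f' :: "real \<Rightarrow> real"
  assumes f: "\<And>x. x \<in> {0..1} \<Longrightarrow> (f has_real_derivative f' x) (at x within {0..1})"
    and t: "t \<in> {0..1}" "u \<in> {0..1}"
  shows "\<exists>\<xi>\<in>{0..1}. \<bar>\<xi> - t\<bar> \<le> \<bar>u - t\<bar> \<and> f u - f t = f' \<xi> * (u - t)"
proof -
  have aux: "\<exists>\<xi>\<in>{a<..<b}. f b - f a = f' \<xi> * (b - a)" if "a < b" "0 \<le> a" "b \<le> 1" for a b
  proof (rule mvt_simple[OF that(1)])
    fix x assume "a \<le> x" "x \<le> b"
    then have "(f has_real_derivative f' x) (at x within {a..b})"
      by (intro has_field_derivative_subset[OF f]) (use that in auto)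
    then show "(f has_derivative (*) (f' x)) (at x within {a..b})" by (simp add: has_field_derivative_def)
  qed
  consider "t < u" | "t = u" | "u < t" by linarith
  then show ?thesis
  proof cases
    case 1
    with aux[OF 1] t obtain \<xi> where "\<xi> \<in> {t<..<u}" "f u - f t = f' \<xi> * (u - t)" by auto
    then show ?thesis using t by (intro bexI[of _ \<xi>]) auto
  next
    case 2 then show ?thesis using t by auto
  next
    case 3
    with aux[OF 3] t obtain \<xi> where x: "\<xi> \<in> {u<..<t}" "f t - f u = f' \<xi> * (t - u)" by auto
    have "f u - f t = f' \<xi> * (u - t)" using x(2) by (simp add: algebra_simps)
    then show ?thesis using t x by (intro bexI[of _ \<xi>]) auto
  qed
qed

text \<open>Two applications of the mean value theorem together with uniform continuity of
  \<open>y''\<close>. The remainder has to be uniform in the base point, because it is used at all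
  grid points at once.\<close>

lemma uniform_taylor_unit_interval:
  fixes y y' y'' :: "real \<Rightarrow> real"
  assumes y: "\<And>x. x \<in> {0..1} \<Longrightarrow> (y has_real_derivative y' x) (at x within {0..1})"
    and y': "\<And>x. x \<in> {0..1} \<Longrightarrow> (y' has_real_derivative y'' x) (at x within {0..1})"
    and y'': "continuous_on {0..1} y''" and \<epsilon>: "0 < \<epsilon>"
  shows "\<exists>\<delta>>0. \<forall>t\<in>{0..1}. \<forall>u\<in>{0..1}. \<bar>u - t\<bar> < \<delta> \<longrightarrow>
    \<bar>y u - y t - y' t * (u - t) - y'' t * (u - t)\<^sup>2 / 2\<bar> \<le> \<epsilon> * (u - t)\<^sup>2"
proof -
  have "uniformly_continuous_on {0..1} y''" by (rule compact_uniformly_continuous[OF y'']) simp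
  then obtain \<delta> where \<delta>: "0 < \<delta>" "\<And>t u. t \<in> {0..1} \<Longrightarrow> u \<in> {0..1} \<Longrightarrow> \<bar>u - t\<bar> < \<delta> \<Longrightarrow> \<bar>y'' u - y'' t\<bar> < \<epsilon>"
    using \<epsilon> by (auto elim!: uniformly_continuous_onE[of _ _ \<epsilon>] simp: dist_real_def)
  have "\<bar>y u - y t - y' t * (u - t) - y'' t * (u - t)\<^sup>2 / 2\<bar> \<le> \<epsilon> * (u - t)\<^sup>2"
    if t: "t \<in> {0..1}" "u \<in> {0..1}" "\<bar>u - t\<bar> < \<delta>" for t u
  proof -
    have one: "\<bar>y' v - y' t - y'' t * (v - t)\<bar> \<le> \<epsilon> * \<bar>v - t\<bar>" if v: "v \<in> {0..1}" "\<bar>v - t\<bar> < \<delta>" for v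
    proof -
      have "((\<lambda>x. y' x - y'' t * (x - t)) has_real_derivative y'' x - y'' t) (at x within {0..1})" if "x \<in> {0..1}" for x
        using y'[OF that] by (auto intro!: derivative_eq_intros)
      from mvt_within_unit_interval[of "\<lambda>x. y' x - y'' t * (x - t)", OF this t(1) v(1)]
      obtain \<xi> where \<xi>: "\<xi> \<in> {0..1}" "\<bar>\<xi> - t\<bar> \<le> \<bar>v - t\<bar>" "y' v - y'' t * (v - t) - (y' t - y'' t * (t - t)) = (y'' \<xi> - y'' t) * (v - t)"
        by auto
      have "y' v - y' t - y'' t * (v - t) = (y'' \<xi> - y'' t) * (v - t)" using \<xi>(3) by simp
      then have "\<bar>y' v - y' t - y'' t * (v - t)\<bar> = \<bar>y'' \<xi> - y'' t\<bar> * \<bar>v - t\<bar>" by (simp only: abs_mult)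
      also have "\<dots> \<le> \<epsilon> * \<bar>v - t\<bar>"
        using \<delta>(2)[OF t(1) \<xi>(1)] \<xi>(2) v by (intro mult_right_mono) auto
      finally show ?thesis .
    qed
    have "((\<lambda>x. y x - y' t * (x - t) - y'' t * (x - t)\<^sup>2 / 2) has_real_derivative y' x - y' t - y'' t * (x - t)) (at x within {0..1})" if "x \<in> {0..1}" for x
      using y[OF that] by (auto intro!: derivative_eq_intros)
    from mvt_within_unit_interval[of "\<lambda>x. y x - y' t * (x - t) - y'' t * (x - t)\<^sup>2 / 2", OF this t(1,2)]
    obtain \<xi> where \<xi>: "\<xi> \<in> {0..1}" "\<bar>\<xi> - t\<bar> \<le> \<bar>u - t\<bar>"
      "y u - y' t * (u - t) - y'' t * (u - t)\<^sup>2 / 2 - y t = (y' \<xi> - y' t - y'' t * (\<xi> - t)) * (u - t)"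
      by auto
    have "y u - y t - y' t * (u - t) - y'' t * (u - t)\<^sup>2 / 2 = (y' \<xi> - y' t - y'' t * (\<xi> - t)) * (u - t)" using \<xi>(3) by linarith
    then have "\<bar>y u - y t - y' t * (u - t) - y'' t * (u - t)\<^sup>2 / 2\<bar> = \<bar>y' \<xi> - y' t - y'' t * (\<xi> - t)\<bar> * \<bar>u - t\<bar>" by (simp only: abs_mult)
    also have "\<dots> \<le> (\<epsilon> * \<bar>u - t\<bar>) * \<bar>u - t\<bar>"
    proof (intro mult_right_mono)
      have "\<epsilon> * \<bar>\<xi> - t\<bar> \<le> \<epsilon> * \<bar>u - t\<bar>" using \<xi>(2) \<epsilon> by (intro mult_left_mono) auto
      then show "\<bar>y' \<xi> - y' t - y'' t * (\<xi> - t)\<bar> \<le> \<epsilon> * \<bar>u - t\<bar>"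
        using one[OF \<xi>(1)] \<xi>(2) t(3) by linarith
    qed simp
    also have "\<dots> = \<epsilon> * (u - t)\<^sup>2" by (simp only: power2_eq_square mult.assoc abs_mult_self_eq)
    finally show ?thesis .
  qed
  then show ?thesis using \<delta>(1) by blast
qed

lemma riemann_sum_tendsto:
  fixes f :: "real \<Rightarrow> real"
  assumes f: "continuous_on {0..1} f"
  shows "(\<lambda>n. (\<Sum>j<n. f (real j / real n)) / real n) \<longlonglongrightarrow> (LBINT t:{0..1}. f t)"
proof (rule LIMSEQ_I)
  fix r :: real assume r: "0 < r"
  define F where "F x = integral {0..x} f" for x
  have F: "(F has_real_derivative f x) (at x within {0..1})" if "x \<in> {0..1}" for x
    unfolding F_def by (rule integral_has_real_derivative[OF f that])
  have I: "(LBINT t:{0..1}. f t) = F 1 - F 0"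
  proof -
    have "set_integrable lborel {0..1} f" by (rule borel_integrable_atLeastAtMost') (rule f)
    from set_borel_integral_eq_integral(2)[OF this] show ?thesis by (simp add: F_def)
  qed
  have "uniformly_continuous_on {0..1} f" by (rule compact_uniformly_continuous[OF f]) simp
  then obtain \<delta> where \<delta>: "0 < \<delta>" "\<And>t u. t \<in> {0..1} \<Longrightarrow> u \<in> {0..1} \<Longrightarrow> \<bar>u - t\<bar> < \<delta> \<Longrightarrow> \<bar>f u - f t\<bar> < r / 2"
    using r by (auto elim!: uniformly_continuous_onE[of _ _ "r / 2"] simp: dist_real_def)
  obtain n0 :: nat where n0: "1 / \<delta> < real n0" using reals_Archimedean2 by blast
  have "norm ((\<Sum>j<n. f (real j / real n)) / real n - (LBINT t:{0..1}. f t)) < r" if n: "n \<ge> Suc n0" for n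
  proof -
    have np: "0 < real n" using n by simp
    have "1 / \<delta> < real n" using n0 n by linarith
    then have nd: "1 / real n < \<delta>" using \<delta>(1) np by (simp add: field_simps)
    have step: "\<bar>f (real j / real n) / real n - (F (real (Suc j) / real n) - F (real j / real n))\<bar> \<le> r / 2 / real n" if j: "j < n" for j
    proof -
      have t: "real j / real n \<in> {0..1}" "real (Suc j) / real n \<in> {0..1}" using j by auto
      have diff: "real (Suc j) / real n - real j / real n = 1 / real n" by (simp add: diff_divide_distrib[symmetric])
      obtain \<xi> where \<xi>: "\<xi> \<in> {0..1}" "\<bar>\<xi> - real j / real n\<bar> \<le> 1 / real n" "F (real (Suc j) / real n) - F (real j / real n) = f \<xi> * (1 / real n)"
        using mvt_within_unit_interval[of F f, OF F t] unfolding diff by auto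
      have "\<bar>f (real j / real n) / real n - f \<xi> * (1 / real n)\<bar> = \<bar>f \<xi> - f (real j / real n)\<bar> / real n"
        using np by (simp add: abs_minus_commute flip: diff_divide_distrib)
      also have "\<dots> \<le> r / 2 / real n"
        using \<delta>(2)[OF t(1) \<xi>(1)] \<xi>(2) nd np by (intro divide_right_mono) auto
      finally show ?thesis using \<xi>(3) by simp
    qed
    have "F 1 - F 0 = (\<Sum>j<n. F (real (Suc j) / real n) - F (real j / real n))"
      using np by (subst sum_lessThan_telescope[of "\<lambda>j. F (real j / real n)" n]) simp
    then have "(\<Sum>j<n. f (real j / real n)) / real n - (LBINT t:{0..1}. f t)
       = (\<Sum>j<n. f (real j / real n) / real n - (F (real (Suc j) / real n) - F (real j / real n)))"
      by (simp add: I sum_subtractf sum_divide_distrib)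
    also have "norm \<dots> \<le> (\<Sum>j<n. r / 2 / real n)"
      using step by (intro sum_norm_le) auto
    also have "\<dots> = r / 2" using np by simp
    finally show ?thesis using r by simp
  qed
  then show "\<exists>no. \<forall>n\<ge>no. norm ((\<Sum>j<n. f (real j / real n)) / real n - (LBINT t:{0..1}. f t)) < r" by blast
qed


text \<open>The solution \<open>y\<close> comes first and the weight \<open>q\<close> is read off
  from it, so no existence theorem for differential equations is involved. The Riccati variable is
  \<open>- y' / y - \<alpha>\<close>; it vanishes at 1, where nothing remains to be weighted, and
  this is \<open>bdry\<close>.\<close>

locale ou_weights =
  fixes \<alpha> :: real and y y' y'' q :: "real \<Rightarrow> real"
  assumes \<alpha>: "0 < \<alpha>"
    and y: "\<And>x. x \<in> {0..1} \<Longrightarrow> (y has_real_derivative y' x) (at x within {0..1})"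
    and y': "\<And>x. x \<in> {0..1} \<Longrightarrow> (y' has_real_derivative y'' x) (at x within {0..1})"
    and y'': "continuous_on {0..1} y''" and ypos: "\<And>x. x \<in> {0..1} \<Longrightarrow> 0 < y x"
    and q: "\<And>x. x \<in> {0..1} \<Longrightarrow> q x = y'' x / y x - \<alpha>\<^sup>2"
    and qpos: "\<And>x. x \<in> {0..1} \<Longrightarrow> 0 < q x"
    and bdry: "y' 1 = - \<alpha> * y 1"
begin

text \<open>Observed with spacing \<open>1 / n\<close>, the process is an autoregression with
  correlation \<open>\<rho> n\<close> and innovation variance \<open>s2 n\<close>.\<close>

definition \<rho> :: "nat \<Rightarrow> real" where "\<rho> n = exp (- \<alpha> / real n)"

definition s2 :: "nat \<Rightarrow> real" where "s2 n = (1 - (\<rho> n)\<^sup>2) / (2 * \<alpha>)"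

text \<open>The Riccati recursion behind \<open>ou_laplace\<close> is linearised by
  \<open>1 + A n k * s2 n = \<rho> n * y ((k - 1) / n) / y (k / n)\<close>; reading it backwards gives weights \<open>w n\<close>
  for which the recursion is solved exactly, and \<open>n * w n k\<close> approximates \<open>q (k / n)\<close>.\<close>

definition A :: "nat \<Rightarrow> nat \<Rightarrow> real" where
  "A n k = (\<rho> n * y (real (k - 1) / real n) / y (real k / real n) - 1) / s2 n"

text \<open>This is \<open>(\<rho> n)\<^sup>2 * A n (Suc k) / (1 + A n (Suc k) * s2 n)\<close> for
  \<open>k < n\<close> and \<open>0 < n\<close>: the weight that the elimination of index
  \<open>Suc k\<close> passes on to index \<open>k\<close>.\<close>

definition a :: "nat \<Rightarrow> nat \<Rightarrow> real" where
  "a n k = ((\<rho> n)\<^sup>2 - \<rho> n * y (real (Suc k) / real n) / y (real k / real n)) / s2 n"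

definition w :: "nat \<Rightarrow> nat \<Rightarrow> real" where
  "w n k = (if k = 0 \<or> n \<le> k then 0 else A n k - a n k)"

lemma continuous_y: "continuous_on {0..1} y"
  by (rule DERIV_continuous_on) (rule y)

lemma continuous_q: "continuous_on {0..1} q"
proof -
  have "continuous_on {0..1} (\<lambda>x. y'' x / y x - \<alpha>\<^sup>2)"
    by (intro continuous_intros y'' continuous_y) (use ypos in force)
  then show ?thesis by (rule continuous_on_eq) (simp add: q)
qed

lemma rho_pos: "0 < \<rho> n" by (simp add: \<rho>_def)

lemma rho_less: "0 < n \<Longrightarrow> \<rho> n < 1" using \<alpha> by (simp add: \<rho>_def)

lemma s2_pos: "0 < n \<Longrightarrow> 0 < s2 n"
  using \<alpha> rho_pos[of n] rho_less[of n] by (simp add: s2_def power_less_one_iff)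

lemma lim_kappa: "(\<lambda>n. \<rho> n / (real n * s2 n)) \<longlonglongrightarrow> 1"
  unfolding \<rho>_def s2_def using \<alpha> by real_asymp

lemma lim_s2: "(\<lambda>n. 1 / (real n * s2 n)) \<longlonglongrightarrow> 1"
  unfolding \<rho>_def s2_def using \<alpha> by real_asymp

text \<open>\<open>\<rho> n + 1 / \<rho> n - 2\<close> is
  \<open>2 * (cosh (\<alpha> / n) - 1)\<close>; this is how \<open>\<alpha>\<^sup>2\<close> enters
  \<open>q\<close>.\<close>

lemma lim_mu: "(\<lambda>n. (\<rho> n + 1 / \<rho> n - 2) * (real n)\<^sup>2) \<longlonglongrightarrow> \<alpha>\<^sup>2"
  unfolding \<rho>_def using \<alpha> by (real_asymp simp: power2_eq_square)

lemma taylor: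
  assumes "0 < \<epsilon>"
  shows "eventually (\<lambda>n. \<forall>t\<in>{0..1}. \<forall>u\<in>{0..1}. \<bar>u - t\<bar> = 1 / real n \<longrightarrow>
    \<bar>y u - y t - y' t * (u - t) - y'' t / (2 * (real n)\<^sup>2)\<bar> \<le> \<epsilon> / (real n)\<^sup>2) sequentially"
proof -
  obtain \<delta> where \<delta>: "0 < \<delta>" "\<And>t u. t \<in> {0..1} \<Longrightarrow> u \<in> {0..1} \<Longrightarrow> \<bar>u - t\<bar> < \<delta> \<Longrightarrow>
    \<bar>y u - y t - y' t * (u - t) - y'' t * (u - t)\<^sup>2 / 2\<bar> \<le> \<epsilon> * (u - t)\<^sup>2"
    using uniform_taylor_unit_interval[of y y' y'', OF y y' y'' assms] by blast
  have "eventually (\<lambda>n. 1 / real n < \<delta>) sequentially"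
    using \<delta>(1) by (intro order_tendstoD(2)[OF lim_1_over_n])
  then show ?thesis
  proof eventually_elim
    case (elim n)
    show ?case
    proof (intro ballI impI)
      fix t u :: real assume t: "t \<in> {0..1}" "u \<in> {0..1}" "\<bar>u - t\<bar> = 1 / real n"
      have "(u - t)\<^sup>2 = 1 / (real n)\<^sup>2"
        using t(3) by (metis power2_abs power_one_over)
      then show "\<bar>y u - y t - y' t * (u - t) - y'' t / (2 * (real n)\<^sup>2)\<bar> \<le> \<epsilon> / (real n)\<^sup>2"
        using \<delta>(2)[OF t(1,2)] t(3) elim by (simp add: mult.commute)
    qed
  qed
qed

text \<open>In \<open>w n j\<close> the two neighbours of \<open>y\<close> combine to a second
  difference: \<open>n * w n j\<close> equals \<open>\<kappa> n\<close> times the difference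
  quotient for \<open>y'' / y\<close> minus \<open>\<mu> n\<close>, with \<open>\<kappa> n\<close>
  tending to 1 and \<open>\<mu> n\<close> to \<open>\<alpha>\<^sup>2\<close>. Uniformity in
  \<open>j\<close> yields both the sign of the weights and the convergence of the sums.\<close>

lemma w_uniform:
  assumes \<epsilon>: "0 < \<epsilon>"
  shows "eventually (\<lambda>n. \<forall>j. 0 < j \<longrightarrow> j < n \<longrightarrow> \<bar>real n * w n j - q (real j / real n)\<bar> \<le> \<epsilon>) sequentially"
proof -
  obtain m0 where m0: "m0 \<in> {0..1}" "\<And>x. x \<in> {0..1} \<Longrightarrow> y m0 \<le> y x"
    using continuous_attains_inf[OF _ _ continuous_y] by auto
  obtain q0 where q0: "q0 \<in> {0..1}" "\<And>x. x \<in> {0..1} \<Longrightarrow> q x \<le> q q0"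
    using continuous_attains_sup[OF _ _ continuous_q] by auto
  define Q where "Q = q q0"
  have Q: "0 < Q" "\<And>x. x \<in> {0..1} \<Longrightarrow> \<bar>q x\<bar> \<le> Q"
    using q0 qpos by (auto simp: Q_def abs_of_pos)
  define m where "m = y m0"
  have m: "0 < m" "\<And>x. x \<in> {0..1} \<Longrightarrow> m \<le> y x" using m0 ypos by (auto simp: m_def)
  define \<kappa> where "\<kappa> n = \<rho> n / (real n * s2 n)" for n
  define \<mu> where "\<mu> n = (\<rho> n + 1 / \<rho> n - 2) * (real n)\<^sup>2" for n
  \<comment> \<open>The bound 1 gives \<open>\<bar>\<kappa> n\<bar> \<le> 2\<close>; the other bound
    limits the contribution of \<open>\<kappa> n - 1\<close> to
    \<open>\<epsilon> / 4\<close>.\<close>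
  define e where "e = min (\<epsilon> / (4 * Q)) 1"
  have e: "0 < e" "e \<le> 1" "e * Q \<le> \<epsilon> / 4" using Q \<epsilon>
    by (auto simp: e_def min_def field_simps)
  have "eventually (\<lambda>n. \<bar>\<kappa> n - 1\<bar> < e) sequentially"
    using tendstoD[OF lim_kappa e(1)] by (simp add: dist_real_def \<kappa>_def)
  moreover have "eventually (\<lambda>n. \<bar>\<mu> n - \<alpha>\<^sup>2\<bar> < \<epsilon> / 8) sequentially"
    using tendstoD[OF lim_mu, of "\<epsilon> / 8"] \<epsilon> by (simp add: dist_real_def \<mu>_def)
  moreover have "eventually (\<lambda>n. \<forall>t\<in>{0..1}. \<forall>u\<in>{0..1}. \<bar>u - t\<bar> = 1 / real n \<longrightarrow>
    \<bar>y u - y t - y' t * (u - t) - y'' t / (2 * (real n)\<^sup>2)\<bar> \<le> (\<epsilon> * m / 16) / (real n)\<^sup>2) sequentially"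
    using \<epsilon> m by (intro taylor) auto
  ultimately show ?thesis
  proof eventually_elim
    case (elim n)
    show ?case
    proof (intro allI impI)
      fix j assume j: "0 < j" "j < n"
      then have n: "0 < n" "0 < real n" by auto
      define t where "t = real j / real n"
      define u where "u = real (j - 1) / real n"
      define v where "v = real (Suc j) / real n"
      have tuv: "t \<in> {0..1}" "u \<in> {0..1}" "v \<in> {0..1}" using j by (auto simp: t_def u_def v_def)
      have ut: "u - t = - (1 / real n)" "v - t = 1 / real n"
        using j n by (auto simp: t_def u_def v_def of_nat_diff diff_divide_distrib add_divide_distrib)
      define E where "E = (y u + y v - 2 * y t) * (real n)\<^sup>2 - y'' t"
      have "\<bar>y u - y t - y' t * (u - t) - y'' t / (2 * (real n)\<^sup>2)\<bar> \<le> (\<epsilon> * m / 16) / (real n)\<^sup>2"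
        "\<bar>y v - y t - y' t * (v - t) - y'' t / (2 * (real n)\<^sup>2)\<bar> \<le> (\<epsilon> * m / 16) / (real n)\<^sup>2"
        using elim(3)[rule_format, OF tuv(1,2)] elim(3)[rule_format, OF tuv(1,3)] by (simp_all add: ut)
      then have "\<bar>(y u + y v - 2 * y t) - 2 * (y'' t / (2 * (real n)\<^sup>2))\<bar> \<le> 2 * ((\<epsilon> * m / 16) / (real n)\<^sup>2)"
        unfolding ut by linarith
      then have "\<bar>(y u + y v - 2 * y t) - 2 * (y'' t / (2 * (real n)\<^sup>2))\<bar> * (real n)\<^sup>2 \<le> 2 * ((\<epsilon> * m / 16) / (real n)\<^sup>2) * (real n)\<^sup>2"
        by (intro mult_right_mono) auto
      also have "\<bar>(y u + y v - 2 * y t) - 2 * (y'' t / (2 * (real n)\<^sup>2))\<bar> * (real n)\<^sup>2 = \<bar>E\<bar>"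
      proof -
        have "((y u + y v - 2 * y t) - 2 * (y'' t / (2 * (real n)\<^sup>2))) * (real n)\<^sup>2 = E"
          using n by (simp add: E_def field_simps)
        then show ?thesis by (metis abs_mult abs_power2)
      qed
      also have "2 * ((\<epsilon> * m / 16) / (real n)\<^sup>2) * (real n)\<^sup>2 = \<epsilon> * m / 8" using n by simp
      finally have E: "\<bar>E\<bar> \<le> \<epsilon> * m / 8" .
      have yt: "0 < y t" "m \<le> y t" using ypos m tuv by auto
      have "real n * w n j = \<kappa> n * ((y'' t + E) / y t - \<mu> n)"
      proof -
        have r: "0 < \<rho> n" by (rule rho_pos)
        have s: "0 < s2 n" by (rule s2_pos[OF n(1)])
        have "w n j = (\<rho> n * y u / y t - 1 - ((\<rho> n)\<^sup>2 - \<rho> n * y v / y t)) / s2 n"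
          using j by (simp add: w_def A_def a_def t_def u_def v_def diff_divide_distrib)
        also have "\<rho> n * y u / y t - 1 - ((\<rho> n)\<^sup>2 - \<rho> n * y v / y t) = \<rho> n * ((y u + y v - 2 * y t) / y t - (\<rho> n + 1 / \<rho> n - 2))"
          using r yt by (simp add: field_simps power2_eq_square)
        finally have wn: "w n j = \<rho> n * ((y u + y v - 2 * y t) / y t - (\<rho> n + 1 / \<rho> n - 2)) / s2 n" .
        have "N * (r * (Z - L) / S) = r / (N * S) * (Z * N\<^sup>2 - L * N\<^sup>2)" if "N \<noteq> 0" "S \<noteq> 0" for N r Z L S :: real
          using that by (simp add: field_simps power2_eq_square)
        then have "real n * w n j = (\<rho> n / (real n * s2 n)) * ((y u + y v - 2 * y t) / y t * (real n)\<^sup>2 - (\<rho> n + 1 / \<rho> n - 2) * (real n)\<^sup>2)"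
          unfolding wn using n s by auto
        then show ?thesis by (simp add: E_def \<kappa>_def \<mu>_def)
      qed
      then have "real n * w n j - q t = (\<kappa> n - 1) * q t + \<kappa> n * (E / y t - (\<mu> n - \<alpha>\<^sup>2))"
      proof -
        have "(y'' t + E) / y t = q t + \<alpha>\<^sup>2 + E / y t" using q[OF tuv(1)] by (simp add: add_divide_distrib)
        then show ?thesis using \<open>real n * w n j = \<kappa> n * ((y'' t + E) / y t - \<mu> n)\<close> by (simp add: algebra_simps)
      qed
      also have "\<bar>\<dots>\<bar> \<le> \<bar>\<kappa> n - 1\<bar> * \<bar>q t\<bar> + \<bar>\<kappa> n\<bar> * (\<bar>E / y t\<bar> + \<bar>\<mu> n - \<alpha>\<^sup>2\<bar>)"
      proof -
        have "\<bar>(\<kappa> n - 1) * q t + \<kappa> n * (E / y t - (\<mu> n - \<alpha>\<^sup>2))\<bar> \<le> \<bar>\<kappa> n - 1\<bar> * \<bar>q t\<bar> + \<bar>\<kappa> n\<bar> * \<bar>E / y t - (\<mu> n - \<alpha>\<^sup>2)\<bar>"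
          unfolding abs_mult[symmetric] by (rule abs_triangle_ineq)
        also have "\<bar>\<kappa> n\<bar> * \<bar>E / y t - (\<mu> n - \<alpha>\<^sup>2)\<bar> \<le> \<bar>\<kappa> n\<bar> * (\<bar>E / y t\<bar> + \<bar>\<mu> n - \<alpha>\<^sup>2\<bar>)"
          by (intro mult_left_mono abs_triangle_ineq4) simp
        finally show ?thesis by simp
      qed
      also have "\<dots> \<le> e * Q + 2 * (\<epsilon> / 8 + \<epsilon> / 8)"
      proof (intro add_mono mult_mono)
        show "\<bar>E / y t\<bar> \<le> \<epsilon> / 8"
        proof -
          have "\<bar>E / y t\<bar> = \<bar>E\<bar> / y t" using yt by simp
          also have "\<dots> \<le> (\<epsilon> * m / 8) / y t" using E yt by (intro divide_right_mono) auto
          also have "\<dots> \<le> (\<epsilon> * y t / 8) / y t" using yt \<epsilon> by (intro divide_right_mono mult_left_mono) auto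
          finally show ?thesis using yt by simp
        qed
      qed (use elim(1,2) e Q tuv \<epsilon> in auto)
      also have "\<dots> \<le> \<epsilon>" using e(3) \<epsilon> by simp
      finally show "\<bar>real n * w n j - q (real j / real n)\<bar> \<le> \<epsilon>" by (simp add: t_def)
    qed
  qed
qed

lemma lim_difference_quotients:
  shows "(\<lambda>n. real n * (y (1 - 1 / real n) - y 1)) \<longlonglongrightarrow> - y' 1"
    and "(\<lambda>n. real n * (y (1 / real n) - y 0)) \<longlonglongrightarrow> y' 0"
proof -
  have ev: "eventually (\<lambda>n. 0 < n) sequentially" by (rule eventually_gt_at_top)
  have main: "(\<lambda>n. real n * (y (t + c / real n) - y t)) \<longlonglongrightarrow> c * y' t"
    if t: "t \<in> {0..1}" "\<bar>c\<bar> = 1" "\<And>n. 0 < n \<Longrightarrow> t + c / real n \<in> {0..1}" for t c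
  proof (rule Lim_transform_bound[where f = "\<lambda>n. real n * (y (t + c / real n) - y t) - c * y' t" and g="\<lambda>n. (\<bar>y'' t\<bar> / 2 + 1) * (1 / real n)", THEN LIM_zero_cancel])
    show "(\<lambda>n. (\<bar>y'' t\<bar> / 2 + 1) * (1 / real n)) \<longlonglongrightarrow> 0"
      using tendsto_mult_right_zero[OF lim_1_over_n] by blast
    show "eventually (\<lambda>n. norm (real n * (y (t + c / real n) - y t) - c * y' t) \<le> norm ((\<bar>y'' t\<bar> / 2 + 1) * (1 / real n))) sequentially"
      using taylor[OF zero_less_one] ev
    proof eventually_elim
      case (elim n)
      then have n: "0 < real n" by simp
      define R where "R = y (t + c / real n) - y t - y' t * (c / real n) - y'' t / (2 * (real n)\<^sup>2)"
      have "\<bar>R\<bar> \<le> 1 / (real n)\<^sup>2"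
        using elim(1)[rule_format, of t "t + c / real n"] t(1,2) t(3)[of n] n by (simp add: R_def)
      have "real n * (y (t + c / real n) - y t) - c * y' t = real n * R + y'' t / (2 * real n)"
        using n by (simp add: R_def field_simps power2_eq_square)
      also have "\<bar>\<dots>\<bar> \<le> real n * \<bar>R\<bar> + \<bar>y'' t / (2 * real n)\<bar>"
        using n by (intro order_trans[OF abs_triangle_ineq]) (auto simp: abs_mult)
      also have "\<dots> \<le> real n * (1 / (real n)\<^sup>2) + \<bar>y'' t\<bar> / (2 * real n)"
        using n \<open>\<bar>R\<bar> \<le> 1 / (real n)\<^sup>2\<close> by (intro add_mono mult_left_mono) auto
      also have "\<dots> = (\<bar>y'' t\<bar> / 2 + 1) * (1 / real n)"
        using n by (simp add: field_simps power2_eq_square)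
      finally show ?case using n by simp
    qed
  qed
  show "(\<lambda>n. real n * (y (1 - 1 / real n) - y 1)) \<longlonglongrightarrow> - y' 1"
    using main[of 1 "-1"] by simp
  show "(\<lambda>n. real n * (y (1 / real n) - y 0)) \<longlonglongrightarrow> y' 0"
    using main[of 0 "1"] by simp
qed

lemma A_last: "0 < n \<Longrightarrow> A n n = (\<rho> n * y (1 - 1 / real n) / y 1 - 1) / s2 n"
  by (simp add: A_def of_nat_diff diff_divide_distrib)

text \<open>By the boundary condition, \<open>y (1 - 1/n) / y 1\<close> and
  \<open>exp (\<alpha> / n)\<close> agree to first order in \<open>1 / n\<close>, so the sign is
  decided at second order, where the coefficients are \<open>(\<alpha>^2 + q 1) / 2\<close> and
  \<open>\<alpha>^2 / 2\<close>. Positivity of \<open>q 1\<close> decides it; with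
  \<open>c = q 1 / 2\<close>, the value \<open>(\<alpha>^2 + c) / 2\<close> lies strictly between
  the two.\<close>

lemma A_last_nonneg: "eventually (\<lambda>n. 0 \<le> A n n) sequentially"
proof -
  define c where "c = q 1 / 2"
  have c: "0 < c" using qpos[of 1] by (simp add: c_def)
  have y1: "0 < y 1" using ypos[of 1] by simp
  have y2: "y'' 1 = (\<alpha>\<^sup>2 + 2 * c) * y 1" using q[of 1] y1 by (simp add: c_def field_simps)
  have "(\<lambda>n. (exp (\<alpha> / real n) - 1 - \<alpha> / real n) * (real n)\<^sup>2) \<longlonglongrightarrow> \<alpha>\<^sup>2 / 2"
    using \<alpha> by (real_asymp simp: power2_eq_square)
  then have "eventually (\<lambda>n. (exp (\<alpha> / real n) - 1 - \<alpha> / real n) * (real n)\<^sup>2 < (\<alpha>\<^sup>2 + c) / 2) sequentially"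
    by (rule order_tendstoD) (use c in simp)
  moreover have "eventually (\<lambda>n. \<forall>t\<in>{0..1}. \<forall>u\<in>{0..1}. \<bar>u - t\<bar> = 1 / real n \<longrightarrow>
    \<bar>y u - y t - y' t * (u - t) - y'' t / (2 * (real n)\<^sup>2)\<bar> \<le> (c * y 1 / 2) / (real n)\<^sup>2) sequentially"
    using c y1 by (intro taylor) auto
  ultimately show ?thesis using eventually_gt_at_top[of 0]
  proof eventually_elim
    case (elim n)
    then have n: "0 < n" "0 < real n" "1 \<le> real n" by auto
    have "\<bar>y (1 - 1 / real n) - y 1 - y' 1 * (1 - 1 / real n - 1) - y'' 1 / (2 * (real n)\<^sup>2)\<bar> \<le> (c * y 1 / 2) / (real n)\<^sup>2"
      by (rule elim(2)[rule_format]) (use n in auto)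
    then have "y 1 - y' 1 / real n + y'' 1 / (2 * (real n)\<^sup>2) - (c * y 1 / 2) / (real n)\<^sup>2 \<le> y (1 - 1 / real n)"
      by (simp add: abs_le_iff)
    also have "y 1 - y' 1 / real n + y'' 1 / (2 * (real n)\<^sup>2) - (c * y 1 / 2) / (real n)\<^sup>2
      = y 1 * (1 + \<alpha> / real n + (\<alpha>\<^sup>2 + c) / 2 / (real n)\<^sup>2)"
      unfolding bdry y2 using n by (simp add: field_simps)
    finally have 1: "y 1 * (1 + \<alpha> / real n + (\<alpha>\<^sup>2 + c) / 2 / (real n)\<^sup>2) \<le> y (1 - 1 / real n)" .
    have "exp (\<alpha> / real n) \<le> 1 + \<alpha> / real n + (\<alpha>\<^sup>2 + c) / 2 / (real n)\<^sup>2"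
    proof -
      have "exp (\<alpha> / real n) - 1 - \<alpha> / real n \<le> (\<alpha>\<^sup>2 + c) / 2 / (real n)\<^sup>2"
        using elim(1) n by (subst pos_le_divide_eq) auto
      then show ?thesis by linarith
    qed
    then have "y 1 * exp (\<alpha> / real n) \<le> y 1 * (1 + \<alpha> / real n + (\<alpha>\<^sup>2 + c) / 2 / (real n)\<^sup>2)"
      using y1 by (intro mult_left_mono) auto
    with 1 have "y 1 * exp (\<alpha> / real n) \<le> y (1 - 1 / real n)" by linarith
    then have "\<rho> n * (y 1 * exp (\<alpha> / real n)) \<le> \<rho> n * y (1 - 1 / real n)"
      using rho_pos[of n] by (intro mult_left_mono) auto
    moreover have "\<rho> n * (y 1 * exp (\<alpha> / real n)) = y 1"
      by (simp add: \<rho>_def exp_minus)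
    ultimately have "1 \<le> \<rho> n * y (1 - 1 / real n) / y 1" using y1 by simp
    then show ?case using s2_pos[OF n(1)] by (simp add: A_last[OF n(1)])
  qed
qed

lemma A_last_tendsto_0: "(\<lambda>n. A n n) \<longlonglongrightarrow> 0"
proof -
  have y1: "0 < y 1" using ypos[of 1] by simp
  have r1: "\<rho> \<longlonglongrightarrow> 1" unfolding \<rho>_def using \<alpha> by real_asymp
  have r2: "(\<lambda>n. real n * (\<rho> n - 1)) \<longlonglongrightarrow> - \<alpha>" unfolding \<rho>_def using \<alpha> by real_asymp
  have "(\<lambda>n. (\<rho> n * (real n * (y (1 - 1 / real n) - y 1)) / y 1 + real n * (\<rho> n - 1)) * (1 / (real n * s2 n)))
     \<longlonglongrightarrow> (1 * (- y' 1) / y 1 + - \<alpha>) * 1"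
    by (intro tendsto_intros r1 r2 lim_difference_quotients lim_s2) (use y1 in auto)
  also have "(1 * (- y' 1) / y 1 + - \<alpha>) * 1 = 0" using y1 by (simp add: bdry)
  finally show ?thesis
  proof (rule Lim_transform_eventually)
    show "eventually (\<lambda>n. (\<rho> n * (real n * (y (1 - 1 / real n) - y 1)) / y 1 + real n * (\<rho> n - 1)) * (1 / (real n * s2 n)) = A n n) sequentially"
      using eventually_gt_at_top[of 0]
    proof eventually_elim
      case (elim n)
      then show ?case using y1 s2_pos[OF elim] by (simp add: A_last[OF elim] field_simps)
    qed
  qed
qed

text \<open>The expression is the factor of the initial state, which has variance
  \<open>1 / (2 * \<alpha>)\<close>, in the base case of \<open>ou_laplace\<close>.\<close>

lemma lim_a_0: "(\<lambda>n. 1 + a n 0 / (2 * \<alpha>)) \<longlonglongrightarrow> (\<alpha> - y' 0 / y 0) / (2 * \<alpha>)"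
proof -
  have y0: "0 < y 0" using ypos[of 0] by simp
  have r1: "\<rho> \<longlonglongrightarrow> 1" unfolding \<rho>_def using \<alpha> by real_asymp
  have r2: "(\<lambda>n. real n * (1 - \<rho> n)) \<longlonglongrightarrow> \<alpha>" unfolding \<rho>_def using \<alpha> by real_asymp
  have r3: "(\<lambda>n. real n * (1 - (\<rho> n)\<^sup>2)) \<longlonglongrightarrow> 2 * \<alpha>" unfolding \<rho>_def using \<alpha> by real_asymp
  have "(\<lambda>n. (real n * (1 - \<rho> n) - \<rho> n * (real n * (y (1 / real n) - y 0)) / y 0) / (real n * (1 - (\<rho> n)\<^sup>2)))
    \<longlonglongrightarrow> (\<alpha> - 1 * y' 0 / y 0) / (2 * \<alpha>)"
    by (intro tendsto_intros r1 r2 r3 lim_difference_quotients) (use y0 \<alpha> in auto)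
  then have "(\<lambda>n. (real n * (1 - \<rho> n) - \<rho> n * (real n * (y (1 / real n) - y 0)) / y 0) / (real n * (1 - (\<rho> n)\<^sup>2)))
    \<longlonglongrightarrow> (\<alpha> - y' 0 / y 0) / (2 * \<alpha>)" by simp
  then show ?thesis
  proof (rule Lim_transform_eventually)
    show "eventually (\<lambda>n. (real n * (1 - \<rho> n) - \<rho> n * (real n * (y (1 / real n) - y 0)) / y 0) / (real n * (1 - (\<rho> n)\<^sup>2))
      = 1 + a n 0 / (2 * \<alpha>)) sequentially"
      using eventually_gt_at_top[of 0]
    proof eventually_elim
      case (elim n)
      have "0 < 1 - (\<rho> n)\<^sup>2" using rho_pos[of n] rho_less[OF elim] by (simp add: power_less_one_iff)
      then show ?case using y0 \<alpha> elim by (simp add: a_def s2_def field_simps power2_eq_square)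
    qed
  qed
qed

lemma weighted_sum_tendsto:
  assumes u: "continuous_on {0..1} u"
  shows "(\<lambda>n. (\<Sum>j<n. w n j * (u (real j / real n))\<^sup>2) + A n n * (u (real n / real n))\<^sup>2)
    \<longlonglongrightarrow> (LBINT t:{0..1}. q t * (u t)\<^sup>2)"
proof -
  have "bounded (u ` {0..1})" by (intro compact_imp_bounded compact_continuous_image u) simp
  then obtain B where "\<forall>x\<in>u ` {0..1}. \<bar>x\<bar> \<le> B" unfolding bounded_real by blast
  then have uB: "(u x)\<^sup>2 \<le> B\<^sup>2 + 1" if "x \<in> {0..1}" for x
    using that power_mono[of "\<bar>u x\<bar>" B 2] by (auto intro: add_increasing2)
  define D where "D = B\<^sup>2 + 1"
  have D: "0 < D" by (simp add: D_def add_nonneg_pos)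
  have 1: "(\<lambda>n. (\<Sum>j<n. q (real j / real n) * (u (real j / real n))\<^sup>2) / real n) \<longlonglongrightarrow> (LBINT t:{0..1}. q t * (u t)\<^sup>2)"
    by (rule riemann_sum_tendsto) (intro continuous_intros continuous_q u)
  have 2: "(\<lambda>n. (\<Sum>j<n. w n j * (u (real j / real n))\<^sup>2) - (\<Sum>j<n. q (real j / real n) * (u (real j / real n))\<^sup>2) / real n) \<longlonglongrightarrow> 0"
  proof (rule LIMSEQ_I)
    fix r :: real assume r: "0 < r"
    define \<epsilon> where "\<epsilon> = r / (4 * D)"
    have \<epsilon>: "0 < \<epsilon>" using r D by (simp add: \<epsilon>_def)
    have "(\<lambda>n. q 0 * (u 0)\<^sup>2 * (1 / real n)) \<longlonglongrightarrow> 0" using tendsto_mult_right_zero[OF lim_1_over_n] by blast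
    then have "eventually (\<lambda>n. \<bar>q 0 * (u 0)\<^sup>2 * (1 / real n)\<bar> < r / 2) sequentially"
      using r by (intro order_tendstoD(2)[OF tendsto_rabs_zero]) auto
    then have "eventually (\<lambda>n. norm ((\<Sum>j<n. w n j * (u (real j / real n))\<^sup>2) - (\<Sum>j<n. q (real j / real n) * (u (real j / real n))\<^sup>2) / real n - 0) < r) sequentially"
      using w_uniform[OF \<epsilon>] eventually_gt_at_top[of 0]
    proof eventually_elim
      case (elim n)
      then have n: "0 < real n" by simp
      \<comment> \<open>Index 0 carries weight 0 in \<open>w n\<close>, whereas the Riemann sum has
        the summand \<open>q 0 * (u 0)\<^sup>2 / n\<close> there; this single term gets its own
        allowance \<open>r / 2\<close>.\<close>
      have b: "\<bar>w n j * (u (real j / real n))\<^sup>2 - q (real j / real n) * (u (real j / real n))\<^sup>2 / real n\<bar> \<le> (if j = 0 then r / 2 else 0) + \<epsilon> * D / real n"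
        if j: "j < n" for j
      proof (cases "j = 0")
        case True
        then show ?thesis using elim(1) \<epsilon> D n by (simp add: w_def add_increasing2)
      next
        case False
        have "w n j * (u (real j / real n))\<^sup>2 - q (real j / real n) * (u (real j / real n))\<^sup>2 / real n = (real n * w n j - q (real j / real n)) * (u (real j / real n))\<^sup>2 / real n"
          using n by (simp add: field_simps)
        also have "\<bar>\<dots>\<bar> = \<bar>real n * w n j - q (real j / real n)\<bar> * (u (real j / real n))\<^sup>2 / real n"
          using n by (simp add: abs_mult)
        also have "\<dots> \<le> \<epsilon> * D / real n"
          using elim(2) False j n uB[of "real j / real n"] \<epsilon> unfolding D_def
          by (intro divide_right_mono mult_mono) auto
        finally show ?thesis using False by simp
      qed
      have "(\<Sum>j<n. w n j * (u (real j / real n))\<^sup>2) - (\<Sum>j<n. q (real j / real n) * (u (real j / real n))\<^sup>2) / real n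
        = (\<Sum>j<n. w n j * (u (real j / real n))\<^sup>2 - q (real j / real n) * (u (real j / real n))\<^sup>2 / real n)"
        by (simp add: sum_subtractf sum_divide_distrib)
      also have "norm \<dots> \<le> (\<Sum>j<n. (if j = 0 then r / 2 else 0) + \<epsilon> * D / real n)"
        using b by (intro sum_norm_le) auto
      also have "\<dots> = r / 2 + \<epsilon> * D" using elim(3) by (simp add: sum.distrib)
      also have "\<dots> < r" using r D by (simp add: \<epsilon>_def)
      finally show ?case by simp
    qed
    then show "\<exists>no. \<forall>n\<ge>no. norm ((\<Sum>j<n. w n j * (u (real j / real n))\<^sup>2) - (\<Sum>j<n. q (real j / real n) * (u (real j / real n))\<^sup>2) / real n - 0) < r"
      by (simp only: eventually_sequentially)
  qed
  have 3: "(\<lambda>n. A n n * (u 1)\<^sup>2) \<longlonglongrightarrow> 0 * (u 1)\<^sup>2" by (intro tendsto_intros A_last_tendsto_0)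
  have "(\<lambda>n. ((\<Sum>j<n. w n j * (u (real j / real n))\<^sup>2) - (\<Sum>j<n. q (real j / real n) * (u (real j / real n))\<^sup>2) / real n) + (\<Sum>j<n. q (real j / real n) * (u (real j / real n))\<^sup>2) / real n + A n n * (u 1)\<^sup>2)
    \<longlonglongrightarrow> 0 + (LBINT t:{0..1}. q t * (u t)\<^sup>2) + 0 * (u 1)\<^sup>2"
    by (intro tendsto_add 1 2 3)
  then have "(\<lambda>n. (\<Sum>j<n. w n j * (u (real j / real n))\<^sup>2) + A n n * (u 1)\<^sup>2) \<longlonglongrightarrow> (LBINT t:{0..1}. q t * (u t)\<^sup>2)" by simp
  then show ?thesis
  proof (rule Lim_transform_eventually)
    show "eventually (\<lambda>n. (\<Sum>j<n. w n j * (u (real j / real n))\<^sup>2) + A n n * (u 1)\<^sup>2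
      = (\<Sum>j<n. w n j * (u (real j / real n))\<^sup>2) + A n n * (u (real n / real n))\<^sup>2) sequentially"
      using eventually_gt_at_top[of 0] by eventually_elim simp
  qed
qed

end

section \<open>Quadratic functionals of the Ornstein--Uhlenbeck process\<close>

lemma stationary_OU_D:
  assumes M: "prob_space M" and U: "stationary_OU_process M \<alpha> U" and t: "t \<in> {0..1}"
  shows "gaussian_rv M (U t)" "U t \<in> borel_measurable M" "integrable M (U t)" "integrable M (\<lambda>\<omega>. (U t \<omega>)\<^sup>2)"
proof -
  have "gaussian_process M {0..1} U" using U by (simp add: stationary_OU_process_def)
  from this[unfolded gaussian_process_def, rule_format, of "{t}" "\<lambda>_. 1"]
  have "gaussian_rv M (\<lambda>\<omega>. \<Sum>s\<in>{t}. 1 * U s \<omega>)" using t by simp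
  then show g: "gaussian_rv M (U t)" by simp
  then show "U t \<in> borel_measurable M" by (simp add: gaussian_rv_def)
  show "integrable M (U t)" "integrable M (\<lambda>\<omega>. (U t \<omega>)\<^sup>2)"
    using gaussian_rv_moments(1,2)[OF M g] by auto
qed

text \<open>For ordered times the exponential covariance is multiplicative, which is the Markov
  relation. Truncating the index to \<open>min j n\<close> keeps all times in the unit interval,
  where measurability is known.\<close>

lemma OU_autoregression:
  assumes M: "prob_space M" and \<alpha>: "0 < \<alpha>" and U: "stationary_OU_process M \<alpha> U" and n: "0 < n"
  shows "gaussian_autoregression M (\<lambda>j. U (real (min j n) / real n)) n (exp (- \<alpha> / real n))
    (sqrt ((1 - (exp (- \<alpha> / real n))\<^sup>2) / (2 * \<alpha>))) (1 / sqrt (2 * \<alpha>))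
    (\<lambda>i j. exp (- \<alpha> * \<bar>real i / real n - real j / real n\<bar>) / (2 * \<alpha>))"
proof -
  interpret prob_space M by (rule M)
  define V where "V j = U (real (min j n) / real n)" for j
  define \<Gamma> where "\<Gamma> i j = exp (- \<alpha> * \<bar>real i / real n - real j / real n\<bar>) / (2 * \<alpha>)" for i j
  have t01: "real (min j n) / real n \<in> {0..1}" for j using n by auto
  note UD = stationary_OU_D[OF M U]
  have Vm[measurable]: "V j \<in> borel_measurable M" for j unfolding V_def by (rule UD(2)[OF t01])
  have Vint: "integrable M (V j)" "integrable M (\<lambda>\<omega>. (V j \<omega>)\<^sup>2)" for j
    unfolding V_def by (rule UD(3)[OF t01] UD(4)[OF t01])+
  have V0: "(\<integral>\<omega>. V j \<omega> \<partial>M) = 0" for j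
    using U t01[of j] unfolding stationary_OU_process_def V_def by blast
  have VV: "(\<integral>\<omega>. V i \<omega> * V j \<omega> \<partial>M) = \<Gamma> i j" if "i \<le> n" "j \<le> n" for i j
  proof -
    have "(\<integral>\<omega>. U t \<omega> * U s \<omega> \<partial>M) = exp (- \<alpha> * \<bar>t - s\<bar>) / (2 * \<alpha>)" if "t \<in> {0..1}" "s \<in> {0..1}" for t s
      using U that unfolding stationary_OU_process_def by blast
    from this[OF t01[of i] t01[of j]] show ?thesis using that by (simp add: V_def \<Gamma>_def min_absorb1)
  qed
  have VVint: "integrable M (\<lambda>\<omega>. V i \<omega> * V j \<omega>)" for i j
  proof (rule Bochner_Integration.integrable_bound)
    show "integrable M (\<lambda>\<omega>. (V i \<omega>)\<^sup>2 + (V j \<omega>)\<^sup>2)" using Vint by simp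
    show "AE \<omega> in M. norm (V i \<omega> * V j \<omega>) \<le> norm ((V i \<omega>)\<^sup>2 + (V j \<omega>)\<^sup>2)"
    proof (intro AE_I2)
      fix \<omega>
      have "2 * (\<bar>V i \<omega>\<bar> * \<bar>V j \<omega>\<bar>) \<le> (V i \<omega>)\<^sup>2 + (V j \<omega>)\<^sup>2"
        using sum_squares_bound[of "\<bar>V i \<omega>\<bar>" "\<bar>V j \<omega>\<bar>"] by (simp add: mult.assoc)
      moreover have "0 \<le> \<bar>V i \<omega>\<bar> * \<bar>V j \<omega>\<bar>" by simp
      ultimately show "norm (V i \<omega> * V j \<omega>) \<le> norm ((V i \<omega>)\<^sup>2 + (V j \<omega>)\<^sup>2)"
        unfolding real_norm_def abs_mult by linarith
    qed
  qed simp
  have ch: "(\<integral>\<omega>. iexp (\<Sum>j\<le>n. c j * V j \<omega>) \<partial>M) = of_real (exp (- (\<Sum>i\<le>n. \<Sum>j\<le>n. c i * c j * \<Gamma> i j) / 2))" for c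
  proof -
    define f where "f j = real j / real n" for j
    have inj: "inj_on f {..n}" using n by (auto simp: inj_on_def f_def)
    \<comment> \<open>Gaussianity of the process speaks about sums over sets of times, so the sum
      over indices is transported along the injection \<open>f\<close>.\<close>
    have "gaussian_rv M (\<lambda>\<omega>. \<Sum>t\<in>f ` {..n}. c (the_inv_into {..n} f t) * U t \<omega>)"
    proof -
      have "finite (f ` {..n})" "f ` {..n} \<subseteq> {0..1}" using n by (auto simp: f_def)
      moreover have "gaussian_process M {0..1} U" using U by (simp add: stationary_OU_process_def)
      ultimately show ?thesis unfolding gaussian_process_def by simp
    qed
    also have "(\<lambda>\<omega>. \<Sum>t\<in>f ` {..n}. c (the_inv_into {..n} f t) * U t \<omega>) = (\<lambda>\<omega>. \<Sum>j\<le>n. c j * V j \<omega>)"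
    proof
      fix \<omega>
      have "V j = U (f j)" if "j \<le> n" for j using that by (simp add: V_def f_def min_absorb1)
      then show "(\<Sum>t\<in>f ` {..n}. c (the_inv_into {..n} f t) * U t \<omega>) = (\<Sum>j\<le>n. c j * V j \<omega>)"
        by (subst sum.reindex[OF inj]) (auto simp: the_inv_into_f_f[OF inj] intro!: sum.cong)
    qed
    finally have g: "gaussian_rv M (\<lambda>\<omega>. \<Sum>j\<le>n. c j * V j \<omega>)" .
    have "(\<integral>\<omega>. (\<Sum>j\<le>n. c j * V j \<omega>) \<partial>M) = 0"
      by (subst Bochner_Integration.integral_sum) (auto simp: Vint V0)
    from gaussian_rv_moments(3)[OF M g this]
    have "(\<integral>\<omega>. iexp (\<Sum>j\<le>n. c j * V j \<omega>) \<partial>M) = of_real (exp (- (\<integral>\<omega>. (\<Sum>j\<le>n. c j * V j \<omega>)\<^sup>2 \<partial>M) / 2))" .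
    also have "(\<integral>\<omega>. (\<Sum>j\<le>n. c j * V j \<omega>)\<^sup>2 \<partial>M) = (\<integral>\<omega>. (\<Sum>i\<le>n. \<Sum>j\<le>n. c i * c j * (V i \<omega> * V j \<omega>)) \<partial>M)"
      by (simp add: power2_eq_square sum_product mult_ac)
    also have "\<dots> = (\<Sum>i\<le>n. \<Sum>j\<le>n. c i * c j * \<Gamma> i j)"
      by (simp add: Bochner_Integration.integral_sum VVint VV)
    finally show ?thesis .
  qed
  have "gaussian_autoregression M V n (exp (- \<alpha> / real n)) (sqrt ((1 - (exp (- \<alpha> / real n))\<^sup>2) / (2 * \<alpha>))) (1 / sqrt (2 * \<alpha>)) \<Gamma>"
  proof unfold_locales
    show "V j \<in> borel_measurable M" for j by (rule Vm)
    show "(\<integral>\<omega>. iexp (\<Sum>j\<le>n. c j * V j \<omega>) \<partial>M) = of_real (exp (- (\<Sum>i\<le>n. \<Sum>j\<le>n. c i * c j * \<Gamma> i j) / 2))" for c by (rule ch)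
    show "\<Gamma> i j = \<Gamma> j i" for i j by (simp add: \<Gamma>_def abs_minus_commute)
    show "\<Gamma> i i = (1 / sqrt (2 * \<alpha>))\<^sup>2" for i using \<alpha> by (simp add: \<Gamma>_def power_divide)
    show "\<Gamma> j (Suc k) = exp (- \<alpha> / real n) * \<Gamma> j k" if "j \<le> k" "Suc k \<le> n" for j k
    proof -
      have 1: "\<bar>real j / real n - real (Suc k) / real n\<bar> = 1 / real n + \<bar>real j / real n - real k / real n\<bar>"
        using that n by (simp add: abs_if divide_right_mono not_less field_simps)
      have "- \<alpha> * \<bar>real j / real n - real (Suc k) / real n\<bar> = - \<alpha> / real n + - \<alpha> * \<bar>real j / real n - real k / real n\<bar>"
        unfolding 1 by (simp add: distrib_left)
      then show ?thesis unfolding \<Gamma>_def by (simp only: exp_add times_divide_eq_right)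
    qed
    show "0 < 1 / sqrt (2 * \<alpha>)" using \<alpha> by simp
    have "(exp (- \<alpha> / real n))\<^sup>2 \<le> 1" using \<alpha> by (simp add: power_le_one_iff)
    then show "(sqrt ((1 - (exp (- \<alpha> / real n))\<^sup>2) / (2 * \<alpha>)))\<^sup>2 + (exp (- \<alpha> / real n))\<^sup>2 * (1 / sqrt (2 * \<alpha>))\<^sup>2 = (1 / sqrt (2 * \<alpha>))\<^sup>2"
      using \<alpha> by (simp add: power_divide field_simps)
  qed
  then show ?thesis unfolding V_def \<Gamma>_def .
qed

lemma OU_laplace_eq_ou_laplace:
  assumes "prob_space M" and "0 < \<alpha>" and "stationary_OU_process M \<alpha> U" and n: "0 < n"
    and "\<And>j. 0 \<le> w j" and "0 \<le> A"
  shows "(\<integral>\<omega>. exp (- ((\<Sum>j<n. w j * (U (real j / real n) \<omega>)\<^sup>2) + A * (U (real n / real n) \<omega>)\<^sup>2) / 2) \<partial>M)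
    = ou_laplace (exp (- \<alpha> / real n)) (sqrt ((1 - (exp (- \<alpha> / real n))\<^sup>2) / (2 * \<alpha>))) (1 / sqrt (2 * \<alpha>)) w n A"
proof -
  interpret gaussian_autoregression M "\<lambda>j. U (real (min j n) / real n)" n "exp (- \<alpha> / real n)"
    "sqrt ((1 - (exp (- \<alpha> / real n))\<^sup>2) / (2 * \<alpha>))" "1 / sqrt (2 * \<alpha>)"
    "\<lambda>i j. exp (- \<alpha> * \<bar>real i / real n - real j / real n\<bar>) / (2 * \<alpha>)"
    by (rule OU_autoregression) (use assms in auto)
  have "(\<Sum>j<n. w j * (U (real (min j n) / real n) \<omega>)\<^sup>2) = (\<Sum>j<n. w j * (U (real j / real n) \<omega>)\<^sup>2)" for \<omega>
    by (intro sum.cong) auto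
  then show ?thesis using laplace_eq_ou_laplace[of w n A] assms by simp
qed

abbreviation energy :: "(real \<Rightarrow> real) \<Rightarrow> (real \<Rightarrow> 'a \<Rightarrow> real) \<Rightarrow> 'a \<Rightarrow> real" where
  "energy f U \<omega> \<equiv> LBINT t:{0..1}. f t * (U t \<omega>)\<^sup>2"

text \<open>Riemann sums converge along every path, since every path is continuous. As limits of
  finite sums they also give measurability of the energy without joint measurability of
  \<open>U\<close> in time and chance.\<close>

lemma OU_weighted_integral:
  assumes M: "prob_space M" and U: "stationary_OU_process M \<alpha> U" and f: "continuous_on {0..1} f"
  shows "\<omega> \<in> space M \<Longrightarrow> (\<lambda>n. \<Sum>j<n. f (real j / real n) / real n * (U (real j / real n) \<omega>)\<^sup>2) \<longlonglongrightarrow> energy f U \<omega>"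
    and "(\<lambda>\<omega>. energy f U \<omega>) \<in> borel_measurable M"
proof -
  show *: "(\<lambda>n. \<Sum>j<n. f (real j / real n) / real n * (U (real j / real n) \<omega>)\<^sup>2) \<longlonglongrightarrow> energy f U \<omega>"
    if "\<omega> \<in> space M" for \<omega>
  proof -
    have "continuous_on {0..1} (\<lambda>t. U t \<omega>)" using U that by (simp add: stationary_OU_process_def)
    then have "continuous_on {0..1} (\<lambda>t. f t * (U t \<omega>)\<^sup>2)" using f by (intro continuous_intros)
    from riemann_sum_tendsto[OF this] show ?thesis by (simp add: sum_divide_distrib)
  qed
  have m: "(\<lambda>\<omega>. \<Sum>j<n. f (real j / real n) / real n * (U (real j / real n) \<omega>)\<^sup>2) \<in> borel_measurable M" for n
  proof (intro borel_measurable_sum borel_measurable_times borel_measurable_power borel_measurable_const)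
    fix j assume "j \<in> {..<n}"
    then show "U (real j / real n) \<in> borel_measurable M" by (intro stationary_OU_D(2)[OF M U]) auto
  qed
  show "(\<lambda>\<omega>. energy f U \<omega>) \<in> borel_measurable M"
    by (rule borel_measurable_LIMSEQ_real[OF * m])
qed

lemma OU_exp_sum_tendsto:
  assumes M: "prob_space M" and U: "stationary_OU_process M \<alpha> U" and f: "continuous_on {0..1} f"
    and w: "\<And>n j. 0 < n \<Longrightarrow> 0 \<le> w n j" and A: "\<And>n. 0 < n \<Longrightarrow> 0 \<le> A n"
    and lim: "\<And>\<omega>. \<omega> \<in> space M \<Longrightarrow> (\<lambda>n. (\<Sum>j<n. w n j * (U (real j / real n) \<omega>)\<^sup>2) + A n * (U (real n / real n) \<omega>)\<^sup>2)
      \<longlonglongrightarrow> energy f U \<omega>"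
  shows "(\<lambda>n. \<integral>\<omega>. exp (- ((\<Sum>j<n. w n j * (U (real j / real n) \<omega>)\<^sup>2) + A n * (U (real n / real n) \<omega>)\<^sup>2) / 2) \<partial>M)
    \<longlonglongrightarrow> (\<integral>\<omega>. exp (- energy f U \<omega> / 2) \<partial>M)"
proof -
  interpret prob_space M by (rule M)
  define S where "S n \<omega> = (\<Sum>j<n. w n j * (U (real j / real n) \<omega>)\<^sup>2) + A n * (U (real n / real n) \<omega>)\<^sup>2" for n \<omega>
  have Sm[measurable]: "S n \<in> borel_measurable M" for n
    unfolding S_def
  proof (intro borel_measurable_add borel_measurable_sum borel_measurable_times borel_measurable_power borel_measurable_const)
    show "U (real n / real n) \<in> borel_measurable M" by (rule stationary_OU_D(2)[OF M U]) auto
    fix j assume "j \<in> {..<n}"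
    then show "U (real j / real n) \<in> borel_measurable M" by (intro stationary_OU_D(2)[OF M U]) auto
  qed
  have [measurable]: "(\<lambda>\<omega>. energy f U \<omega>) \<in> borel_measurable M"
    by (rule OU_weighted_integral(2)[OF M U f])
  have Sn: "0 \<le> S (Suc n) \<omega>" for n \<omega>
    unfolding S_def by (intro add_nonneg_nonneg sum_nonneg mult_nonneg_nonneg w A) auto
  \<comment> \<open>Signs of the weights are assumed for positive \<open>n\<close> only, hence the
    shifted index; the constant 1 then dominates.\<close>
  have "(\<lambda>n. \<integral>\<omega>. exp (- S (Suc n) \<omega> / 2) \<partial>M) \<longlonglongrightarrow> (\<integral>\<omega>. exp (- energy f U \<omega> / 2) \<partial>M)"
  proof (rule integral_dominated_convergence[where w="\<lambda>_. 1"])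
    show "AE \<omega> in M. (\<lambda>n. exp (- S (Suc n) \<omega> / 2)) \<longlonglongrightarrow> exp (- energy f U \<omega> / 2)"
    proof (intro AE_I2)
      fix \<omega> assume "\<omega> \<in> space M"
      from LIMSEQ_Suc[OF lim[OF this]]
      have "(\<lambda>n. S (Suc n) \<omega>) \<longlonglongrightarrow> energy f U \<omega>" by (simp only: S_def)
      then show "(\<lambda>n. exp (- S (Suc n) \<omega> / 2)) \<longlonglongrightarrow> exp (- energy f U \<omega> / 2)"
        by (intro tendsto_intros) auto
    qed
  qed (use Sn in auto)
  then have "(\<lambda>n. \<integral>\<omega>. exp (- S n \<omega> / 2) \<partial>M) \<longlonglongrightarrow> (\<integral>\<omega>. exp (- energy f U \<omega> / 2) \<partial>M)"
    by (rule LIMSEQ_imp_Suc)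
  then show ?thesis by (simp only: S_def)
qed

section \<open>Closed form of the exponential functional\<close>

context ou_weights
begin

lemma y_grid_pos: "j \<le> n \<Longrightarrow> 0 < n \<Longrightarrow> 0 < y (real j / real n)"
  by (rule ypos) auto

text \<open>Each elimination contributes \<open>1 / sqrt (1 + A * s2)\<close>, the root of a
  quotient of neighbouring values of \<open>y\<close> divided by \<open>\<rho> n\<close>, so the
  product telescopes. Since the weight plus the amount passed on is again \<open>A n k\<close>, the
  recursion stays on the prescribed sequence; at index 0 there is no weight and \<open>a n 0\<close>
  remains.\<close>

lemma ou_laplace_exact:
  assumes n: "0 < n" and k: "k \<le> n"
  shows "ou_laplace (\<rho> n) (sqrt (s2 n)) (1 / sqrt (2 * \<alpha>)) (w n) k (if k = 0 then a n 0 else A n k)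
    = sqrt (y (real k / real n) / ((\<rho> n) ^ k * y 0)) / sqrt (1 + a n 0 / (2 * \<alpha>))"
  using k
proof (induction k)
  case 0
  have "0 < y 0" using ypos[of 0] by simp
  then show ?case using \<alpha> by (simp add: power_divide)
next
  case (Suc k)
  define yk where "yk = y (real k / real n)"
  define yk1 where "yk1 = y (real (Suc k) / real n)"
  define r where "r = \<rho> n * yk / yk1"
  have pos: "0 < yk" "0 < yk1" "0 < y 0"
    using Suc.prems n y_grid_pos[of k n, folded yk_def] y_grid_pos[of "Suc k" n, folded yk1_def] ypos[of 0] by auto
  have s: "0 < s2 n" by (rule s2_pos[OF n])
  have \<rho>: "0 < \<rho> n" by (rule rho_pos)
  have r: "0 < r" using pos \<rho> by (simp add: r_def)
  have A: "A n (Suc k) = (r - 1) / s2 n" by (simp add: A_def r_def yk_def yk1_def)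
  have 1: "1 + A n (Suc k) * (sqrt (s2 n))\<^sup>2 = r" using s by (simp add: A)
  have "(\<rho> n)\<^sup>2 * A n (Suc k) / r = a n k"
  proof -
    have "a n k = ((\<rho> n)\<^sup>2 - (\<rho> n)\<^sup>2 / r) / s2 n"
      unfolding a_def yk_def[symmetric] yk1_def[symmetric]
      using pos \<rho> by (simp add: r_def power2_eq_square)
    also have "\<dots> = (\<rho> n)\<^sup>2 * A n (Suc k) / r" using r s by (simp add: A field_simps)
    finally show ?thesis by simp
  qed
  then have 2: "w n k + (\<rho> n)\<^sup>2 * A n (Suc k) / r = (if k = 0 then a n 0 else A n k)"
    using Suc.prems by (simp add: w_def)
  have "ou_laplace (\<rho> n) (sqrt (s2 n)) (1 / sqrt (2 * \<alpha>)) (w n) (Suc k) (A n (Suc k))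
    = 1 / sqrt r * (sqrt (yk / ((\<rho> n) ^ k * y 0)) / sqrt (1 + a n 0 / (2 * \<alpha>)))"
    unfolding ou_laplace.simps 1 2 yk_def using Suc by simp
  also have "\<dots> = sqrt (1 / r * (yk / ((\<rho> n) ^ k * y 0))) / sqrt (1 + a n 0 / (2 * \<alpha>))"
    by (simp add: real_sqrt_divide real_sqrt_mult)
  also have "1 / r * (yk / ((\<rho> n) ^ k * y 0)) = yk1 / ((\<rho> n) ^ Suc k * y 0)"
    using pos \<rho> by (simp add: r_def)
  finally show ?case by (simp add: yk1_def)
qed

text \<open>\<open>y'' = (q + \<alpha>\<^sup>2) * y\<close> is positive, so the slope increases, and
  at 1 it is still negative. This keeps the denominator of the final formula positive.\<close>

lemma derivative_neg_at_0: "y' 0 < 0"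
proof -
  obtain \<xi> where \<xi>: "\<xi> \<in> {0..1}" "y' 1 - y' 0 = y'' \<xi> * (1 - 0)"
    using mvt_within_unit_interval[of y' y'' 0 1, OF y'] by auto
  have "y'' \<xi> = (q \<xi> + \<alpha>\<^sup>2) * y \<xi>" using q[OF \<xi>(1)] ypos[OF \<xi>(1)] by simp
  also have "\<dots> > 0" using qpos[OF \<xi>(1)] ypos[OF \<xi>(1)] by (simp add: add_pos_nonneg)
  finally have "y' 0 < y' 1" using \<xi>(2) by simp
  also have "y' 1 < 0" using bdry \<alpha> ypos[of 1] by simp
  finally show ?thesis .
qed

text \<open>The exact discrete value has two limits: on the probabilistic side the weighted sums
  converge to the energy, on the analytic side \<open>(\<rho> n) ^ n = exp (- \<alpha>)\<close> and
  only \<open>a n 0\<close> still depends on \<open>n\<close>.\<close>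

theorem OU_exp_functional:
  assumes M: "prob_space M" and U: "stationary_OU_process M \<alpha> U"
  shows "(\<integral>\<omega>. exp (- energy q U \<omega> / 2) \<partial>M) = sqrt (2 * \<alpha> * exp \<alpha> * y 1 / (\<alpha> * y 0 - y' 0))"
proof -
  \<comment> \<open>Accuracy equal to the minimum of \<open>q\<close> is just what makes the weights
    nonnegative.\<close>
  obtain q0 where q0: "q0 \<in> {0..1}" "\<And>x. x \<in> {0..1} \<Longrightarrow> q q0 \<le> q x"
    using continuous_attains_inf[OF _ _ continuous_q] by auto
  have "0 < q q0" by (rule qpos[OF q0(1)])
  from w_uniform[OF this] A_last_nonneg
  have "eventually (\<lambda>n. (\<forall>j. 0 \<le> w n j) \<and> 0 \<le> A n n) sequentially"
  proof eventually_elim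
    case (elim n)
    have "0 \<le> w n j" for j
    proof (cases "0 < j \<and> j < n")
      case True
      then have "real j / real n \<in> {0..1}" "0 < real n" by auto
      have "\<bar>real n * w n j - q (real j / real n)\<bar> \<le> q q0" using elim(1) True by blast
      then have "0 \<le> real n * w n j" using q0(2)[OF \<open>real j / real n \<in> {0..1}\<close>] by linarith
      then show ?thesis using \<open>0 < real n\<close> by (simp add: zero_le_mult_iff)
    qed (auto simp: w_def)
    then show ?case using elim(2) by blast
  qed
  then obtain n0 where n0: "\<And>n. n \<ge> n0 \<Longrightarrow> (\<forall>j. 0 \<le> w n j) \<and> 0 \<le> A n n" by (auto simp: eventually_sequentially)
  \<comment> \<open>Nonnegativity holds only from \<open>n0\<close> on; replacing the earlier
    weights by 0 meets the sign conditions for all \<open>n\<close> and leaves the limit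
    unchanged.\<close>
  define w' where "w' n j = (if n \<ge> n0 then w n j else 0)" for n j
  define A' where "A' n = (if n \<ge> n0 then A n n else 0)" for n
  have lim: "(\<lambda>n. \<integral>\<omega>. exp (- ((\<Sum>j<n. w' n j * (U (real j / real n) \<omega>)\<^sup>2) + A' n * (U (real n / real n) \<omega>)\<^sup>2) / 2) \<partial>M)
    \<longlonglongrightarrow> (\<integral>\<omega>. exp (- energy q U \<omega> / 2) \<partial>M)"
  proof (rule OU_exp_sum_tendsto[OF M U continuous_q])
    fix \<omega> assume "\<omega> \<in> space M"
    then have "continuous_on {0..1} (\<lambda>t. U t \<omega>)" using U by (simp add: stationary_OU_process_def)
    from weighted_sum_tendsto[OF this]
    show "(\<lambda>n. (\<Sum>j<n. w' n j * (U (real j / real n) \<omega>)\<^sup>2) + A' n * (U (real n / real n) \<omega>)\<^sup>2) \<longlonglongrightarrow> energy q U \<omega>"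
    proof (rule Lim_transform_eventually)
      show "eventually (\<lambda>n. (\<Sum>j<n. w n j * (U (real j / real n) \<omega>)\<^sup>2) + A n n * (U (real n / real n) \<omega>)\<^sup>2
        = (\<Sum>j<n. w' n j * (U (real j / real n) \<omega>)\<^sup>2) + A' n * (U (real n / real n) \<omega>)\<^sup>2) sequentially"
        using eventually_ge_at_top[of n0] by eventually_elim (simp add: w'_def A'_def)
    qed
  qed (use n0 in \<open>auto simp: w'_def A'_def\<close>)
  have y0: "0 < y 0" and y1: "0 < y 1" using ypos[of 0] ypos[of 1] by auto
  have "y' 0 / y 0 < 0" using derivative_neg_at_0 y0 by (rule divide_neg_pos)
  then have "(\<alpha> - y' 0 / y 0) / (2 * \<alpha>) > 0"
    using \<alpha> by (intro divide_pos_pos) auto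
  then have "(\<lambda>n. sqrt (y 1 / (exp (- \<alpha>) * y 0)) / sqrt (1 + a n 0 / (2 * \<alpha>))) \<longlonglongrightarrow> sqrt (y 1 / (exp (- \<alpha>) * y 0)) / sqrt ((\<alpha> - y' 0 / y 0) / (2 * \<alpha>))"
    by (intro tendsto_intros lim_a_0) auto
  moreover have "eventually (\<lambda>n. sqrt (y 1 / (exp (- \<alpha>) * y 0)) / sqrt (1 + a n 0 / (2 * \<alpha>)) =
    (\<integral>\<omega>. exp (- ((\<Sum>j<n. w' n j * (U (real j / real n) \<omega>)\<^sup>2) + A' n * (U (real n / real n) \<omega>)\<^sup>2) / 2) \<partial>M)) sequentially"
    using eventually_ge_at_top[of n0] eventually_gt_at_top[of 0]
  proof eventually_elim
    case (elim n)
    have w': "w' n = w n" "A' n = A n n" using elim by (auto simp: w'_def A'_def)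
    have "(\<rho> n) ^ n = exp (- \<alpha>)" using elim by (simp add: \<rho>_def flip: exp_of_nat_mult)
    then have "sqrt (y 1 / (exp (- \<alpha>) * y 0)) / sqrt (1 + a n 0 / (2 * \<alpha>)) = ou_laplace (\<rho> n) (sqrt (s2 n)) (1 / sqrt (2 * \<alpha>)) (w n) n (A n n)"
      using ou_laplace_exact[of n n] elim by simp
    also have "\<dots> = (\<integral>\<omega>. exp (- ((\<Sum>j<n. w n j * (U (real j / real n) \<omega>)\<^sup>2) + A n n * (U (real n / real n) \<omega>)\<^sup>2) / 2) \<partial>M)"
      unfolding \<rho>_def s2_def by (rule OU_laplace_eq_ou_laplace[OF M \<alpha> U, symmetric]) (use elim n0 in auto)
    finally show ?case by (simp only: w')
  qed
  ultimately have "(\<lambda>n. \<integral>\<omega>. exp (- ((\<Sum>j<n. w' n j * (U (real j / real n) \<omega>)\<^sup>2) + A' n * (U (real n / real n) \<omega>)\<^sup>2) / 2) \<partial>M)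
    \<longlonglongrightarrow> sqrt (y 1 / (exp (- \<alpha>) * y 0)) / sqrt ((\<alpha> - y' 0 / y 0) / (2 * \<alpha>))"
    by (rule Lim_transform_eventually)
  from LIMSEQ_unique[OF lim this]
  have "(\<integral>\<omega>. exp (- energy q U \<omega> / 2) \<partial>M) = sqrt (y 1 / (exp (- \<alpha>) * y 0) / ((\<alpha> - y' 0 / y 0) / (2 * \<alpha>)))"
    by (simp only: real_sqrt_divide)
  also have "y 1 / (exp (- \<alpha>) * y 0) / ((\<alpha> - y' 0 / y 0) / (2 * \<alpha>)) = 2 * \<alpha> * exp \<alpha> * y 1 / (\<alpha> * y 0 - y' 0)"
  proof -
    have "y 0 * (\<alpha> - y' 0 / y 0) = \<alpha> * y 0 - y' 0" using y0 by (simp add: algebra_simps)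
    then show ?thesis by (simp add: exp_minus field_simps)
  qed
  finally show ?thesis .
qed

end

section \<open>The Liouville--Green solution\<close>

text \<open>\<open>sqrt s - sqrt (s + \<kappa>)\<close> tends to 0, so a bounded change of
  \<open>s\<close> affects not even the constant. This is why a weight known up to a bounded error
  still yields sharp asymptotics.\<close>

lemma tendsto_wkb_shift:
  fixes G :: "real \<Rightarrow> real" and a :: real
  assumes G: "((\<lambda>s. G s * s powr (1/4) * exp (a * sqrt s)) \<longlongrightarrow> C) at_top"
  shows "((\<lambda>s. G (s + \<kappa>) * s powr (1/4) * exp (a * sqrt s)) \<longlongrightarrow> C) at_top"
proof -
  have inf: "filterlim (\<lambda>s. s + \<kappa>) at_top at_top" for \<kappa> :: real
    using filterlim_tendsto_add_at_top[OF tendsto_const filterlim_ident, of \<kappa>] by (simp add: add.commute)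
  have 1: "((\<lambda>s. (s / (s + \<kappa>)) powr (1/4)) \<longlongrightarrow> 1) at_top"
    by real_asymp
  have 2: "((\<lambda>s. sqrt s - sqrt (s + \<kappa>)) \<longlongrightarrow> 0) at_top"
    by real_asymp
  have "((\<lambda>s. (G (s + \<kappa>) * (s + \<kappa>) powr (1/4) * exp (a * sqrt (s + \<kappa>))) * (s / (s + \<kappa>)) powr (1/4) * exp (a * (sqrt s - sqrt (s + \<kappa>)))) \<longlongrightarrow> C * 1 * exp (a * 0)) at_top"
    by (intro tendsto_mult filterlim_compose[OF G inf] 1 tendsto_exp tendsto_const 2)
  then have "((\<lambda>s. (G (s + \<kappa>) * (s + \<kappa>) powr (1/4) * exp (a * sqrt (s + \<kappa>))) * (s / (s + \<kappa>)) powr (1/4) * exp (a * (sqrt s - sqrt (s + \<kappa>)))) \<longlongrightarrow> C) at_top" by simp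
  moreover have "eventually (\<lambda>s. (G (s + \<kappa>) * (s + \<kappa>) powr (1/4) * exp (a * sqrt (s + \<kappa>))) * (s / (s + \<kappa>)) powr (1/4) * exp (a * (sqrt s - sqrt (s + \<kappa>)))
    = G (s + \<kappa>) * s powr (1/4) * exp (a * sqrt s)) at_top"
    using eventually_gt_at_top[of 0] eventually_gt_at_top[of "- \<kappa>"]
  proof eventually_elim
    case (elim s)
    have "exp (a * sqrt (s + \<kappa>)) * exp (a * (sqrt s - sqrt (s + \<kappa>))) = exp (a * sqrt s)"
      by (simp add: algebra_simps flip: exp_add)
    moreover have "(s + \<kappa>) powr (1/4) * (s / (s + \<kappa>)) powr (1/4) = s powr (1/4)"
      using elim by (simp add: powr_divide)
    moreover have "(g * p * e) * p' * e' = g * (p * p') * (e * e')" for g p e p' e' :: real by (simp only: mult_ac)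
    ultimately show ?case by (simp only:)
  qed
  ultimately show ?thesis by (rule Lim_transform_eventually)
qed

locale wkb =
  fixes \<alpha> :: real and \<psi> \<psi>' \<psi>'' :: "real \<Rightarrow> real"
  assumes \<alpha>: "0 < \<alpha>"
    and \<psi>pos: "\<And>x. x \<in> {0..1} \<Longrightarrow> 0 < \<psi> x"
    and \<psi>: "\<And>x. x \<in> {0..1} \<Longrightarrow> (\<psi> has_real_derivative \<psi>' x) (at x within {0..1})"
    and \<psi>': "\<And>x. x \<in> {0..1} \<Longrightarrow> (\<psi>' has_real_derivative \<psi>'' x) (at x within {0..1})"
    and \<psi>'': "continuous_on {0..1} \<psi>''"
begin

definition m :: "real \<Rightarrow> real" where "m x = \<psi> x powr (-1/4)"

definition m' :: "real \<Rightarrow> real" where "m' x = -1/4 * \<psi> x powr (-5/4) * \<psi>' x"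

definition m'' :: "real \<Rightarrow> real" where
  "m'' x = 5/16 * \<psi> x powr (-9/4) * (\<psi>' x)\<^sup>2 - 1/4 * \<psi> x powr (-5/4) * \<psi>'' x"

definition r :: "real \<Rightarrow> real" where "r x = \<psi> x powr (1/4)"

definition \<Theta> :: "real \<Rightarrow> real" where "\<Theta> x = integral {0..x} (\<lambda>t. sqrt (\<psi> t))"

definition \<kappa> :: "real \<Rightarrow> real" where "\<kappa> c = (m' 1 + \<alpha> * m 1) / (c * r 1)"

text \<open>The phase is measured from the right endpoint, so \<open>ch c 1 = 1\<close> and
  \<open>sh c 1 = \<kappa> c\<close>, and the boundary condition becomes a linear equation for
  \<open>\<kappa> c\<close>.\<close>

definition ch :: "real \<Rightarrow> real \<Rightarrow> real" where
  "ch c x = cosh (c * (\<Theta> 1 - \<Theta> x)) + \<kappa> c * sinh (c * (\<Theta> 1 - \<Theta> x))"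

definition sh :: "real \<Rightarrow> real \<Rightarrow> real" where
  "sh c x = sinh (c * (\<Theta> 1 - \<Theta> x)) + \<kappa> c * cosh (c * (\<Theta> 1 - \<Theta> x))"

lemma cont_\<psi>: "continuous_on {0..1} \<psi>" and cont_\<psi>': "continuous_on {0..1} \<psi>'"
  by (rule DERIV_continuous_on, rule \<psi> \<psi>', assumption)+

lemma cont_m'': "continuous_on {0..1} m''"
  unfolding m''_def using \<psi>pos
  by (intro continuous_intros cont_\<psi> cont_\<psi>' \<psi>'') (auto simp: less_imp_neq[symmetric])

lemma cont_m: "continuous_on {0..1} m"
  unfolding m_def using \<psi>pos
  by (intro continuous_intros cont_\<psi>) (auto simp: less_imp_neq[symmetric])

lemma m_pos: "x \<in> {0..1} \<Longrightarrow> 0 < m x" and r_pos: "x \<in> {0..1} \<Longrightarrow> 0 < r x"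
  using \<psi>pos[of x] by (auto simp: m_def r_def)

lemma deriv_m: "x \<in> {0..1} \<Longrightarrow> (m has_real_derivative m' x) (at x within {0..1})"
  unfolding m_def m'_def using \<psi>pos[of x]
  by (auto intro!: derivative_eq_intros \<psi>)

lemma deriv_m': "x \<in> {0..1} \<Longrightarrow> (m' has_real_derivative m'' x) (at x within {0..1})"
  unfolding m'_def m''_def using \<psi>pos[of x]
  by (auto intro!: derivative_eq_intros \<psi> \<psi>' simp: power2_eq_square field_simps)

text \<open>With this derivative the two \<open>sh\<close> terms in the second derivative of the
  solution cancel; the exponents \<open>1/4\<close> and \<open>-1/4\<close> are chosen for that
  purpose.\<close>

lemma deriv_r: "x \<in> {0..1} \<Longrightarrow> (r has_real_derivative - m' x * sqrt (\<psi> x)) (at x within {0..1})"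
proof -
  assume x: "x \<in> {0..1}"
  have "\<psi> x powr (-3/4) = \<psi> x powr (-5/4) * \<psi> x powr (1/2)" using \<psi>pos[OF x] by (simp flip: powr_add)
  then have "1/4 * \<psi> x powr (-3/4) * \<psi>' x = - m' x * sqrt (\<psi> x)"
    using \<psi>pos[OF x] by (simp add: m'_def powr_half_sqrt)
  moreover have "(r has_real_derivative 1/4 * \<psi> x powr (-3/4) * \<psi>' x) (at x within {0..1})"
    unfolding r_def using \<psi>pos[OF x] by (auto intro!: derivative_eq_intros \<psi> x)
  ultimately show ?thesis by simp
qed

lemma deriv_\<Theta>: "x \<in> {0..1} \<Longrightarrow> (\<Theta> has_real_derivative sqrt (\<psi> x)) (at x within {0..1})"
  unfolding \<Theta>_def by (rule integral_has_real_derivative) (intro continuous_intros cont_\<psi>)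

lemma \<Theta>_mono: "x \<in> {0..1} \<Longrightarrow> \<Theta> x \<le> \<Theta> 1"
proof -
  assume x: "x \<in> {0..1}"
  obtain \<xi> where \<xi>: "\<xi> \<in> {0..1}" "\<Theta> 1 - \<Theta> x = sqrt (\<psi> \<xi>) * (1 - x)"
    using mvt_within_unit_interval[of \<Theta> "\<lambda>x. sqrt (\<psi> x)" x 1, OF deriv_\<Theta> x] by auto
  have "0 \<le> sqrt (\<psi> \<xi>) * (1 - x)" using \<psi>pos[OF \<xi>(1)] x by simp
  then show ?thesis using \<xi>(2) by simp
qed

lemma deriv_ch: "x \<in> {0..1} \<Longrightarrow> (ch c has_real_derivative - c * sqrt (\<psi> x) * sh c x) (at x within {0..1})"
  unfolding ch_def sh_def
  by (auto intro!: derivative_eq_intros deriv_\<Theta> simp: algebra_simps)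

lemma deriv_sh: "x \<in> {0..1} \<Longrightarrow> (sh c has_real_derivative - c * sqrt (\<psi> x) * ch c x) (at x within {0..1})"
  unfolding ch_def sh_def
  by (auto intro!: derivative_eq_intros deriv_\<Theta> simp: algebra_simps)

text \<open>On the nonnegative axis \<open>sinh\<close> stays below \<open>cosh\<close>, so
  \<open>\<bar>\<kappa> c\<bar> < 1\<close> is enough; this holds for large \<open>c\<close> because
  \<open>\<kappa> c\<close> tends to 0.\<close>

lemma ch_pos:
  assumes "\<bar>\<kappa> c\<bar> < 1" "0 \<le> c" "x \<in> {0..1}"
  shows "0 < ch c x"
proof -
  define z where "z = c * (\<Theta> 1 - \<Theta> x)"
  have z: "0 \<le> z" using \<Theta>_mono assms by (simp add: z_def)
  then have s: "0 \<le> sinh z" by simp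
  have "\<kappa> c * sinh z \<ge> - 1 * sinh z" using assms s by (intro mult_right_mono) auto
  moreover have "sinh z < cosh z" by (simp add: sinh_def cosh_def)
  ultimately show ?thesis by (simp add: ch_def z_def[symmetric])
qed

text \<open>The Liouville--Green function \<open>\<psi> powr (-1/4) * ch c\<close> solves the perturbed equation
  \<open>y'' = (c\<^sup>2 * \<psi> + m'' / m) * y\<close> exactly, and the perturbation does not depend on \<open>c\<close>.
  The constant \<open>\<kappa> c\<close> is chosen so that \<open>y' 1 = - \<alpha> * y 1\<close>.\<close>

definition sol :: "real \<Rightarrow> real \<Rightarrow> real" where "sol c x = m x * ch c x"

definition sol' :: "real \<Rightarrow> real \<Rightarrow> real" where "sol' c x = m' x * ch c x - c * r x * sh c x"

definition sol'' :: "real \<Rightarrow> real \<Rightarrow> real" where "sol'' c x = (m'' x + c\<^sup>2 * \<psi> x * m x) * ch c x"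

text \<open>The weight \<open>q\<close> that \<open>ou_weights\<close> attaches to the solution
  \<open>sol c\<close>. With \<open>c = sqrt (2 * s)\<close> its leading term is
  \<open>2 * s * \<psi>\<close>, and the rest is independent of \<open>s\<close>.\<close>

definition weight :: "real \<Rightarrow> real \<Rightarrow> real" where
  "weight c x = c\<^sup>2 * \<psi> x + (m'' x / m x - \<alpha>\<^sup>2)"

lemma m_sqrt: "x \<in> {0..1} \<Longrightarrow> m x * sqrt (\<psi> x) = r x" and r_sqrt: "x \<in> {0..1} \<Longrightarrow> r x * sqrt (\<psi> x) = \<psi> x * m x"
proof -
  assume x: "x \<in> {0..1}"
  have p: "0 < \<psi> x" by (rule \<psi>pos[OF x])
  show "m x * sqrt (\<psi> x) = r x" using p by (simp add: m_def r_def flip: powr_half_sqrt powr_add)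
  have "\<psi> x powr (1/4) * \<psi> x powr (1/2) = \<psi> x powr (1 + (-1/4))" by (simp flip: powr_add)
  also have "\<dots> = \<psi> x powr 1 * \<psi> x powr (-1/4)" by (rule powr_add)
  finally show "r x * sqrt (\<psi> x) = \<psi> x * m x" using p by (simp add: m_def r_def powr_half_sqrt)
qed

lemma deriv_sol: "x \<in> {0..1} \<Longrightarrow> (sol c has_real_derivative sol' c x) (at x within {0..1})"
proof -
  assume x: "x \<in> {0..1}"
  have "(sol c has_real_derivative m' x * ch c x + (- c * sqrt (\<psi> x) * sh c x) * m x) (at x within {0..1})"
    unfolding sol_def by (rule DERIV_mult[OF deriv_m[OF x] deriv_ch[OF x]])
  also have "m' x * ch c x + (- c * sqrt (\<psi> x) * sh c x) * m x = sol' c x"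
    by (simp add: sol'_def m_sqrt[OF x, symmetric])
  finally show ?thesis .
qed

lemma deriv_sol': "x \<in> {0..1} \<Longrightarrow> (sol' c has_real_derivative sol'' c x) (at x within {0..1})"
proof -
  assume x: "x \<in> {0..1}"
  have "(sol' c has_real_derivative (m'' x * ch c x + (- c * sqrt (\<psi> x) * sh c x) * m' x) -
      c * ((- m' x * sqrt (\<psi> x)) * sh c x + (- c * sqrt (\<psi> x) * ch c x) * r x)) (at x within {0..1})"
    unfolding sol'_def mult.assoc[of c]
    by (intro DERIV_diff DERIV_mult deriv_m' deriv_ch DERIV_cmult deriv_r deriv_sh x)
  also have "(m'' x * ch c x + (- c * sqrt (\<psi> x) * sh c x) * m' x) -
      c * ((- m' x * sqrt (\<psi> x)) * sh c x + (- c * sqrt (\<psi> x) * ch c x) * r x) = (m'' x + c\<^sup>2 * (r x * sqrt (\<psi> x))) * ch c x"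
    by (simp add: algebra_simps power2_eq_square)
  also have "\<dots> = sol'' c x" by (simp add: sol''_def r_sqrt[OF x])
  finally show ?thesis .
qed

lemma wkb_ou_weights:
  assumes c: "0 < c" "\<bar>\<kappa> c\<bar> < 1" and w: "\<And>x. x \<in> {0..1} \<Longrightarrow> 0 < weight c x"
  shows "ou_weights \<alpha> (sol c) (sol' c) (sol'' c) (weight c)"
proof
  fix x :: real assume x: "x \<in> {0..1}"
  show "(sol c has_real_derivative sol' c x) (at x within {0..1})" by (rule deriv_sol[OF x])
  show "(sol' c has_real_derivative sol'' c x) (at x within {0..1})" by (rule deriv_sol'[OF x])
  show "0 < sol c x" using m_pos[OF x] ch_pos[OF c(2) _ x] c(1) by (simp add: sol_def)
  show "weight c x = sol'' c x / sol c x - \<alpha>\<^sup>2"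
    using m_pos[OF x] ch_pos[OF c(2) _ x] c(1) by (simp add: sol_def sol''_def weight_def add_divide_distrib)
  show "0 < weight c x" by (rule w[OF x])
next
  have "continuous_on {0..1} (ch c)" by (rule DERIV_continuous_on) (rule deriv_ch)
  then show "continuous_on {0..1} (sol'' c)"
    unfolding sol''_def by (intro continuous_intros cont_m'' cont_\<psi> cont_m)
  show "sol' c 1 = - \<alpha> * sol c 1"
    using c r_pos[of 1] by (simp add: sol_def sol'_def ch_def sh_def \<kappa>_def)
qed (rule \<alpha>)

lemma kappa_tendsto: "(\<kappa> \<longlongrightarrow> 0) at_top"
proof -
  have "((\<lambda>c. (m' 1 + \<alpha> * m 1) / r 1 * (1 / c)) \<longlongrightarrow> (m' 1 + \<alpha> * m 1) / r 1 * 0) at_top"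
    by (intro tendsto_mult tendsto_const tendsto_divide_0[OF tendsto_const] filterlim_at_top_imp_at_infinity filterlim_ident)
  then show ?thesis by (simp add: \<kappa>_def[abs_def] field_simps)
qed

lemma \<Theta>_0: "\<Theta> 0 = 0" by (simp add: \<Theta>_def)

lemma \<Theta>_1_pos: "0 < \<Theta> 1"
proof -
  obtain \<xi> where \<xi>: "\<xi> \<in> {0..1}" "\<Theta> 1 - \<Theta> 0 = sqrt (\<psi> \<xi>) * (1 - 0)"
    using mvt_within_unit_interval[of \<Theta> "\<lambda>x. sqrt (\<psi> x)" 0 1, OF deriv_\<Theta>] by auto
  then show ?thesis using \<psi>pos[OF \<xi>(1)] \<Theta>_0 by simp
qed

text \<open>The numerator is constant, \<open>sol c 1 = m 1\<close>, while the denominator grows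
  like \<open>c * r 0 * exp (\<theta> * c) / 2\<close>. Taking the square root of the quotient
  yields the decay \<open>exp (- \<theta> * c / 2) / sqrt c\<close> and turns the exponents
  \<open>1/4\<close> of \<open>r 0\<close> and \<open>-1/4\<close> of \<open>m 1\<close> into
  \<open>-1/8\<close> for both endpoint values of \<open>\<psi>\<close>.\<close>

lemma exp_functional_asymptotics:
  assumes \<theta>: "\<theta> = \<Theta> 1"
  shows "((\<lambda>c. sqrt (2 * \<alpha> * exp \<alpha> * sol c 1 / (\<alpha> * sol c 0 - sol' c 0)) * sqrt c * exp (\<theta> * c / 2))
    \<longlongrightarrow> 2 * sqrt \<alpha> * exp (\<alpha> / 2) * \<psi> 0 powr (- 1/8) * \<psi> 1 powr (- 1/8)) at_top"
proof -
  have \<theta>pos: "0 < \<theta>" using \<Theta>_1_pos \<theta> by simp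
  define E where "E c = exp (- 2 * (\<theta> * c))" for c
  have E0: "(E \<longlongrightarrow> 0) at_top" unfolding E_def using \<theta>pos by real_asymp
  define Cn where "Cn c = ((1 + \<kappa> c) + (1 - \<kappa> c) * E c) / 2" for c
  define Sn where "Sn c = ((1 + \<kappa> c) - (1 - \<kappa> c) * E c) / 2" for c
  have hyp: "cosh (c * \<theta>) = exp (\<theta> * c) * (1 + E c) / 2" "sinh (c * \<theta>) = exp (\<theta> * c) * (1 - E c) / 2" for c
    by (simp_all add: cosh_def sinh_def E_def distrib_left right_diff_distrib mult.commute flip: exp_add)
  have ch0: "ch c 0 = exp (\<theta> * c) * Cn c" and sh0: "sh c 0 = exp (\<theta> * c) * Sn c" for c
    unfolding ch_def sh_def \<Theta>_0 diff_0_right \<theta>[symmetric] hyp Cn_def Sn_def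
    by (simp_all add: algebra_simps add_divide_distrib diff_divide_distrib)
  \<comment> \<open>The denominator after division by \<open>c * exp (\<theta> * c)\<close>; only
    the \<open>r 0\<close> term, which comes from differentiating the phase, survives in the
    limit.\<close>
  define J where "J c = (\<alpha> * m 0 - m' 0) * Cn c / c + r 0 * Sn c" for c
  have r0: "0 < r 0" and r1: "0 < r 1" using r_pos by auto
  have Cn: "(Cn \<longlongrightarrow> ((1 + 0) + (1 - 0) * 0) / 2) at_top" and Sn: "(Sn \<longlongrightarrow> ((1 + 0) - (1 - 0) * 0) / 2) at_top"
    unfolding Cn_def Sn_def by (intro tendsto_intros kappa_tendsto E0; simp)+
  have "((\<lambda>c. (\<alpha> * m 0 - m' 0) * Cn c / c) \<longlongrightarrow> 0) at_top"
    by (rule tendsto_divide_0[OF tendsto_mult[OF tendsto_const Cn]]) (intro filterlim_at_top_imp_at_infinity filterlim_ident)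
  from tendsto_add[OF this tendsto_mult[OF tendsto_const Sn, of "r 0"]]
  have J: "(J \<longlongrightarrow> r 0 / 2) at_top" by (simp add: J_def[abs_def])
  have "((\<lambda>c. sqrt (2 * \<alpha> * exp \<alpha> * m 1 / J c)) \<longlongrightarrow> sqrt (2 * \<alpha> * exp \<alpha> * m 1 / (r 0 / 2))) at_top"
    by (intro tendsto_intros J) (use r0 in simp)
  also have "sqrt (2 * \<alpha> * exp \<alpha> * m 1 / (r 0 / 2)) = 2 * sqrt \<alpha> * exp (\<alpha> / 2) * \<psi> 0 powr (- 1/8) * \<psi> 1 powr (- 1/8)"
  proof (rule real_sqrt_unique)
    have "exp \<alpha> = (exp (\<alpha> / 2))\<^sup>2" by (simp flip: exp_of_nat_mult)
    moreover have "(\<psi> 0 powr (- 1/8))\<^sup>2 = 1 / r 0" "(\<psi> 1 powr (- 1/8))\<^sup>2 = m 1"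
      using \<psi>pos[of 0] \<psi>pos[of 1] by (simp_all add: r_def m_def power2_eq_square powr_minus_divide flip: powr_add)
    ultimately show "(2 * sqrt \<alpha> * exp (\<alpha> / 2) * \<psi> 0 powr (- 1/8) * \<psi> 1 powr (- 1/8))\<^sup>2 = 2 * \<alpha> * exp \<alpha> * m 1 / (r 0 / 2)"
      using \<alpha> by (simp add: power_mult_distrib)
  qed (use \<alpha> in simp)
  finally have L: "((\<lambda>c. sqrt (2 * \<alpha> * exp \<alpha> * m 1 / J c)) \<longlongrightarrow> 2 * sqrt \<alpha> * exp (\<alpha> / 2) * \<psi> 0 powr (- 1/8) * \<psi> 1 powr (- 1/8)) at_top" .
  have "eventually (\<lambda>c. sqrt (2 * \<alpha> * exp \<alpha> * m 1 / J c) = sqrt (2 * \<alpha> * exp \<alpha> * sol c 1 / (\<alpha> * sol c 0 - sol' c 0)) * sqrt c * exp (\<theta> * c / 2)) at_top"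
    using eventually_gt_at_top[of 0]
  proof eventually_elim
    case (elim c)
    have "\<alpha> * sol c 0 - sol' c 0 = exp (\<theta> * c) * c * J c"
      using elim by (simp add: sol_def sol'_def ch0 sh0 J_def field_simps)
    moreover have "sol c 1 = m 1" by (simp add: sol_def ch_def)
    moreover have "exp (\<theta> * c) = (exp (\<theta> * c / 2))\<^sup>2" by (simp flip: exp_of_nat_mult)
    ultimately have "2 * \<alpha> * exp \<alpha> * sol c 1 / (\<alpha> * sol c 0 - sol' c 0) = 2 * \<alpha> * exp \<alpha> * m 1 / J c / (c * (exp (\<theta> * c / 2))\<^sup>2)"
      by simp
    then have "sqrt (2 * \<alpha> * exp \<alpha> * sol c 1 / (\<alpha> * sol c 0 - sol' c 0)) = sqrt (2 * \<alpha> * exp \<alpha> * m 1 / J c) / (sqrt c * exp (\<theta> * c / 2))"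
      by (simp only: real_sqrt_divide real_sqrt_mult real_sqrt_abs abs_exp_cancel)
    then show ?case using elim by simp
  qed
  with L show ?thesis by (rule Lim_transform_eventually)
qed

end

section \<open>Small ball asymptotics\<close>

text \<open>Exchange of integrals over the set where \<open>X \<omega> \<le> x\<close>. The division
  by \<open>s\<close> is what raises the power of \<open>s\<close> in the asymptotics from
  \<open>1/4\<close> to \<open>5/4\<close>.\<close>

lemma laplace_of_cdf:
  assumes M: "prob_space M" and X[measurable]: "X \<in> borel_measurable M" and X0: "\<And>\<omega>. \<omega> \<in> space M \<Longrightarrow> 0 \<le> X \<omega>" and s: "0 < s"
  shows "has_bochner_integral lborel (\<lambda>x. exp (- s * x) * measure M {\<omega> \<in> space M. X \<omega> \<le> x}) ((\<integral>\<omega>. exp (- s * X \<omega>) \<partial>M) / s)"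
proof -
  interpret prob_space M by (rule M)
  interpret P: pair_sigma_finite M lborel ..
  define F where "F x = measure M {\<omega> \<in> space M. X \<omega> \<le> x}" for x
  have "mono F" unfolding F_def by (intro monoI finite_measure_mono) auto
  then have Fm[measurable]: "F \<in> borel_measurable borel" by (rule borel_measurable_mono)
  have int: "integrable M (\<lambda>\<omega>. exp (- s * X \<omega>))"
    by (rule integrable_const_bound[where B=1]) (use X0 s in \<open>auto intro!: AE_I2\<close>)
  have "(\<integral>\<^sup>+x. ennreal (exp (- s * x) * F x) \<partial>lborel) = (\<integral>\<^sup>+x. \<integral>\<^sup>+\<omega>. ennreal (exp (- s * x)) * indicator {X \<omega>..} x \<partial>M \<partial>lborel)"
  proof (intro nn_integral_cong)
    fix x
    have "(\<integral>\<^sup>+\<omega>. ennreal (exp (- s * x)) * indicator {X \<omega>..} x \<partial>M) = (\<integral>\<^sup>+\<omega>. ennreal (exp (- s * x)) * indicator {\<omega> \<in> space M. X \<omega> \<le> x} \<omega> \<partial>M)"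
      by (intro nn_integral_cong) (auto simp: indicator_def)
    also have "\<dots> = ennreal (exp (- s * x)) * emeasure M {\<omega> \<in> space M. X \<omega> \<le> x}"
      by (rule nn_integral_cmult_indicator) measurable
    finally show "ennreal (exp (- s * x) * F x) = (\<integral>\<^sup>+\<omega>. ennreal (exp (- s * x)) * indicator {X \<omega>..} x \<partial>M)"
      by (simp add: F_def emeasure_eq_measure ennreal_mult)
  qed
  also have "\<dots> = (\<integral>\<^sup>+\<omega>. \<integral>\<^sup>+x. ennreal (exp (- s * x)) * indicator {X \<omega>..} x \<partial>lborel \<partial>M)"
  proof (rule P.Fubini')
    have "(\<lambda>(\<omega>, x). ennreal (exp (- s * x)) * indicator {X \<omega>..} x) = (\<lambda>p. ennreal (exp (- s * snd p)) * indicator {p. X (fst p) \<le> snd p} p)"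
      by (auto simp: fun_eq_iff indicator_def)
    moreover have "(\<lambda>p. ennreal (exp (- s * snd p)) * indicator {p. X (fst p) \<le> snd p} p) \<in> borel_measurable (M \<Otimes>\<^sub>M lborel)"
      by measurable
    ultimately show "(\<lambda>(\<omega>, x). ennreal (exp (- s * x)) * indicator {X \<omega>..} x) \<in> borel_measurable (M \<Otimes>\<^sub>M lborel)" by simp
  qed
  also have "\<dots> = (\<integral>\<^sup>+\<omega>. ennreal (exp (- s * X \<omega>) / s) \<partial>M)"
    by (simp only: nn_integral_exp_atLeast[OF s])
  also have "\<dots> = ennreal ((\<integral>\<omega>. exp (- s * X \<omega>) \<partial>M) / s)"
    using int s by (subst nn_integral_eq_integral) auto
  finally have nn: "(\<integral>\<^sup>+x. ennreal (exp (- s * x) * F x) \<partial>lborel) = ennreal ((\<integral>\<omega>. exp (- s * X \<omega>) \<partial>M) / s)" .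
  have "has_bochner_integral lborel (\<lambda>x. exp (- s * x) * F x) ((\<integral>\<omega>. exp (- s * X \<omega>) \<partial>M) / s)"
  proof (rule has_bochner_integral_nn_integral[OF _ _ _ nn])
    show "AE x in lborel. 0 \<le> exp (- s * x) * F x" by (simp add: F_def)
    show "0 \<le> (\<integral>\<omega>. exp (- s * X \<omega>) \<partial>M) / s" using s by simp
  qed simp
  then show ?thesis by (simp only: F_def)
qed

text \<open>The approximating functions are not claimed to be distribution functions of discretised
  energies; they share the Laplace transforms of those, and convergence of transforms is all that
  the limit theorem uses.\<close>

lemma OU_cdf_log_concave:
  assumes M: "prob_space M" and \<alpha>: "0 < \<alpha>" and U: "stationary_OU_process M \<alpha> U"
    and \<psi>: "continuous_on {0..1} \<psi>" and \<psi>0: "\<And>t. t \<in> {0..1} \<Longrightarrow> 0 \<le> \<psi> t"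
    and t: "0 < t" "t < 1"
  defines "F \<equiv> \<lambda>x. measure M {\<omega> \<in> space M. energy \<psi> U \<omega> \<le> x}"
  shows "F x powr (1 - t) * F y powr t \<le> F ((1 - t) * x + t * y)"
proof -
  interpret prob_space M by (rule M)
  define X where "X \<omega> = energy \<psi> U \<omega>" for \<omega>
  have X[measurable]: "X \<in> borel_measurable M"
    unfolding X_def by (rule OU_weighted_integral(2)[OF M U \<psi>])
  have X0: "0 \<le> X \<omega>" for \<omega>
    unfolding X_def set_lebesgue_integral_def using \<psi>0 by (intro integral_nonneg_AE AE_I2) (auto simp: indicator_def)
  have F: "F x = measure M {\<omega> \<in> space M. X \<omega> \<le> x}" for x by (simp add: F_def X_def)
  define \<rho> where "\<rho> n = exp (- \<alpha> / real n)" for n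
  define \<sigma> where "\<sigma> n = sqrt ((1 - (exp (- \<alpha> / real n))\<^sup>2) / (2 * \<alpha>))" for n
  \<comment> \<open>The factor 2 compensates the \<open>1/2\<close> in the exponent behind
    \<open>ou_laplace\<close>. Index \<open>n\<close> gets weight 0, matching Riemann sums over left
    endpoints.\<close>
  define w where "w n j = (if j < n then 2 * \<psi> (real j / real n) / real n else 0)" for n j
  have w: "0 \<le> w n j" for n j using \<psi>0 by (auto simp: w_def)
  define P where "P n f \<longleftrightarrow> log_concave f \<and> mono f \<and> (\<forall>x. 0 \<le> f x \<and> f x \<le> (1::real)) \<and> (\<forall>x<0. f x = 0) \<and>
    (\<forall>s>0. (\<integral>\<^sup>+x. ennreal (exp (- s * x) * f x) \<partial>lborel)
       = ennreal (ou_laplace (\<rho> n) (\<sigma> n) (1 / sqrt (2 * \<alpha>)) (\<lambda>j. s * w n j) n (s * w n n) / s))" for n f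
  have "\<exists>f. P n f" for n
    unfolding P_def by (rule exists_log_concave_with_laplace) (rule w)
  then obtain Fn where "\<And>n. P n (Fn n)" by metis
  then have Fn: "log_concave (Fn n)" "mono (Fn n)" "0 \<le> Fn n x \<and> Fn n x \<le> 1" "x < 0 \<Longrightarrow> Fn n x = 0"
    and lap: "s > 0 \<Longrightarrow> (\<integral>\<^sup>+x. ennreal (exp (- s * x) * Fn n x) \<partial>lborel)
       = ennreal (ou_laplace (\<rho> n) (\<sigma> n) (1 / sqrt (2 * \<alpha>)) (\<lambda>j. s * w n j) n (s * w n n) / s)" for n x s
    unfolding P_def by blast+
  have Fnm[measurable]: "Fn n \<in> borel_measurable borel" for n using Fn(2) by (rule borel_measurable_mono)
  show ?thesis
  proof (rule log_concave_of_laplace_tendsto[where Fn = "\<lambda>n. Fn (Suc n)"])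
    show "Fn (Suc n) x powr (1 - t) * Fn (Suc n) y powr t \<le> Fn (Suc n) ((1 - t) * x + t * y)" if "0 < t" "t < 1" for n x y t
      using log_concaveD(2)[OF Fn(1) that, of "Suc n" x y] by simp
    show "mono F" unfolding F by (intro monoI finite_measure_mono) auto
    show "F x = 0" if "x < 0" for x
    proof -
      have "{\<omega> \<in> space M. X \<omega> \<le> x} = {}" using X0 that by (auto simp: not_le intro: less_le_trans)
      then show ?thesis by (simp only: F measure_empty)
    qed
    show "(F \<longlongrightarrow> F x) (at_right x)" for x
    proof -
      interpret D: real_distribution "distr M borel X" by (rule real_distribution_distr) (rule X)
      have "cdf (distr M borel X) z = F z" for z
        unfolding cdf_def F by (subst measure_distr) (auto simp: vimage_def Int_def conj_commute)
      then have "cdf (distr M borel X) = F" by auto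
      with D.cdf_is_right_cont[of x] show ?thesis by (simp add: continuous_within)
    qed
    fix s :: real assume s: "0 < s"
    have "(\<lambda>n. \<integral>\<omega>. exp (- ((\<Sum>j<n. s * w n j * (U (real j / real n) \<omega>)\<^sup>2) + s * w n n * (U (real n / real n) \<omega>)\<^sup>2) / 2) \<partial>M)
      \<longlonglongrightarrow> (\<integral>\<omega>. exp (- (LBINT t:{0..1}. (s * (2 * \<psi> t)) * (U t \<omega>)\<^sup>2) / 2) \<partial>M)"
    proof (rule OU_exp_sum_tendsto[OF M U])
      show c: "continuous_on {0..1} (\<lambda>t. s * (2 * \<psi> t))" by (intro continuous_intros \<psi>)
      fix \<omega> assume "\<omega> \<in> space M"
      from OU_weighted_integral(1)[OF M U c this]
      show "(\<lambda>n. (\<Sum>j<n. s * w n j * (U (real j / real n) \<omega>)\<^sup>2) + s * w n n * (U (real n / real n) \<omega>)\<^sup>2) \<longlonglongrightarrow> (LBINT t:{0..1}. (s * (2 * \<psi> t)) * (U t \<omega>)\<^sup>2)"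
        by (simp add: w_def)
    qed (use w s in auto)
    also have "(\<lambda>\<omega>. LBINT t:{0..1}. (s * (2 * \<psi> t)) * (U t \<omega>)\<^sup>2) = (\<lambda>\<omega>. 2 * s * X \<omega>)"
    proof
      fix \<omega>
      have "(LBINT t:{0..1}. (s * (2 * \<psi> t)) * (U t \<omega>)\<^sup>2) = (LBINT t:{0..1}. (2 * s) * (\<psi> t * (U t \<omega>)\<^sup>2))" by (simp add: mult_ac)
      then show "(LBINT t:{0..1}. (s * (2 * \<psi> t)) * (U t \<omega>)\<^sup>2) = 2 * s * X \<omega>"
        by (simp only: X_def set_integral_mult_right)
    qed
    finally have "(\<lambda>n. \<integral>\<omega>. exp (- ((\<Sum>j<n. s * w n j * (U (real j / real n) \<omega>)\<^sup>2) + s * w n n * (U (real n / real n) \<omega>)\<^sup>2) / 2) \<partial>M) \<longlonglongrightarrow> (\<integral>\<omega>. exp (- s * X \<omega>) \<partial>M)"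
      by simp
    from tendsto_divide[OF LIMSEQ_Suc[OF this] tendsto_const, of s] s
    have "(\<lambda>n. (\<integral>\<omega>. exp (- ((\<Sum>j<Suc n. s * w (Suc n) j * (U (real j / real (Suc n)) \<omega>)\<^sup>2) + s * w (Suc n) (Suc n) * (U (real (Suc n) / real (Suc n)) \<omega>)\<^sup>2) / 2) \<partial>M) / s) \<longlonglongrightarrow> (\<integral>\<omega>. exp (- s * X \<omega>) \<partial>M) / s"
      by blast
    also have "(\<integral>\<omega>. exp (- s * X \<omega>) \<partial>M) / s = (\<integral>x. exp (- s * x) * F x \<partial>lborel)"
      using laplace_of_cdf[OF M X X0 s] by (simp add: F has_bochner_integral_iff)
    also have "(\<lambda>n. (\<integral>\<omega>. exp (- ((\<Sum>j<Suc n. s * w (Suc n) j * (U (real j / real (Suc n)) \<omega>)\<^sup>2) + s * w (Suc n) (Suc n) * (U (real (Suc n) / real (Suc n)) \<omega>)\<^sup>2) / 2) \<partial>M) / s)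
      = (\<lambda>n. \<integral>x. exp (- s * x) * Fn (Suc n) x \<partial>lborel)"
    proof
      fix n
      define L where "L = (\<integral>\<omega>. exp (- ((\<Sum>j<Suc n. s * w (Suc n) j * (U (real j / real (Suc n)) \<omega>)\<^sup>2) + s * w (Suc n) (Suc n) * (U (real (Suc n) / real (Suc n)) \<omega>)\<^sup>2) / 2) \<partial>M)"
      have "L = ou_laplace (\<rho> (Suc n)) (\<sigma> (Suc n)) (1 / sqrt (2 * \<alpha>)) (\<lambda>j. s * w (Suc n) j) (Suc n) (s * w (Suc n) (Suc n))"
        unfolding L_def \<rho>_def \<sigma>_def by (rule OU_laplace_eq_ou_laplace[OF M \<alpha> U]) (use w s in auto)
      then have "(\<integral>\<^sup>+x. ennreal (exp (- s * x) * Fn (Suc n) x) \<partial>lborel) = ennreal (L / s)"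
        using lap[OF s, of "Suc n"] by simp
      moreover have "0 \<le> L" unfolding L_def by simp
      moreover have "AE x in lborel. 0 \<le> exp (- s * x) * Fn (Suc n) x" using Fn(3) by simp
      ultimately have "(\<integral>x. exp (- s * x) * Fn (Suc n) x \<partial>lborel) = L / s"
        using s by (subst integral_eq_nn_integral) auto
      then show "L / s = (\<integral>x. exp (- s * x) * Fn (Suc n) x \<partial>lborel)" by simp
    qed
    finally show "(\<lambda>n. \<integral>x. exp (- s * x) * Fn (Suc n) x \<partial>lborel) \<longlonglongrightarrow> (\<integral>x. exp (- s * x) * F x \<partial>lborel)" .
  qed (use Fn t in \<open>auto simp: F\<close>)
qed

section \<open>Laplace transform of the squared norm at infinity\<close>

context wkb
begin

lemma OU_laplace_asymptotics:
  assumes M: "prob_space M" and U: "stationary_OU_process M \<alpha> U"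
  shows "((\<lambda>s. (\<integral>\<omega>. exp (- s * energy \<psi> U \<omega>) \<partial>M) * s powr (1/4) * exp (\<Theta> 1 / sqrt 2 * sqrt s))
    \<longlongrightarrow> 2 * sqrt \<alpha> * exp (\<alpha> / 2) * \<psi> 0 powr (- 1/8) * \<psi> 1 powr (- 1/8) * 2 powr (- 1/4)) at_top"
proof -
  interpret prob_space M by (rule M)
  define I where "I c = sqrt (2 * \<alpha> * exp \<alpha> * sol c 1 / (\<alpha> * sol c 0 - sol' c 0))" for c
  define D where "D = 2 * sqrt \<alpha> * exp (\<alpha> / 2) * \<psi> 0 powr (- 1/8) * \<psi> 1 powr (- 1/8)"
  \<comment> \<open>\<open>c = sqrt (2 * s)\<close> turns the leading weight
    \<open>c^2 * \<psi>\<close> into \<open>2 * s * \<psi>\<close>; since \<open>sqrt c\<close> is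
    then \<open>(2 * s) powr (1/4)\<close>, the constant picks up the factor
    \<open>2 powr (- 1/4)\<close>.\<close>
  define G where "G s = I (sqrt (2 * s))" for s
  define L where "L s = (\<integral>\<omega>. exp (- s * energy \<psi> U \<omega>) \<partial>M)" for s
  have sq: "filterlim (\<lambda>s::real. sqrt (2 * s)) at_top at_top" by real_asymp
  have Ilim: "((\<lambda>c. I c * sqrt c * exp (\<Theta> 1 * c / 2)) \<longlongrightarrow> D) at_top"
    using exp_functional_asymptotics[OF refl] by (simp only: I_def D_def)
  have "((\<lambda>s. G s * sqrt (sqrt (2 * s)) * exp (\<Theta> 1 * sqrt (2 * s) / 2) * 2 powr (- 1/4)) \<longlongrightarrow> D * 2 powr (- 1/4)) at_top"
    unfolding G_def by (intro tendsto_mult tendsto_const filterlim_compose[OF Ilim sq])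
  then have G: "((\<lambda>s. G s * s powr (1/4) * exp (\<Theta> 1 / sqrt 2 * sqrt s)) \<longlongrightarrow> D * 2 powr (- 1/4)) at_top"
  proof (rule Lim_transform_eventually)
    show "eventually (\<lambda>s. G s * sqrt (sqrt (2 * s)) * exp (\<Theta> 1 * sqrt (2 * s) / 2) * 2 powr (- 1/4) = G s * s powr (1/4) * exp (\<Theta> 1 / sqrt 2 * sqrt s)) at_top"
      using eventually_gt_at_top[of 0]
    proof eventually_elim
      case (elim s)
      have "sqrt (sqrt (2 * s)) = (2 * s) powr (1/4)"
        using elim by (simp add: powr_powr flip: powr_half_sqrt)
      also have "\<dots> = 2 powr (1/4) * s powr (1/4)" using elim by (simp add: powr_mult)
      finally have 1: "sqrt (sqrt (2 * s)) * 2 powr (- 1/4) = s powr (1/4)" by (simp add: powr_minus_divide)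
      have "\<Theta> 1 * sqrt (2 * s) / 2 = \<Theta> 1 / sqrt 2 * sqrt s"
        by (simp add: real_sqrt_mult field_simps)
      moreover have "g * r * e * p = g * (r * p) * e" for g r e p :: real by (simp only: mult_ac)
      ultimately show ?case using 1 by (simp only:)
    qed
  qed
  obtain p0 where p0: "p0 \<in> {0..1}" "\<And>x. x \<in> {0..1} \<Longrightarrow> \<psi> p0 \<le> \<psi> x"
    using continuous_attains_inf[OF _ _ cont_\<psi>] by auto
  define p where "p = \<psi> p0"
  have p: "0 < p" "\<And>x. x \<in> {0..1} \<Longrightarrow> p \<le> \<psi> x" using \<psi>pos[OF p0(1)] p0(2) by (auto simp: p_def)
  have cR: "continuous_on {0..1} (\<lambda>x. m'' x / m x - \<alpha>\<^sup>2)"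
    by (intro continuous_intros cont_m'' cont_m) (use m_pos in force)
  have "bounded ((\<lambda>x. m'' x / m x - \<alpha>\<^sup>2) ` {0..1})" by (intro compact_imp_bounded compact_continuous_image cR) simp
  then obtain K where K: "\<And>x. x \<in> {0..1} \<Longrightarrow> \<bar>m'' x / m x - \<alpha>\<^sup>2\<bar> \<le> K" unfolding bounded_real by blast
  have K0: "0 \<le> K" using K[of 0] by (auto intro: order_trans[OF abs_ge_zero])
  \<comment> \<open>As \<open>p\<close> is the minimum of \<open>\<psi>\<close>, this
    \<open>k\<close> satisfies \<open>K \<le> 2 * k * \<psi> x\<close>: the additive error of the
    weight is absorbed by changing \<open>s\<close> by \<open>k\<close>.\<close>
  define k where "k = K / (2 * p)"
  have k: "0 \<le> k" "\<And>x. x \<in> {0..1} \<Longrightarrow> K \<le> 2 * k * \<psi> x"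
  proof -
    show k0: "0 \<le> k" using K0 p by (simp add: k_def)
    fix x :: real assume "x \<in> {0..1}"
    then have "2 * k * p \<le> 2 * k * \<psi> x" using k0 p by (intro mult_left_mono) auto
    then show "K \<le> 2 * k * \<psi> x" using p by (simp add: k_def)
  qed
  have cw: "continuous_on {0..1} (weight c)" for c
    unfolding weight_def by (intro continuous_intros cont_\<psi> cR)
  \<comment> \<open>The first condition makes the solution positive, the second one the weight; both
    hold for large \<open>s\<close>.\<close>
  have Gfun: "G s = (\<integral>\<omega>. exp (- energy (weight (sqrt (2 * s))) U \<omega> / 2) \<partial>M)
      \<and> (\<forall>x\<in>{0..1}. 0 < weight (sqrt (2 * s)) x)"
    if "\<bar>\<kappa> (sqrt (2 * s))\<bar> < 1" "K < 2 * s * p" for s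
  proof -
    have "0 < 2 * s * p" using that(2) K0 by linarith
    then have s: "0 < s" using p by (simp add: zero_less_mult_iff)
    have w: "0 < weight (sqrt (2 * s)) x" if x: "x \<in> {0..1}" for x
    proof -
      have "2 * s * p \<le> 2 * s * \<psi> x" using p(2)[OF x] s by (intro mult_left_mono) auto
      moreover have "- K \<le> m'' x / m x - \<alpha>\<^sup>2" using K[OF x] by (simp add: abs_le_iff)
      moreover have e: "(sqrt (2 * s))\<^sup>2 = 2 * s" using s by simp
      ultimately show ?thesis using \<open>K < 2 * s * p\<close> unfolding weight_def e by linarith
    qed
    interpret W: ou_weights \<alpha> "sol (sqrt (2 * s))" "sol' (sqrt (2 * s))" "sol'' (sqrt (2 * s))" "weight (sqrt (2 * s))"
      by (rule wkb_ou_weights) (use s that w in auto)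
    show ?thesis using W.OU_exp_functional[OF M U] w by (auto simp: G_def I_def)
  qed
  have evG: "eventually (\<lambda>s. \<bar>\<kappa> (sqrt (2 * s))\<bar> < 1 \<and> K < 2 * s * p) at_top"
  proof (rule eventually_conj)
    have "((\<lambda>s. \<bar>\<kappa> (sqrt (2 * s))\<bar>) \<longlongrightarrow> \<bar>0\<bar>) at_top"
      by (intro tendsto_rabs filterlim_compose[OF kappa_tendsto sq])
    then show "eventually (\<lambda>s. \<bar>\<kappa> (sqrt (2 * s))\<bar> < 1) at_top" by (rule order_tendstoD) simp
    show "eventually (\<lambda>s. K < 2 * s * p) at_top"
      using eventually_gt_at_top[of "K / (2 * p)"] by eventually_elim (use p in \<open>simp add: field_simps\<close>)
  qed
  have compare: "(\<integral>\<omega>. exp (- energy f U \<omega> / 2) \<partial>M) \<le> (\<integral>\<omega>. exp (- energy g U \<omega> / 2) \<partial>M)"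
    if cf: "continuous_on {0..1} f" and cg: "continuous_on {0..1} g" and fg: "\<And>x. x \<in> {0..1} \<Longrightarrow> 0 \<le> g x \<and> g x \<le> f x" for f g
  proof -
    have si: "set_integrable lborel {0..1} (\<lambda>t. h t * (U t \<omega>)\<^sup>2)" if "\<omega> \<in> space M" "continuous_on {0..1} h" for h \<omega>
    proof (rule borel_integrable_atLeastAtMost')
      have "continuous_on {0..1} (\<lambda>t. U t \<omega>)" using U that by (simp add: stationary_OU_process_def)
      then show "continuous_on {0..1} (\<lambda>t. h t * (U t \<omega>)\<^sup>2)" using that(2) by (intro continuous_intros)
    qed
    have nn: "0 \<le> energy h U \<omega>" if "\<And>x. x \<in> {0..1} \<Longrightarrow> 0 \<le> h x" for h \<omega>
      unfolding set_lebesgue_integral_def using that by (intro integral_nonneg_AE AE_I2) (auto simp: indicator_def)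
    have [measurable]: "(\<lambda>\<omega>. energy f U \<omega>) \<in> borel_measurable M" "(\<lambda>\<omega>. energy g U \<omega>) \<in> borel_measurable M"
      by (rule OU_weighted_integral(2)[OF M U cf] OU_weighted_integral(2)[OF M U cg])+
    have f0: "0 \<le> f x" if "x \<in> {0..1}" for x using fg[OF that] by linarith
    show ?thesis
    proof (rule integral_mono)
      show "integrable M (\<lambda>\<omega>. exp (- energy f U \<omega> / 2))"
        by (rule integrable_const_bound[where B=1]) (use nn[OF f0] in auto)
      show "integrable M (\<lambda>\<omega>. exp (- energy g U \<omega> / 2))"
        by (rule integrable_const_bound[where B=1]) (use nn[of g] fg in auto)
      fix \<omega> assume \<omega>: "\<omega> \<in> space M"
      have "energy g U \<omega> \<le> energy f U \<omega>"
      proof (rule set_integral_mono[OF si[OF \<omega> cg] si[OF \<omega> cf]])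
        fix t :: real assume "t \<in> {0..1}"
        then have "g t \<le> f t" using fg[of t] by linarith
        then show "g t * (U t \<omega>)\<^sup>2 \<le> f t * (U t \<omega>)\<^sup>2" by (rule mult_right_mono) simp
      qed
      then show "exp (- energy f U \<omega> / 2) \<le> exp (- energy g U \<omega> / 2)" by simp
    qed
  qed
  \<comment> \<open>Doubling the weight \<open>s * \<psi>\<close> cancels the \<open>1/2\<close> in
    the exponential functional, so that weights can be compared pointwise.\<close>
  have L2: "L s = (\<integral>\<omega>. exp (- (LBINT t:{0..1}. (2 * s * \<psi> t) * (U t \<omega>)\<^sup>2) / 2) \<partial>M)" for s
    unfolding L_def mult.assoc[of "2 * s"] by (simp only: set_integral_mult_right) (simp add: field_simps)
  have cs: "continuous_on {0..1} (\<lambda>t. 2 * s * \<psi> t)" for s by (intro continuous_intros cont_\<psi>)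
  have shift: "filterlim (\<lambda>s::real. s + c) at_top at_top" for c
    using filterlim_tendsto_add_at_top[OF tendsto_const filterlim_ident, of c] by (simp add: add.commute)
  have lower: "eventually (\<lambda>s. G (s + k) \<le> L s) at_top"
    using eventually_compose_filterlim[OF evG shift[of k]] eventually_gt_at_top[of 0]
  proof eventually_elim
    case (elim s)
    have sk: "(sqrt (2 * (s + k)))\<^sup>2 = 2 * (s + k)" using elim k by simp
    have G: "G (s + k) = (\<integral>\<omega>. exp (- energy (weight (sqrt (2 * (s + k)))) U \<omega> / 2) \<partial>M)"
      using Gfun[of "s + k"] elim(1) by blast
    show ?case
      unfolding L2 G
    proof (rule compare[OF cw cs])
      fix x :: real assume x: "x \<in> {0..1}"
      have "0 \<le> 2 * s * \<psi> x" using elim(2) \<psi>pos[OF x] by simp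
      moreover have "2 * (s + k) * \<psi> x = 2 * s * \<psi> x + 2 * k * \<psi> x" by (simp add: algebra_simps)
      then have "2 * s * \<psi> x \<le> weight (sqrt (2 * (s + k))) x"
        using K[OF x] k(2)[OF x] unfolding weight_def sk abs_le_iff by linarith
      ultimately show "0 \<le> 2 * s * \<psi> x \<and> 2 * s * \<psi> x \<le> weight (sqrt (2 * (s + k))) x" ..
    qed
  qed
  have upper: "eventually (\<lambda>s. L s \<le> G (s + - k)) at_top"
    using eventually_compose_filterlim[OF evG shift[of "- k"]] eventually_gt_at_top[of k]
  proof eventually_elim
    case (elim s)
    have sk: "(sqrt (2 * (s + - k)))\<^sup>2 = 2 * (s + - k)" using elim k by simp
    have G: "G (s + - k) = (\<integral>\<omega>. exp (- energy (weight (sqrt (2 * (s + - k)))) U \<omega> / 2) \<partial>M)"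
      and pos: "\<forall>x\<in>{0..1}. 0 < weight (sqrt (2 * (s + - k))) x"
      using Gfun[of "s + - k"] elim(1) by blast+
    show ?case
      unfolding L2 G
    proof (rule compare[OF cs cw])
      fix x :: real assume x: "x \<in> {0..1}"
      have "0 < weight (sqrt (2 * (s + - k))) x" using pos x by blast
      moreover have "2 * (s + - k) * \<psi> x = 2 * s * \<psi> x - 2 * k * \<psi> x" by (simp add: algebra_simps)
      then have "weight (sqrt (2 * (s + - k))) x \<le> 2 * s * \<psi> x"
        using K[OF x] k(2)[OF x] unfolding weight_def sk abs_le_iff by linarith
      ultimately show "0 \<le> weight (sqrt (2 * (s + - k))) x \<and> weight (sqrt (2 * (s + - k))) x \<le> 2 * s * \<psi> x" by simp
    qed
  qed
  have "((\<lambda>s. L s * s powr (1/4) * exp (\<Theta> 1 / sqrt 2 * sqrt s)) \<longlongrightarrow> D * 2 powr (- 1/4)) at_top"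
  proof (rule tendsto_sandwich[OF _ _ tendsto_wkb_shift[OF G, of k] tendsto_wkb_shift[OF G, of "- k"]])
    show "eventually (\<lambda>s. G (s + k) * s powr (1/4) * exp (\<Theta> 1 / sqrt 2 * sqrt s) \<le> L s * s powr (1/4) * exp (\<Theta> 1 / sqrt 2 * sqrt s)) at_top"
      using lower by eventually_elim (intro mult_right_mono, auto)
    show "eventually (\<lambda>s. L s * s powr (1/4) * exp (\<Theta> 1 / sqrt 2 * sqrt s) \<le> G (s + - k) * s powr (1/4) * exp (\<Theta> 1 / sqrt 2 * sqrt s)) at_top"
      using upper by eventually_elim (intro mult_right_mono, auto)
  qed
  then show ?thesis by (simp only: L_def D_def)
qed

end

theorem theorem5:
  fixes M :: "'a measure" and U :: "real \<Rightarrow> 'a \<Rightarrow> real"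
    and \<alpha> \<theta> :: real and \<psi> :: "real \<Rightarrow> real"
  assumes "prob_space M"
    and "\<alpha> > 0"
    and "stationary_OU_process M \<alpha> U"
    and "\<And>t. t \<in> {0..1} \<Longrightarrow> \<psi> t > 0"
    and "twice_continuously_differentiable_on \<psi> {0..1}"
    and "\<theta> = (LBINT t:{0..1}. sqrt (\<psi> t))"
  shows "(\<lambda>\<epsilon>. measure M {\<omega> \<in> space M. weighted_norm \<psi> (\<lambda>t. U t \<omega>) \<le> \<epsilon>})
           \<sim>[at_right 0]
         (\<lambda>\<epsilon>. 8 * \<alpha> powr (1/2) * exp (\<alpha> / 2) /
               (pi powr (1/2) * \<theta> powr (3/2) * \<psi> 0 powr (1/8) * \<psi> 1 powr (1/8)) *
               \<epsilon>\<^sup>2 * exp (- (\<theta>\<^sup>2 / 8) * \<epsilon> powr (- 2)))"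
proof -
  note M = assms(1) and U = assms(3)
  interpret prob_space M by (rule M)
  obtain \<psi>' \<psi>'' where d: "\<And>x. x \<in> {0..1} \<Longrightarrow> (\<psi> has_real_derivative \<psi>' x) (at x within {0..1})"
    "\<And>x. x \<in> {0..1} \<Longrightarrow> (\<psi>' has_real_derivative \<psi>'' x) (at x within {0..1})" "continuous_on {0..1} \<psi>''"
    using assms(5) unfolding twice_continuously_differentiable_on_def by blast
  interpret W: wkb \<alpha> \<psi> \<psi>' \<psi>'' by (rule wkb.intro) (use assms(2,4) d in auto)
  have \<theta>: "\<theta> = W.\<Theta> 1"
  proof -
    have "set_integrable lborel {0..1} (\<lambda>t. sqrt (\<psi> t))"
      by (rule borel_integrable_atLeastAtMost') (intro continuous_intros W.cont_\<psi>)
    from set_borel_integral_eq_integral(2)[OF this] show ?thesis by (simp add: assms(6) W.\<Theta>_def)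
  qed
  have \<theta>0: "0 < \<theta>" using W.\<Theta>_1_pos \<theta> by simp
  \<comment> \<open>With this \<open>a\<close>, the exponent constant \<open>a^2 / 4\<close> of the
    Tauberian theorem is \<open>\<theta>^2 / 8\<close>.\<close>
  define a where "a = \<theta> / sqrt 2"
  have a: "0 < a" using \<theta>0 by (simp add: a_def)
  define X where "X \<omega> = energy \<psi> U \<omega>" for \<omega>
  have X[measurable]: "X \<in> borel_measurable M"
    unfolding X_def by (rule OU_weighted_integral(2)[OF M U W.cont_\<psi>])
  have X0: "0 \<le> X \<omega>" for \<omega>
    unfolding X_def set_lebesgue_integral_def using assms(4) by (intro integral_nonneg_AE AE_I2) (auto simp: indicator_def less_imp_le)
  define F where "F x = measure M {\<omega> \<in> space M. X \<omega> \<le> x}" for x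
  define L where "L s = (\<integral>\<omega>. exp (- s * X \<omega>) \<partial>M)" for s
  define C where "C = 2 * sqrt \<alpha> * exp (\<alpha> / 2) * \<psi> 0 powr (- 1/8) * \<psi> 1 powr (- 1/8) * 2 powr (- 1/4)"
  have p01: "0 < \<psi> 0" "0 < \<psi> 1" using assms(4) by auto
  have C: "0 < C" using assms(2) p01 by (simp add: C_def)
  have "mono F" unfolding F_def by (intro monoI finite_measure_mono) auto
  then have Fm: "F \<in> borel_measurable borel" by (rule borel_measurable_mono)
  have Lpos: "0 < L s" if "0 < s" for s
  proof -
    have "integrable M (\<lambda>\<omega>. exp (- s * X \<omega>))"
      by (rule integrable_const_bound[where B=1]) (use X0 that in auto)
    then have "(\<integral>\<omega>. 0 \<partial>M) < L s" unfolding L_def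
      by (intro integral_less_AE_space) (auto simp: emeasure_space_1)
    then show ?thesis by simp
  qed
  have "((\<lambda>x. F x / x * exp (a\<^sup>2 / (4 * x))) \<longlongrightarrow> C * (2 / a) powr (3 / 2) / sqrt pi) (at_right 0)"
  proof (rule log_concave_tauberian[where H = "\<lambda>s. L s / s", OF Fm _ _ _ _ a C])
    show "F x powr (1 - t) * F y powr t \<le> F ((1 - t) * x + t * y)" if "0 < t" "t < 1" for x y t
      unfolding F_def X_def by (rule OU_cdf_log_concave[OF M assms(2) U W.cont_\<psi> _ that]) (use assms(4) in \<open>auto intro: less_imp_le\<close>)
    show "has_bochner_integral lborel (\<lambda>x. exp (- s * x) * F x) (L s / s)" if "0 < s" for s
      unfolding F_def L_def by (rule laplace_of_cdf[OF M X X0 that])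
    have "((\<lambda>s. L s * s powr (1/4) * exp (a * sqrt s)) \<longlongrightarrow> C) at_top"
      using W.OU_laplace_asymptotics[OF M U] unfolding L_def X_def C_def a_def \<theta> .
    then show "((\<lambda>s. L s / s * s powr (5 / 4) * exp (a * sqrt s)) \<longlongrightarrow> C) at_top"
    proof (rule Lim_transform_eventually)
      show "eventually (\<lambda>s. L s * s powr (1/4) * exp (a * sqrt s) = L s / s * s powr (5 / 4) * exp (a * sqrt s)) at_top"
        using eventually_gt_at_top[of 0]
      proof eventually_elim
        case (elim s)
        have "s powr (5/4) = s powr (1 + 1/4)" by simp
        also have "\<dots> = s * s powr (1/4)" unfolding powr_add using elim by simp
        finally show ?case using elim by simp
      qed
    qed
  qed (use Lpos in \<open>auto simp: F_def\<close>)
  moreover have "filterlim (\<lambda>\<epsilon>::real. \<epsilon>\<^sup>2) (at_right 0) (at_right 0)" by real_asymp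
  ultimately have lim: "((\<lambda>\<epsilon>. F (\<epsilon>\<^sup>2) / \<epsilon>\<^sup>2 * exp (a\<^sup>2 / (4 * \<epsilon>\<^sup>2))) \<longlongrightarrow> C * (2 / a) powr (3 / 2) / sqrt pi) (at_right 0)"
    by (rule filterlim_compose)
  define B where "B = 8 * \<alpha> powr (1/2) * exp (\<alpha> / 2) / (pi powr (1/2) * \<theta> powr (3/2) * \<psi> 0 powr (1/8) * \<psi> 1 powr (1/8))"
  have B: "0 < B" using assms(2) \<theta>0 p01 by (simp add: B_def)
  \<comment> \<open>The 8 is a product of powers of two: 2 and \<open>2 powr (- 1/4)\<close> from
    \<open>C\<close>, and \<open>2 powr (9/4)\<close> from \<open>(2 / a) powr (3/2)\<close>,
    because \<open>2 / a = 2 powr (3/2) / \<theta>\<close>.\<close>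
  have CB: "C * (2 / a) powr (3 / 2) / sqrt pi = B"
  proof -
    have "2 / a = 2 powr (3/2) / \<theta>"
    proof -
      have "(2::real) powr (3/2) = 2 powr (1 + 1/2)" by simp
      also have "\<dots> = 2 * sqrt 2" unfolding powr_add by (simp add: powr_half_sqrt)
      finally show ?thesis by (simp add: a_def)
    qed
    then have "(2 / a) powr (3/2) = 2 powr (9/4) / \<theta> powr (3/2)"
      using \<theta>0 by (simp add: powr_divide powr_powr)
    moreover have "2 powr (9/4) * (2 * 2 powr (- 1/4)) = (8::real)"
    proof -
      have "2 powr (9/4) * (2 powr 1 * 2 powr (- 1/4)) = (2::real) powr 3" by (simp flip: powr_add)
      also have "\<dots> = 2 ^ 3" by (rule powr_numeral) simp
      finally show ?thesis by simp
    qed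
    moreover have "\<psi> 0 powr (- 1/8) = 1 / \<psi> 0 powr (1/8)" "\<psi> 1 powr (- 1/8) = 1 / \<psi> 1 powr (1/8)"
      by (simp_all add: powr_minus_divide)
    moreover have "sqrt \<alpha> = \<alpha> powr (1/2)" "sqrt pi = pi powr (1/2)"
      using assms(2) by (simp_all add: powr_half_sqrt)
    moreover have "2 * x * e * (1 / u) * (1 / v) * h * (g / z) / y = (g * (2 * h)) * x * e / (y * z * u * v)" for x e u v h g z y :: real
      by (simp add: mult_ac)
    ultimately show ?thesis unfolding C_def B_def by (simp only:)
  qed
  show ?thesis
  proof (rule asymp_equivI')
    have "((\<lambda>\<epsilon>. F (\<epsilon>\<^sup>2) / \<epsilon>\<^sup>2 * exp (a\<^sup>2 / (4 * \<epsilon>\<^sup>2)) / B) \<longlongrightarrow> B / B) (at_right 0)"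
      using lim B unfolding CB by (intro tendsto_divide tendsto_const) auto
    then have "((\<lambda>\<epsilon>. F (\<epsilon>\<^sup>2) / \<epsilon>\<^sup>2 * exp (a\<^sup>2 / (4 * \<epsilon>\<^sup>2)) / B) \<longlongrightarrow> 1) (at_right 0)" using B by simp
    then show "((\<lambda>\<epsilon>. measure M {\<omega> \<in> space M. weighted_norm \<psi> (\<lambda>t. U t \<omega>) \<le> \<epsilon>} /
         (8 * \<alpha> powr (1/2) * exp (\<alpha> / 2) /
               (pi powr (1/2) * \<theta> powr (3/2) * \<psi> 0 powr (1/8) * \<psi> 1 powr (1/8)) *
               \<epsilon>\<^sup>2 * exp (- (\<theta>\<^sup>2 / 8) * \<epsilon> powr (- 2)))) \<longlongrightarrow> 1) (at_right 0)"
    proof (rule Lim_transform_eventually)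
      have "eventually (\<lambda>\<epsilon>::real. 0 < \<epsilon>) (at_right 0)" by (rule eventually_at_right_less)
      then show "eventually (\<lambda>\<epsilon>. F (\<epsilon>\<^sup>2) / \<epsilon>\<^sup>2 * exp (a\<^sup>2 / (4 * \<epsilon>\<^sup>2)) / B = measure M {\<omega> \<in> space M. weighted_norm \<psi> (\<lambda>t. U t \<omega>) \<le> \<epsilon>} /
         (8 * \<alpha> powr (1/2) * exp (\<alpha> / 2) /
               (pi powr (1/2) * \<theta> powr (3/2) * \<psi> 0 powr (1/8) * \<psi> 1 powr (1/8)) *
               \<epsilon>\<^sup>2 * exp (- (\<theta>\<^sup>2 / 8) * \<epsilon> powr (- 2)))) (at_right 0)"
      proof eventually_elim
        case (elim \<epsilon>)
        have "weighted_norm \<psi> (\<lambda>t. U t \<omega>) \<le> \<epsilon> \<longleftrightarrow> X \<omega> \<le> \<epsilon>\<^sup>2" for \<omega>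
        proof -
          have "weighted_norm \<psi> (\<lambda>t. U t \<omega>) = sqrt (X \<omega>)" by (simp add: weighted_norm_def X_def mult.commute)
          moreover have "\<epsilon> = sqrt (\<epsilon>\<^sup>2)" using elim by simp
          ultimately show ?thesis by (metis real_sqrt_le_iff)
        qed
        then have 1: "measure M {\<omega> \<in> space M. weighted_norm \<psi> (\<lambda>t. U t \<omega>) \<le> \<epsilon>} = F (\<epsilon>\<^sup>2)" by (simp add: F_def)
        have "\<epsilon> powr (- 2) = 1 / \<epsilon>\<^sup>2" using elim by (simp add: powr_minus_divide)
        then have "- (\<theta>\<^sup>2 / 8) * \<epsilon> powr (- 2) = - (a\<^sup>2 / (4 * \<epsilon>\<^sup>2))"
          by (simp add: a_def power_divide)
        then have 2: "exp (- (\<theta>\<^sup>2 / 8) * \<epsilon> powr (- 2)) = 1 / exp (a\<^sup>2 / (4 * \<epsilon>\<^sup>2))"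
          by (simp only: exp_minus inverse_eq_divide)
        show ?case unfolding 1 2 B_def[symmetric] by simp
      qed
    qed
  qed
qed

end
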